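(* Let $a>0$, $\Omega=(0,a)\times(0,a)\subset\mathbb{R}^2$, $m\ge 2$, let $f_1,\dots,f_m$ be admissible internal dynamics and $\phi_1,\dots,\phi_m$ admissible boundary data (as defined in the context), and assume that each $f_l(z,s)$ is nondecreasing with respect to the variable $s$. Let $(u_1,\dots,u_m)\in S$ be an exact minimizer of $E$ over $S$ and suppose that each component $u_l\in C^2(\Omega)$, $l=1,\dots,m$. For each positive integer $N$, with $h=a/N$, let $(u_h^1,\dots,u_h^m)$ be a solution of the discrete system (finite difference scheme) on $\Omega_h$. Then, for every $l=1,2,\dots,m$, $$u_h^l\to u_l\quad\text{whenever } h\to 0 .$$
   Context: Setting. $\Omega=(0,a)\times(0,a)$, $m\ge2$ is an integer. Admissible internal dynamics: for each $i$, $f_i:\Omega\times[0,\infty)\to\mathbb{R}$ is Lipschitz continuous in $s$, uniformly continuous in $x$, and $f_i(x,0)\equiv 0$; $f_i$ is extended to $s\le 0$ by $f_i(x,s)=-f_i(x,-s)$. Alternatively, the case where the dynamics do not depend on $s$, $f_i(x,s)=f_i(x)$, is also allowed; in that case the assumption is instead that for all $i$ the function $f_i$ is nonnegative and uniformly continuous in $x$. Set $F_i(x,s)=\int_0^s f_i(x,v)\,dv$ for $s\ge 0$ (extended evenly in $s$). Admissible boundary data: $\phi_i\in H^{1/2}(\partial\Omega)$, $\phi_i\ge 0$, $\phi_i\cdot\phi_j=0$ on $\partial\Omega$ for $i\ne j$; each $\phi_i$ is extended by zero outside $\partial\Omega$. Functional and constraint set: $$E(u_1,\dots,u_m)=\int_\Omega\sum_{i=1}^m\Big(\tfrac12|\nabla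 u_i|^2+F_i(x,u_i)\Big)dx,$$ $$S=\{(u_1,\dots,u_m)\in (W^{1,2}(\Omega))^m:\ u_i\ge 0,\ u_i\cdot u_j=0 \text{ a.e. in } \Omega \text{ for } i\neq j,\ u_i=\phi_i \text{ on }\partial\Omega\}.$$ Mesh: $h=a/N$, $\Omega_h=\{(ih,jh):0\le i,j\le N\}$, $\Omega_h^o=\{(ih,jh):1\le i,j\le N-1\}$, $\partial\Omega_h=\Omega_h\setminus\Omega_h^o$. Discrete system (finite difference scheme): functions $u_h^1,\dots,u_h^m:\Omega_h\to\mathbb{R}$ with, for every $l=1,\dots,m$, $$u_h^l(z)=\max\Big(-\tfrac{h^2}{4}f_l(z,u_h^l(z))+\overline u_h^l(z)-\sum_{p\ne l}\overline u_h^p(z),\,0\Big)\ \ (z\in\Omega_h^o),\qquad u_h^l(z)=\phi_l(z)\ \ (z\in\partial\Omega_h),$$ where $\overline u_h^l(z)$ is the average of $u_h^l$ over the four nearest mesh neighbours of $z$. Mode of convergence: the statement itself does not name one. The result is described as pointwise convergence of the scheme, and it is deduced from a bound on $\|u_l-u_h^l\|_{L^\infty(\Omega_h)}=\max_{z\in\Omega_h}|u_l(z)-u_h^l(z)|$.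
   Formalization: The boundary data φ_i are assumed continuous on ∂Ω in addition to lying in H^{1/2}(∂Ω): the scheme uses values of φ_i at individual nodes, which an H^{1/2} class does not define, and for arbitrary representatives the claim is false. *)

theory Defs
  imports "HOL-Analysis.Analysis"
begin

definition square :: "real \<Rightarrow> (real \<times> real) set" where
  "square a = {0<..<a} \<times> {0<..<a}"

section \<open>Differentiability classes\<close>

definition D1 :: "(real \<times> real \<Rightarrow> real) \<Rightarrow> real \<times> real \<Rightarrow> real" where
  "D1 f z = frechet_derivative f (at z) (1, 0)"

definition D2 :: "(real \<times> real \<Rightarrow> real) \<Rightarrow> real \<times> real \<Rightarrow> real" where
  "D2 f z = frechet_derivative f (at z) (0, 1)"

definition grad :: "(real \<times> real \<Rightarrow> real) \<Rightarrow> real \<times> real \<Rightarrow> real \<times> real" where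
  "grad f z = (D1 f z, D2 f z)"

text \<open>The set \<open>S\<close> is meant to be open.\<close>

fun Ck_on :: "nat \<Rightarrow> (real \<times> real) set \<Rightarrow> (real \<times> real \<Rightarrow> real) \<Rightarrow> bool" where
  "Ck_on 0 S f \<longleftrightarrow> continuous_on S f"
| "Ck_on (Suc k) S f \<longleftrightarrow>
     (\<forall>z\<in>S. f differentiable (at z)) \<and> Ck_on k S (D1 f) \<and> Ck_on k S (D2 f)"

section \<open>The Sobolev space of order one on the square\<close>

definition L2 :: "'a measure \<Rightarrow> ('a \<Rightarrow> 'b::euclidean_space) set" where
  "L2 M = {f \<in> borel_measurable M. integrable M (\<lambda>x. (norm (f x))\<^sup>2)}"

definition test_function :: "real \<Rightarrow> (real \<times> real \<Rightarrow> real) \<Rightarrow> bool" where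
  "test_function a \<psi> \<longleftrightarrow>
     Ck_on 1 UNIV \<psi> \<and> compact (closure {z. \<psi> z \<noteq> 0}) \<and> closure {z. \<psi> z \<noteq> 0} \<subseteq> square a"

definition weak_gradient ::
    "real \<Rightarrow> (real \<times> real \<Rightarrow> real) \<Rightarrow> (real \<times> real \<Rightarrow> real \<times> real) \<Rightarrow> bool" where
  "weak_gradient a u g \<longleftrightarrow>
     g \<in> L2 (lebesgue_on (square a)) \<and>
     (\<forall>\<psi>. test_function a \<psi> \<longrightarrow>
        (LINT z|lebesgue_on (square a). u z *\<^sub>R grad \<psi> z) =
        - (LINT z|lebesgue_on (square a). \<psi> z *\<^sub>R g z))"

definition W12 :: "real \<Rightarrow> (real \<times> real \<Rightarrow> real) set" where
  "W12 a = {u \<in> L2 (lebesgue_on (square a)). \<exists>g. weak_gradient a u g}"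

text \<open>A weak gradient is determined up to null sets, so the choice below does not affect
  any integral in which it occurs.\<close>

definition wgrad :: "real \<Rightarrow> (real \<times> real \<Rightarrow> real) \<Rightarrow> real \<times> real \<Rightarrow> real \<times> real" where
  "wgrad a u = (SOME g. weak_gradient a u g)"

section \<open>Boundary values\<close>

text \<open>Arc-length parametrisation of the boundary of the square on \<open>[0, 4a)\<close>, and the
  arc-length measure it induces.\<close>

definition perimeter :: "real \<Rightarrow> real \<Rightarrow> real \<times> real" where
  "perimeter a t =
     (if t \<le> a then (t, 0)
      else if t \<le> 2 * a then (a, t - a)
      else if t \<le> 3 * a then (3 * a - t, a)
      else (0, 4 * a - t))"

definition boundary_measure :: "real \<Rightarrow> (real \<times> real) measure" where
  "boundary_measure a = distr (restrict_space lborel {0..<4 * a}) borel (perimeter a)"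

text \<open>Sobolev-Slobodeckij norm: the exponent of the distance is \<open>(n - 1) + 2 s\<close> with
  \<open>n = 2\<close> and \<open>s = 1/2\<close>.\<close>

definition H_half :: "real \<Rightarrow> (real \<times> real \<Rightarrow> real) set" where
  "H_half a = {\<phi> \<in> L2 (boundary_measure a).
     (\<integral>\<^sup>+ z. (\<integral>\<^sup>+ w. ennreal ((\<phi> z - \<phi> w)\<^sup>2 / (dist z w)\<^sup>2)
        \<partial>boundary_measure a) \<partial>boundary_measure a) < \<infinity>}"

text \<open>\<open>\<phi>\<close> is the trace of \<open>u\<close>: the trace operator is the continuous extension, from
  \<open>W\<^sup>1\<^sup>,\<^sup>2\<close> of the square to \<open>L\<^sup>2\<close> of its boundary, of the restriction map on
  functions that are \<open>C\<^sup>1\<close> up to the boundary.\<close>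

definition has_trace ::
    "real \<Rightarrow> (real \<times> real \<Rightarrow> real) \<Rightarrow> (real \<times> real \<Rightarrow> real) \<Rightarrow> bool" where
  "has_trace a u \<phi> \<longleftrightarrow>
     u \<in> W12 a \<and> \<phi> \<in> L2 (boundary_measure a) \<and>
     (\<exists>v :: nat \<Rightarrow> real \<times> real \<Rightarrow> real.
        (\<forall>k. Ck_on 1 UNIV (v k)) \<and>
        (\<lambda>k. LINT z|lebesgue_on (square a). (v k z - u z)\<^sup>2) \<longlonglongrightarrow> 0 \<and>
        (\<lambda>k. LINT z|lebesgue_on (square a). (norm (grad (v k) z - wgrad a u z))\<^sup>2) \<longlonglongrightarrow> 0 \<and>
        (\<lambda>k. LINT z|boundary_measure a. (v k z - \<phi> z)\<^sup>2) \<longlonglongrightarrow> 0)"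

section \<open>Data of the segregation problem\<close>

text \<open>The components are indexed by \<open>{1..m}\<close>. The first alternative describes dynamics
  depending on \<open>s\<close>, the second one dynamics independent of \<open>s\<close>.\<close>

definition admissible_dynamics ::
    "real \<Rightarrow> nat \<Rightarrow> (nat \<Rightarrow> real \<times> real \<Rightarrow> real \<Rightarrow> real) \<Rightarrow> bool" where
  "admissible_dynamics a m f \<longleftrightarrow>
     (\<forall>i\<in>{1..m}.
        (\<exists>L. \<forall>x\<in>square a. L-lipschitz_on {0..} (f i x)) \<and>
        (\<forall>s\<ge>0. uniformly_continuous_on (square a) (\<lambda>x. f i x s)) \<and>
        (\<forall>x\<in>square a. f i x 0 = 0) \<and>
        (\<forall>x\<in>square a. \<forall>s\<le>0. f i x s = - f i x (- s)))
   \<or> (\<forall>i\<in>{1..m}.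
        (\<forall>x\<in>square a. \<forall>s. f i x s = f i x 0) \<and>
        (\<forall>x\<in>square a. \<forall>s. f i x s \<ge> 0) \<and>
        (\<forall>s. uniformly_continuous_on (square a) (\<lambda>x. f i x s)))"

text \<open>The difference scheme evaluates \<open>\<phi> i\<close> at individual boundary nodes, which is
  meaningless for a class of functions modulo null sets; the boundary data are therefore
  represented by continuous functions.\<close>

definition admissible_boundary_data ::
    "real \<Rightarrow> nat \<Rightarrow> (nat \<Rightarrow> real \<times> real \<Rightarrow> real) \<Rightarrow> bool" where
  "admissible_boundary_data a m \<phi> \<longleftrightarrow>
     (\<forall>i\<in>{1..m}.
        \<phi> i \<in> H_half a \<and>
        continuous_on (frontier (square a)) (\<phi> i) \<and>
        (\<forall>z\<in>frontier (square a). \<phi> i z \<ge> 0) \<and>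
        (\<forall>z. z \<notin> frontier (square a) \<longrightarrow> \<phi> i z = 0)) \<and>
     (\<forall>i\<in>{1..m}. \<forall>j\<in>{1..m}. i \<noteq> j \<longrightarrow> (\<forall>z\<in>frontier (square a). \<phi> i z * \<phi> j z = 0))"

definition primitive ::
    "(real \<times> real \<Rightarrow> real \<Rightarrow> real) \<Rightarrow> real \<times> real \<Rightarrow> real \<Rightarrow> real" where
  "primitive f x s = integral {0..\<bar>s\<bar>} (f x)"

definition energy ::
    "real \<Rightarrow> nat \<Rightarrow> (nat \<Rightarrow> real \<times> real \<Rightarrow> real \<Rightarrow> real) \<Rightarrow> (nat \<Rightarrow> real \<times> real \<Rightarrow> real) \<Rightarrow> real" where
  "energy a m f u =
     (LINT z|lebesgue_on (square a).
        (\<Sum>i=1..m. 1/2 * (norm (wgrad a (u i) z))\<^sup>2 + primitive (f i) z (u i z)))"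

text \<open>The trace condition does not see the values of \<open>u i\<close> on the boundary, a null set;
  the pointwise boundary condition only normalises the representative, so that \<open>u i\<close> can
  be evaluated at boundary nodes.\<close>

definition constraint_set ::
    "real \<Rightarrow> nat \<Rightarrow> (nat \<Rightarrow> real \<times> real \<Rightarrow> real) \<Rightarrow> (nat \<Rightarrow> real \<times> real \<Rightarrow> real) set" where
  "constraint_set a m \<phi> =
     {u. (\<forall>i\<in>{1..m}.
            u i \<in> W12 a \<and>
            (AE z in lebesgue_on (square a). u i z \<ge> 0) \<and>
            has_trace a (u i) (\<phi> i) \<and>
            (\<forall>z\<in>frontier (square a). u i z = \<phi> i z)) \<and>
         (\<forall>i\<in>{1..m}. \<forall>j\<in>{1..m}. i \<noteq> j \<longrightarrow>
            (AE z in lebesgue_on (square a). u i z * u j z = 0))}"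

definition minimizer ::
    "real \<Rightarrow> nat \<Rightarrow> (nat \<Rightarrow> real \<times> real \<Rightarrow> real \<Rightarrow> real) \<Rightarrow> (nat \<Rightarrow> real \<times> real \<Rightarrow> real) \<Rightarrow>
     (nat \<Rightarrow> real \<times> real \<Rightarrow> real) \<Rightarrow> bool" where
  "minimizer a m f \<phi> u \<longleftrightarrow>
     u \<in> constraint_set a m \<phi> \<and>
     (\<forall>v\<in>constraint_set a m \<phi>. energy a m f u \<le> energy a m f v)"

section \<open>The finite difference scheme\<close>

definition mesh :: "real \<Rightarrow> nat \<Rightarrow> (real \<times> real) set" where
  "mesh a N = {(real i * (a / real N), real j * (a / real N)) | i j. i \<le> N \<and> j \<le> N}"

definition mesh_interior :: "real \<Rightarrow> nat \<Rightarrow> (real \<times> real) set" where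
  "mesh_interior a N =
     {(real i * (a / real N), real j * (a / real N)) | i j. 1 \<le> i \<and> i < N \<and> 1 \<le> j \<and> j < N}"

definition mesh_boundary :: "real \<Rightarrow> nat \<Rightarrow> (real \<times> real) set" where
  "mesh_boundary a N = mesh a N - mesh_interior a N"

definition neighbour_average :: "real \<Rightarrow> (real \<times> real \<Rightarrow> real) \<Rightarrow> real \<times> real \<Rightarrow> real" where
  "neighbour_average h v z = (v (z + (h, 0)) + v (z - (h, 0)) + v (z + (0, h)) + v (z - (0, h))) / 4"

definition discrete_solution ::
    "real \<Rightarrow> nat \<Rightarrow> (nat \<Rightarrow> real \<times> real \<Rightarrow> real \<Rightarrow> real) \<Rightarrow> (nat \<Rightarrow> real \<times> real \<Rightarrow> real) \<Rightarrow>
     nat \<Rightarrow> (nat \<Rightarrow> real \<times> real \<Rightarrow> real) \<Rightarrow> bool" where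
  "discrete_solution a m f \<phi> N U \<longleftrightarrow>
     (let h = a / real N in
      \<forall>l\<in>{1..m}.
        (\<forall>z\<in>mesh_interior a N.
           U l z = max (- (h\<^sup>2 / 4) * f l z (U l z) + neighbour_average h (U l) z
                        - (\<Sum>p\<in>{1..m} - {l}. neighbour_average h (U p) z)) 0) \<and>
        (\<forall>z\<in>mesh_boundary a N. U l z = \<phi> l z))"

end

theory Submission
  imports Defs
begin

text \<open>
  Convergence rests on three facts: the minimizer solves, pointwise and component by component, the
  same relations as the solutions of the scheme; these relations admit a comparison principle; and
  near the boundary both the minimizer and the discrete solutions are close to the boundary data,
  uniformly in the mesh width.

  For a family of nonnegative functions of which at most one is nonzero at each point, the
  \<^emph>\<open>excess\<close> of the component \<open>l\<close> is that component minus the sum of all others. Perturbing \<open>u l\<close>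
  inside \<open>{u l > 0}\<close> shows that its Laplacian is \<open>f l\<close> there (\<open>euler_lagrange\<close>). At a zero of
  \<open>u l\<close> the Laplacian, being continuous, is either a limit of such values or the Laplacian of the
  zero function; as \<open>f l\<close> is nonnegative, it lies between \<open>0\<close> and \<open>f l\<close> everywhere
  (\<open>laplacian_bounds\<close>). Hence the Laplacian of the excess of \<open>u l\<close> is at most \<open>f l\<close>, with equality
  where \<open>u l > 0\<close>. The formula with the maximum that defines the scheme says precisely this about
  the discrete Laplacian (\<open>discrete_laplacian_excess_eq\<close>, \<open>discrete_laplacian_excess_le\<close>).

  For two such families consider the sum of the distances between their components. At every
  point where it is positive it coincides with the difference of the excesses of some component,
  taken with a favourable sign (\<open>deviation_attained\<close>). Monotonicity of \<open>f l\<close> therefore makes it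
  discretely subharmonic up to the consistency error, and it is bounded by its values in a boundary
  layer (\<open>discrete_comparison\<close>). Away from the boundary the consistency error tends to zero because
  the second derivatives of \<open>u l\<close> are uniformly continuous on compact subsets; in the layer they need
  not even be bounded, and the boundary values have to be compared directly.

  For the scheme this is done with quadratic barriers, on which the discrete Laplacian is exact
  (\<open>boundary_barrier\<close>, \<open>scheme_boundary_values\<close>). The minimizer takes its boundary values only as
  traces. Here a Poincare inequality in a strip of width \<open>d\<close> along a side bounds the mean square of
  \<open>u l - \<phi> l\<close> on a square of size comparable to \<open>d\<close> by a multiple of the Dirichlet energy in the strip
  (\<open>trace_strip\<close>); in dimension two no power of \<open>d\<close> remains, and the energy in the strip tends to
  zero with \<open>d\<close>. A mean value inequality for subharmonic functions (\<open>subharmonic_le_mean\<close>) turns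
  this into a pointwise estimate (\<open>boundary_values\<close>). In particular \<open>u l\<close> is continuous up to the
  boundary.
\<close>

section \<open>Geometry of the square and of the mesh\<close>

lemma square_eq_box: "square a = box (0, 0) (a, a)"
  by (auto simp: square_def box_def Basis_prod_def)

lemma mem_cbox_pair:
  fixes x y :: real
  shows "(x, y) \<in> cbox (\<alpha>, \<gamma>) (\<beta>, \<delta>) \<longleftrightarrow> \<alpha> \<le> x \<and> x \<le> \<beta> \<and> \<gamma> \<le> y \<and> y \<le> \<delta>"
  by (auto simp: cbox_Pair_eq)

lemma square_iff: "(x, y) \<in> square a \<longleftrightarrow> 0 < x \<and> x < a \<and> 0 < y \<and> y < a"
  by (auto simp: square_def)

lemma open_square: "open (square a)"
  by (simp add: square_eq_box open_box)

lemma frontier_square: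
  assumes "a > 0"
  shows "frontier (square a) = cbox (0, 0) (a, a) - square a"
proof -
  have "(a/2, a/2) \<in> square a"
    using assms by (simp add: square_iff)
  then show ?thesis
    unfolding square_eq_box frontier_box by auto
qed

lemma compact_frontier_square: "compact (frontier (square a))"
  unfolding square_eq_box by (intro compact_frontier_bounded bounded_box)

lemma closed_square_cases:
  assumes "a > 0" "z \<in> cbox (0, 0) (a, a)"
  obtains "z \<in> square a" | "z \<in> frontier (square a)"
  using assms frontier_square by blast

lemma finite_mesh: "finite (mesh a N)"
proof -
  have "mesh a N = (\<lambda>(i, j). (real i * (a / real N), real j * (a / real N))) ` ({..N} \<times> {..N})"
    by (auto simp: mesh_def)
  then show ?thesis by simp
qed

lemma mesh_nonempty: "mesh a N \<noteq> {}"
  by (auto simp: mesh_def)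

lemma mesh_interior_subset: "mesh_interior a N \<subseteq> mesh a N"
  by (force simp: mesh_def mesh_interior_def)

lemma mesh_index_le:
  assumes "a > 0" "i \<le> N"
  shows "real i * (a / real N) \<le> a"
proof (cases "N = 0")
  case True
  then show ?thesis using assms by simp
next
  case False
  then show ?thesis using assms by (simp add: field_simps)
qed

lemma mesh_subset_closed_square:
  assumes "a > 0"
  shows "mesh a N \<subseteq> cbox (0, 0) (a, a)"
  using assms mesh_index_le by (auto simp: mesh_def cbox_Pair_eq)

lemma mesh_interior_subset_square:
  assumes "a > 0"
  shows "mesh_interior a N \<subseteq> square a"
  using assms by (auto simp: mesh_interior_def square_iff field_simps)

lemma mesh_boundary_subset_frontier:
  assumes "a > 0" "N \<ge> 1"
  shows "mesh_boundary a N \<subseteq> frontier (square a)"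
proof
  fix z assume z: "z \<in> mesh_boundary a N"
  then obtain i j where ij: "i \<le> N" "j \<le> N" "z = (real i * (a / real N), real j * (a / real N))"
    by (auto simp: mesh_boundary_def mesh_def)
  have "z \<notin> square a"
  proof
    assume "z \<in> square a"
    then have "0 < i" "i < N" "0 < j" "j < N"
      using ij assms by (auto simp: square_iff field_simps zero_less_mult_iff)
    then have "z \<in> mesh_interior a N"
      using ij unfolding mesh_interior_def by (intro CollectI exI[of _ i] exI[of _ j]) simp
    then show False using z unfolding mesh_boundary_def by blast
  qed
  moreover have "z \<in> mesh a N" using z by (simp add: mesh_boundary_def)
  ultimately show "z \<in> frontier (square a)"
    using mesh_subset_closed_square[OF assms(1), of N] frontier_square[OF assms(1)] by auto
qed

lemma mesh_cases:
  assumes "z \<in> mesh a N"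
  obtains "z \<in> mesh_interior a N" | "z \<in> mesh_boundary a N"
  using assms by (auto simp: mesh_boundary_def)

lemma mesh_neighbours:
  assumes "z \<in> mesh_interior a N"
  defines "h \<equiv> a / real N"
  shows "z + (h, 0) \<in> mesh a N" "z - (h, 0) \<in> mesh a N" "z + (0, h) \<in> mesh a N" "z - (0, h) \<in> mesh a N"
proof -
  obtain i j where ij: "1 \<le> i" "i < N" "1 \<le> j" "j < N" "z = (real i * h, real j * h)"
    using assms by (auto simp: mesh_interior_def)
  have memI: "(real i' * h, real j' * h) \<in> mesh a N" if "i' \<le> N" "j' \<le> N" for i' j'
    using that by (auto simp: mesh_def h_def)
  have "z + (h, 0) = (real (i + 1) * h, real j * h)" "z - (h, 0) = (real (i - 1) * h, real j * h)"
    "z + (0, h) = (real i * h, real (j + 1) * h)" "z - (0, h) = (real i * h, real (j - 1) * h)"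
    using ij by (auto simp: algebra_simps of_nat_diff)
  moreover have "i + 1 \<le> N" "i - 1 \<le> N" "j + 1 \<le> N" "j - 1 \<le> N" "i \<le> N" "j \<le> N"
    using ij by auto
  ultimately show "z + (h, 0) \<in> mesh a N" "z - (h, 0) \<in> mesh a N" "z + (0, h) \<in> mesh a N" "z - (0, h) \<in> mesh a N"
    by (simp_all only: memI)
qed

section \<open>The discrete Laplacian\<close>

definition discrete_laplacian :: "real \<Rightarrow> (real \<times> real \<Rightarrow> real) \<Rightarrow> real \<times> real \<Rightarrow> real" where
  "discrete_laplacian h v z = (4 / h\<^sup>2) * (neighbour_average h v z - v z)"

lemma neighbour_average_add:
  "neighbour_average h (\<lambda>z. v z + w z) z = neighbour_average h v z + neighbour_average h w z"
  by (simp add: neighbour_average_def field_simps)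

lemma neighbour_average_diff:
  "neighbour_average h (\<lambda>z. v z - w z) z = neighbour_average h v z - neighbour_average h w z"
  by (simp add: neighbour_average_def field_simps)

lemma neighbour_average_cmult:
  "neighbour_average h (\<lambda>z. c * v z) z = c * neighbour_average h v z"
  by (simp add: neighbour_average_def field_simps)

lemma neighbour_average_const: "neighbour_average h (\<lambda>z. c) z = c"
  by (simp add: neighbour_average_def)

lemma neighbour_average_sum:
  "neighbour_average h (\<lambda>z. \<Sum>i\<in>I. v i z) z = (\<Sum>i\<in>I. neighbour_average h (v i) z)"
  by (simp add: neighbour_average_def sum.distrib flip: sum_divide_distrib)

lemma neighbour_average_norm_square:
  "neighbour_average h (\<lambda>z. (fst z)\<^sup>2 + (snd z)\<^sup>2) z = (fst z)\<^sup>2 + (snd z)\<^sup>2 + h\<^sup>2"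
  by (cases z) (simp add: neighbour_average_def field_simps power2_eq_square)

lemma neighbour_average_mono:
  assumes "z \<in> mesh_interior a N" "\<And>w. w \<in> mesh a N \<Longrightarrow> u w \<le> v w"
  shows "neighbour_average (a / real N) u z \<le> neighbour_average (a / real N) v z"
  using assms(2)[OF mesh_neighbours(1)[OF assms(1)]] assms(2)[OF mesh_neighbours(2)[OF assms(1)]]
    assms(2)[OF mesh_neighbours(3)[OF assms(1)]] assms(2)[OF mesh_neighbours(4)[OF assms(1)]]
  by (simp add: neighbour_average_def)

text \<open>The alternative \<open>v z \<le> K\<close> at interior nodes confines the strict subharmonicity to those nodes at
  which an equation is available.\<close>

lemma discrete_maximum_principle:
  assumes "\<And>z. z \<in> mesh_boundary a N \<Longrightarrow> v z \<le> K"
    and "\<And>z. z \<in> mesh_interior a N \<Longrightarrow> v z \<le> K \<or> v z < neighbour_average (a / real N) v z"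
    and "z \<in> mesh a N"
  shows "v z \<le> K"
proof -
  have "Max (v ` mesh a N) \<in> v ` mesh a N"
    using finite_mesh mesh_nonempty by (intro Max_in) auto
  then obtain z0 where z0: "z0 \<in> mesh a N" "v z0 = Max (v ` mesh a N)" by auto
  have le: "v w \<le> v z0" if "w \<in> mesh a N" for w
    unfolding z0(2) using that finite_mesh by (intro Max_ge) auto
  have "v z0 \<le> K"
    using z0(1)
  proof (cases rule: mesh_cases)
    case 1
    have "neighbour_average (a / real N) v z0 \<le> v z0"
      using neighbour_average_mono[OF 1, of v "\<lambda>_. v z0"] le by (simp add: neighbour_average_const)
    then show ?thesis using assms(2)[OF 1] by auto
  next
    case 2
    then show ?thesis by (rule assms(1))
  qed
  then show ?thesis using le[OF assms(3)] by simp
qed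

section \<open>Segregated families\<close>

text \<open>Where \<open>U l > 0\<close> in a segregated family the excess is \<open>U l\<close> itself, elsewhere it is minus the
  component that is nonzero, if there is one.\<close>

definition excess :: "nat \<Rightarrow> (nat \<Rightarrow> 'a \<Rightarrow> real) \<Rightarrow> nat \<Rightarrow> 'a \<Rightarrow> real" where
  "excess m U l z = U l z - (\<Sum>p\<in>{1..m} - {l}. U p z)"

definition segregated_at :: "nat \<Rightarrow> (nat \<Rightarrow> 'a \<Rightarrow> real) \<Rightarrow> 'a \<Rightarrow> bool" where
  "segregated_at m U z \<longleftrightarrow> (\<forall>l\<in>{1..m}. U l z \<ge> 0) \<and>
     (\<forall>l\<in>{1..m}. \<forall>p\<in>{1..m}. l \<noteq> p \<longrightarrow> U l z * U p z = 0)"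

lemma segregated_at_nonneg: "segregated_at m U z \<Longrightarrow> l \<in> {1..m} \<Longrightarrow> U l z \<ge> 0"
  by (simp add: segregated_at_def)

lemma segregated_at_eq_0:
  assumes "segregated_at m U z" "l \<in> {1..m}" "U l z > 0" "p \<in> {1..m} - {l}"
  shows "U p z = 0"
proof -
  have "U l z * U p z = 0"
    using assms(1,2,4) by (auto simp: segregated_at_def simp del: mult_eq_0_iff)
  then show ?thesis using assms(3) by simp
qed

definition deviation :: "nat \<Rightarrow> (nat \<Rightarrow> 'a \<Rightarrow> real) \<Rightarrow> (nat \<Rightarrow> 'a \<Rightarrow> real) \<Rightarrow> 'a \<Rightarrow> real" where
  "deviation m U W z = (\<Sum>l\<in>{1..m}. \<bar>U l z - W l z\<bar>)"

lemma excess_diff_le_deviation: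
  assumes "l \<in> {1..m}"
  shows "excess m U l z - excess m W l z \<le> deviation m U W z"
proof -
  have "excess m U l z - excess m W l z = (U l z - W l z) + (\<Sum>p\<in>{1..m} - {l}. W p z - U p z)"
    by (simp add: excess_def sum_subtractf)
  also have "\<dots> \<le> \<bar>U l z - W l z\<bar> + (\<Sum>p\<in>{1..m} - {l}. \<bar>U p z - W p z\<bar>)"
    by (intro add_mono sum_mono) auto
  also have "\<dots> = deviation m U W z"
    using assms by (simp add: deviation_def sum.remove)
  finally show ?thesis .
qed

text \<open>The strict inequality forces \<open>U l > 0\<close>, so that every other component of \<open>U\<close> vanishes. All terms
  in the difference of the excesses then have the same sign and nothing cancels.\<close>

lemma excess_diff_eq_deviation:
  assumes "segregated_at m U z" "segregated_at m W z" "l \<in> {1..m}" "U l z > W l z"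
  shows "excess m U l z - excess m W l z = deviation m U W z"
proof -
  have pos: "U l z > 0" using segregated_at_nonneg[OF assms(2,3)] assms(4) by linarith
  have 0: "U p z = 0" "W p z \<ge> 0" if "p \<in> {1..m} - {l}" for p
    using segregated_at_eq_0[OF assms(1,3) pos that] segregated_at_nonneg[OF assms(2), of p] that by simp_all
  have "deviation m U W z = \<bar>U l z - W l z\<bar> + (\<Sum>p\<in>{1..m} - {l}. \<bar>U p z - W p z\<bar>)"
    using assms(3) by (simp add: deviation_def sum.remove)
  also have "\<dots> = (U l z - W l z) + (\<Sum>p\<in>{1..m} - {l}. W p z - U p z)"
    using 0 assms(4) by simp
  finally show ?thesis by (simp add: excess_def sum_subtractf)
qed

lemma deviation_commute: "deviation m U W z = deviation m W U z"
  by (simp add: deviation_def abs_minus_commute)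

lemma deviation_attained:
  assumes "segregated_at m U z" "segregated_at m W z" "deviation m U W z > 0"
  obtains l where "l \<in> {1..m}" "U l z > W l z" "excess m U l z - excess m W l z = deviation m U W z"
  | l where "l \<in> {1..m}" "W l z > U l z" "excess m W l z - excess m U l z = deviation m U W z"
proof -
  obtain l where l: "l \<in> {1..m}" "U l z \<noteq> W l z"
  proof (rule ccontr)
    assume "\<not> thesis"
    then have "deviation m U W z = 0"
      using that unfolding deviation_def by (intro sum.neutral ballI) fastforce
    then show False using assms(3) by simp
  qed
  show ?thesis
  proof (cases "U l z > W l z")
    case True
    then show ?thesis using that(1) l excess_diff_eq_deviation[OF assms(1,2)] by blast
  next
    case False
    then show ?thesis
      using that(2)[of l] l excess_diff_eq_deviation[OF assms(2,1), of l] deviation_commute[of m U W z] by auto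
  qed
qed

lemma excess_le: 
  assumes "segregated_at m U z"
  shows "excess m U l z \<le> U l z"
proof -
  have "(\<Sum>p\<in>{1..m} - {l}. U p z) \<ge> 0"
    using segregated_at_nonneg[OF assms] by (intro sum_nonneg) simp
  then show ?thesis by (simp add: excess_def)
qed

lemma excess_eq_if_pos:
  assumes "segregated_at m U z" "l \<in> {1..m}" "U l z > 0"
  shows "excess m U l z = U l z"
proof -
  have "(\<Sum>p\<in>{1..m} - {l}. U p z) = 0"
    using segregated_at_eq_0[OF assms] by (intro sum.neutral) blast
  then show ?thesis by (simp add: excess_def)
qed

section \<open>Stability of the scheme\<close>

text \<open>By \<open>deviation_attained\<close> the deviation is touched from below, at any node where it is positive, by a
  difference of excesses; the equations and the monotonicity of \<open>F\<close> bound the discrete Laplacian of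
  that difference by \<open>- \<tau>\<close> from below. Adding \<open>\<kappa> \<bar>z\<bar>\<^sup>2\<close>, whose discrete Laplacian is \<open>4 \<kappa>\<close>, makes the sum
  strictly subharmonic, and its maximum is attained where no equation is assumed.\<close>

theorem discrete_comparison:
  fixes F :: "nat \<Rightarrow> real \<times> real \<Rightarrow> real \<Rightarrow> real"
  assumes "a > 0" "N \<ge> 1"
    and segU: "\<And>z. z \<in> mesh a N \<Longrightarrow> segregated_at m U z"
    and segW: "\<And>z. z \<in> mesh a N \<Longrightarrow> segregated_at m W z"
    and mono: "\<And>l z. l \<in> {1..m} \<Longrightarrow> z \<in> square a \<Longrightarrow> mono_on {0..} (F l z)"
    and U: "\<And>l z. l \<in> {1..m} \<Longrightarrow> z \<in> mesh_interior a N \<inter> G \<Longrightarrow>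
        discrete_laplacian (a / real N) (excess m U l) z \<le> F l z (U l z)"
      "\<And>l z. l \<in> {1..m} \<Longrightarrow> z \<in> mesh_interior a N \<inter> G \<Longrightarrow> U l z > 0 \<Longrightarrow>
        discrete_laplacian (a / real N) (excess m U l) z \<ge> F l z (U l z)"
    and W: "\<And>l z. l \<in> {1..m} \<Longrightarrow> z \<in> mesh_interior a N \<inter> G \<Longrightarrow>
        discrete_laplacian (a / real N) (excess m W l) z \<le> F l z (W l z) + \<tau>"
      "\<And>l z. l \<in> {1..m} \<Longrightarrow> z \<in> mesh_interior a N \<inter> G \<Longrightarrow> W l z > 0 \<Longrightarrow>
        discrete_laplacian (a / real N) (excess m W l) z \<ge> F l z (W l z) - \<tau>"
    and near: "\<And>z. z \<in> mesh a N - (mesh_interior a N \<inter> G) \<Longrightarrow> deviation m U W z \<le> \<epsilon>"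
    and "\<epsilon> \<ge> 0" "\<tau> \<ge> 0" "\<tau> < 4 * \<kappa>"
    and z: "z \<in> mesh a N"
  shows "deviation m U W z \<le> \<epsilon> + 2 * \<kappa> * a\<^sup>2"
proof -
  define h where "h = a / real N"
  have h: "h > 0" using assms by (simp add: h_def)
  define Q where "Q z = (fst z)\<^sup>2 + (snd z)\<^sup>2" for z :: "real \<times> real"
  define v where "v z = deviation m U W z + \<kappa> * Q z" for z
  have \<kappa>: "\<kappa> > 0" using assms by linarith
  have Qle: "0 \<le> Q z \<and> Q z \<le> 2 * a\<^sup>2" if "z \<in> mesh a N" for z
  proof -
    have "z \<in> cbox (0, 0) (a, a)" using that mesh_subset_closed_square[OF assms(1)] by blast
    then have "(fst z)\<^sup>2 \<le> a\<^sup>2" "(snd z)\<^sup>2 \<le> a\<^sup>2"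
      by (cases z, auto simp: mem_cbox_pair intro!: power_mono)+
    then show ?thesis by (auto simp: Q_def)
  qed
  have bnd: "v z \<le> \<epsilon> + 2 * \<kappa> * a\<^sup>2" if "z \<in> mesh a N" "deviation m U W z \<le> \<epsilon>" for z
  proof -
    have "\<kappa> * Q z \<le> \<kappa> * (2 * a\<^sup>2)" using Qle[OF that(1)] \<kappa> by (intro mult_left_mono) auto
    then show ?thesis using that by (simp add: v_def)
  qed
  have step: "v z < neighbour_average h v z"
    if z: "z \<in> mesh_interior a N \<inter> G" and e: "\<And>w. w \<in> mesh a N \<Longrightarrow> e w \<le> deviation m U W w"
      "e z = deviation m U W z" "discrete_laplacian h e z \<ge> - \<tau>" for e z
  proof -
    have "h\<^sup>2 / 4 * (- \<tau>) \<le> h\<^sup>2 / 4 * discrete_laplacian h e z"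
      using e(3) by (intro mult_left_mono) auto
    also have "\<dots> = neighbour_average h e z - e z"
      using h by (simp add: discrete_laplacian_def)
    finally have 1: "- \<tau> * (h\<^sup>2 / 4) \<le> neighbour_average h e z - e z" by (simp add: mult.commute)
    have 2: "neighbour_average h e z \<le> neighbour_average h (deviation m U W) z"
      unfolding h_def using z e(1) by (intro neighbour_average_mono) auto
    have 3: "neighbour_average h v z = neighbour_average h (deviation m U W) z + \<kappa> * (Q z + h\<^sup>2)"
      using neighbour_average_add[of h "deviation m U W" "\<lambda>z. \<kappa> * Q z" z] neighbour_average_cmult[of h \<kappa> Q z]
        neighbour_average_norm_square[of h z] unfolding v_def Q_def by simp
    have "\<tau> * (h\<^sup>2 / 4) < (4 * \<kappa>) * (h\<^sup>2 / 4)"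
      using assms h by (intro mult_strict_right_mono) auto
    then show ?thesis using 1 2 3 e(2) by (simp add: v_def algebra_simps)
  qed
  have "v z \<le> \<epsilon> + 2 * \<kappa> * a\<^sup>2"
  proof (rule discrete_maximum_principle[OF _ _ z])
    fix z assume "z \<in> mesh_boundary a N"
    then show "v z \<le> \<epsilon> + 2 * \<kappa> * a\<^sup>2"
      by (intro bnd near) (auto simp: mesh_boundary_def)
  next
    fix z assume zi: "z \<in> mesh_interior a N"
    then have zm: "z \<in> mesh a N" and zs: "z \<in> square a"
      using mesh_interior_subset[of a N] mesh_interior_subset_square[OF assms(1), of N] by auto
    show "v z \<le> \<epsilon> + 2 * \<kappa> * a\<^sup>2 \<or> v z < neighbour_average (a / real N) v z"
    proof (cases "z \<in> G \<and> deviation m U W z > 0")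
      case False
      then have "deviation m U W z \<le> \<epsilon>" using near[of z] zm \<open>\<epsilon> \<ge> 0\<close> by auto
      then show ?thesis using bnd zm by blast
    next
      case True
      then have zG: "z \<in> mesh_interior a N \<inter> G" using zi by simp
      have "v z < neighbour_average h v z"
        using segU[OF zm] segW[OF zm] conjunct2[OF True]
      proof (cases rule: deviation_attained)
        case (1 l)
        have 0: "0 \<le> W l z" using segW[OF zm] 1 by (auto simp: segregated_at_def)
        have "F l z (W l z) \<le> F l z (U l z)"
          using mono_onD[OF mono[OF 1(1) zs]] 0 1(2) by auto
        moreover have "discrete_laplacian h (excess m U l) z \<ge> F l z (U l z)"
          unfolding h_def using U(2)[OF 1(1) zG] 0 1(2) by auto
        moreover have "discrete_laplacian h (excess m W l) z \<le> F l z (W l z) + \<tau>"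
          unfolding h_def using W(1)[OF 1(1) zG] by auto
        ultimately have "discrete_laplacian h (\<lambda>z. excess m U l z - excess m W l z) z \<ge> - \<tau>"
          unfolding discrete_laplacian_def neighbour_average_diff by (simp add: algebra_simps)
        then show ?thesis
          by (intro step[OF zG, of "\<lambda>z. excess m U l z - excess m W l z"] excess_diff_le_deviation 1)
      next
        case (2 l)
        have 0: "0 \<le> U l z" using segU[OF zm] 2 by (auto simp: segregated_at_def)
        have "F l z (U l z) \<le> F l z (W l z)"
          using mono_onD[OF mono[OF 2(1) zs]] 0 2(2) by auto
        moreover have "discrete_laplacian h (excess m W l) z \<ge> F l z (W l z) - \<tau>"
          unfolding h_def using W(2)[OF 2(1) zG] 0 2(2) by auto
        moreover have "discrete_laplacian h (excess m U l) z \<le> F l z (U l z)"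
          unfolding h_def using U(1)[OF 2(1) zG] by auto
        ultimately have "discrete_laplacian h (\<lambda>z. excess m W l z - excess m U l z) z \<ge> - \<tau>"
          unfolding discrete_laplacian_def neighbour_average_diff by (simp add: algebra_simps)
        then show ?thesis
          using 2 by (intro step[OF zG, of "\<lambda>z. excess m W l z - excess m U l z"])
            (auto simp: deviation_commute[of m U W] intro: excess_diff_le_deviation)
      qed
      then show ?thesis by (simp add: h_def)
    qed
  qed
  moreover have "\<kappa> * Q z \<ge> 0" using Qle[OF z] \<kappa> by simp
  ultimately show ?thesis by (simp add: v_def)
qed

section \<open>Reaction terms\<close>

text \<open>Common form of the two alternatives for the dynamics, restricted to the range \<open>s \<ge> 0\<close> in which
  all components take their values; dynamics independent of \<open>s\<close> have \<open>L = 0\<close>.\<close>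

definition monotone_reaction :: "real \<Rightarrow> real \<Rightarrow> (real \<times> real \<Rightarrow> real \<Rightarrow> real) \<Rightarrow> bool" where
  "monotone_reaction a L g \<longleftrightarrow> L \<ge> 0 \<and>
     (\<forall>x\<in>square a. \<forall>s\<ge>0. 0 \<le> g x s \<and> (\<forall>t\<ge>s. g x s \<le> g x t \<and> g x t \<le> g x s + L * (t - s))) \<and>
     (\<forall>s\<ge>0. continuous_on (square a) (\<lambda>x. g x s)) \<and>
     (\<exists>K. \<forall>x\<in>square a. g x 0 \<le> K)"

lemma monotone_reactionD:
  assumes "monotone_reaction a L g"
  shows "L \<ge> 0"
    "x \<in> square a \<Longrightarrow> s \<ge> 0 \<Longrightarrow> 0 \<le> g x s"
    "x \<in> square a \<Longrightarrow> s \<ge> 0 \<Longrightarrow> s \<le> t \<Longrightarrow> g x s \<le> g x t"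
    "x \<in> square a \<Longrightarrow> s \<ge> 0 \<Longrightarrow> s \<le> t \<Longrightarrow> g x t \<le> g x s + L * (t - s)"
    "s \<ge> 0 \<Longrightarrow> continuous_on (square a) (\<lambda>x. g x s)"
  using assms unfolding monotone_reaction_def by auto

lemma admissible_monotone_reaction:
  assumes "admissible_dynamics a m f" "\<forall>l\<in>{1..m}. \<forall>x\<in>square a. mono_on {0..} (f l x)" "l \<in> {1..m}"
  obtains L where "monotone_reaction a L (f l)"
proof -
  have bnd: "\<exists>K. \<forall>x\<in>square a. g x \<le> K" if "uniformly_continuous_on (square a) g" for g :: "real \<times> real \<Rightarrow> real"
  proof -
    have "bounded (g ` square a)"
      using that by (rule bounded_uniformly_continuous_image) (simp add: square_eq_box)
    then obtain K where "\<forall>y\<in>g ` square a. norm y \<le> K" unfolding bounded_iff by blast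
    then have "\<forall>x\<in>square a. g x \<le> K" by auto
    then show ?thesis by blast
  qed
  have mono: "f l x s \<le> f l x t" if "x \<in> square a" "0 \<le> s" "s \<le> t" for x s t
  proof -
    have "mono_on {0..} (f l x)" using bspec[OF bspec[OF assms(2,3)] that(1)] .
    then show ?thesis by (rule mono_onD) (use that in auto)
  qed
  consider (dep) "\<exists>L. \<forall>x\<in>square a. L-lipschitz_on {0..} (f l x)"
      "\<forall>s\<ge>0. uniformly_continuous_on (square a) (\<lambda>x. f l x s)" "\<forall>x\<in>square a. f l x 0 = 0"
    | (indep) "\<forall>x\<in>square a. \<forall>s. f l x s = f l x 0" "\<forall>x\<in>square a. \<forall>s. f l x s \<ge> 0"
      "\<forall>s. uniformly_continuous_on (square a) (\<lambda>x. f l x s)"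
    using assms(1) unfolding admissible_dynamics_def
  proof (elim disjE)
    assume "\<forall>i\<in>{1..m}.
        (\<exists>L. \<forall>x\<in>square a. L-lipschitz_on {0..} (f i x)) \<and>
        (\<forall>s\<ge>0. uniformly_continuous_on (square a) (\<lambda>x. f i x s)) \<and>
        (\<forall>x\<in>square a. f i x 0 = 0) \<and>
        (\<forall>x\<in>square a. \<forall>s\<le>0. f i x s = - f i x (- s))"
    from bspec[OF this assms(3)] show thesis by (elim conjE) (rule dep)
  next
    assume "\<forall>i\<in>{1..m}.
        (\<forall>x\<in>square a. \<forall>s. f i x s = f i x 0) \<and>
        (\<forall>x\<in>square a. \<forall>s. f i x s \<ge> 0) \<and>
        (\<forall>s. uniformly_continuous_on (square a) (\<lambda>x. f i x s))"
    from bspec[OF this assms(3)] show thesis by (elim conjE) (rule indep)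
  qed
  then show ?thesis
  proof cases
    case dep
    then obtain L where L: "\<And>x. x \<in> square a \<Longrightarrow> L-lipschitz_on {0..} (f l x)" by blast
    have lip: "f l x t \<le> f l x s + \<bar>L\<bar> * (t - s)" if "x \<in> square a" "0 \<le> s" "s \<le> t" for x s t
    proof -
      have "dist (f l x t) (f l x s) \<le> L * dist t s"
        using L[OF that(1)] that by (intro lipschitz_onD) auto
      also have "\<dots> \<le> \<bar>L\<bar> * (t - s)"
        using that by (simp add: dist_real_def mult_right_mono)
      finally show ?thesis by (simp add: dist_real_def)
    qed
    have nn: "0 \<le> f l x s" if "x \<in> square a" "0 \<le> s" for x s
      using mono[of x 0 s] dep(3) that by simp
    have "monotone_reaction a \<bar>L\<bar> (f l)"
      unfolding monotone_reaction_def
      using mono lip nn bnd[of "\<lambda>x. f l x 0"] dep(2)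
        uniformly_continuous_imp_continuous[of "square a" "\<lambda>x. f l x _"]
      by (intro conjI ballI allI impI) simp_all
    then show ?thesis by (rule that)
  next
    case indep
    have eq: "f l x t = f l x s" if "x \<in> square a" for x s t
      using indep(1) that by metis
    have eq: "f l x t \<le> f l x s + 0 * (t - s)" if "x \<in> square a" for x s t
      using eq[OF that, of t s] by simp
    have "monotone_reaction a 0 (f l)"
      unfolding monotone_reaction_def
      using mono eq indep(2,3) bnd[of "\<lambda>x. f l x 0"]
        uniformly_continuous_imp_continuous[of "square a" "\<lambda>x. f l x _"]
      by (intro conjI ballI allI impI) simp_all
    then show ?thesis by (rule that)
  qed
qed

lemma monotone_reaction_bounded:
  assumes "monotone_reaction a L g" "R \<ge> 0"
  obtains K where "K \<ge> 0" "\<And>x s. x \<in> square a \<Longrightarrow> 0 \<le> s \<Longrightarrow> s \<le> R \<Longrightarrow> g x s \<le> K"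
proof -
  obtain K where K: "\<And>x. x \<in> square a \<Longrightarrow> g x 0 \<le> K"
    using assms(1) unfolding monotone_reaction_def by blast
  have "g x s \<le> \<bar>K\<bar> + L * R" if "x \<in> square a" "0 \<le> s" "s \<le> R" for x s
  proof -
    have "g x s \<le> g x 0 + L * (s - 0)"
      using monotone_reactionD(4)[OF assms(1) that(1), of 0 s] that by simp
    also have "\<dots> \<le> \<bar>K\<bar> + L * R"
      using K[OF that(1)] monotone_reactionD(1)[OF assms(1)] that by (intro add_mono mult_left_mono) auto
    finally show ?thesis .
  qed
  moreover have "\<bar>K\<bar> + L * R \<ge> 0" using monotone_reactionD(1)[OF assms(1)] assms(2) by simp
  ultimately show ?thesis using that by blast
qed

section \<open>Solutions of the difference scheme\<close>

locale scheme =
  fixes a :: real and m :: nat and f :: "nat \<Rightarrow> real \<times> real \<Rightarrow> real \<Rightarrow> real"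
    and \<phi> :: "nat \<Rightarrow> real \<times> real \<Rightarrow> real" and N :: nat and U :: "nat \<Rightarrow> real \<times> real \<Rightarrow> real"
  assumes a: "a > 0" and N: "N \<ge> 1"
    and reaction: "l \<in> {1..m} \<Longrightarrow> \<exists>L. monotone_reaction a L (f l)"
    and data: "admissible_boundary_data a m \<phi>"
    and solution: "discrete_solution a m f \<phi> N U"
begin

abbreviation "h \<equiv> a / real N"
abbreviation "avg \<equiv> neighbour_average h"

lemma cancel: "(4 / h\<^sup>2) * ((h\<^sup>2 / 4) * c) = c"
  using a N by (simp add: field_simps)

lemma scheme_eq:
  assumes "l \<in> {1..m}" "z \<in> mesh_interior a N"
  shows "U l z = max (- (h\<^sup>2 / 4) * f l z (U l z) + avg (U l) z - (\<Sum>p\<in>{1..m} - {l}. avg (U p) z)) 0"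
  using solution assms unfolding discrete_solution_def Let_def by blast

lemma boundary_eq: "l \<in> {1..m} \<Longrightarrow> z \<in> mesh_boundary a N \<Longrightarrow> U l z = \<phi> l z"
  using solution unfolding discrete_solution_def Let_def by blast

lemma nonneg:
  assumes "l \<in> {1..m}" "z \<in> mesh a N"
  shows "U l z \<ge> 0"
  using assms(2)
proof (cases rule: mesh_cases)
  case 1
  show ?thesis by (subst scheme_eq[OF assms(1) 1]) simp
next
  case 2
  have "z \<in> frontier (square a)" using 2 mesh_boundary_subset_frontier[OF a N] by blast
  then have "\<phi> l z \<ge> 0" using data assms(1) unfolding admissible_boundary_data_def by blast
  then show ?thesis using boundary_eq[OF assms(1) 2] by simp
qed

lemma avg_nonneg:
  assumes "l \<in> {1..m}" "z \<in> mesh_interior a N"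
  shows "avg (U l) z \<ge> 0"
  using neighbour_average_mono[OF assms(2), of "\<lambda>_. 0" "U l"] nonneg[OF assms(1)]
  by (simp add: neighbour_average_const)

lemma f_nonneg:
  assumes "l \<in> {1..m}" "z \<in> mesh_interior a N"
  shows "f l z (U l z) \<ge> 0"
proof -
  have "z \<in> square a" "z \<in> mesh a N"
    using assms(2) mesh_interior_subset_square[OF a, of N] mesh_interior_subset[of a N] by auto
  then show ?thesis
    using reaction[OF assms(1)] nonneg[OF assms(1), of z] monotone_reactionD(2)[of a _ "f l" z "U l z"] by blast
qed

text \<open>Were two components positive at the same node, then in the sum of their equations each average
  would be cancelled by the other equation, leaving a nonpositive right-hand side.\<close>

lemma disjoint_interior:
  assumes l: "l \<in> {1..m}" and p: "p \<in> {1..m}" "l \<noteq> p" and z: "z \<in> mesh_interior a N"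
  shows "U l z * U p z = 0"
proof (rule ccontr)
  assume ne: "U l z * U p z \<noteq> 0"
  then have pos: "U l z > 0" "U p z > 0"
    using nonneg[OF l, of z] nonneg[OF p(1), of z] z mesh_interior_subset[of a N]
    by (auto simp: order_less_le simp del: split_paired_All)
  have le: "avg (U q) z \<le> (\<Sum>r\<in>{1..m} - {k}. avg (U r) z)" if "q \<in> {1..m} - {k}" for q k
    using that avg_nonneg[OF _ z] by (intro member_le_sum) auto
  have "U l z = - (h\<^sup>2 / 4) * f l z (U l z) + avg (U l) z - (\<Sum>r\<in>{1..m} - {l}. avg (U r) z)"
    using scheme_eq[OF l z] pos(1) by linarith
  moreover have "U p z = - (h\<^sup>2 / 4) * f p z (U p z) + avg (U p) z - (\<Sum>r\<in>{1..m} - {p}. avg (U r) z)"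
    using scheme_eq[OF p(1) z] pos(2) by linarith
  moreover have "(h\<^sup>2 / 4) * f l z (U l z) \<ge> 0" "(h\<^sup>2 / 4) * f p z (U p z) \<ge> 0"
    using f_nonneg[OF l z] f_nonneg[OF p(1) z] by simp_all
  ultimately show False using le[of l p] le[of p l] l p pos by auto
qed

lemma segregated:
  assumes "z \<in> mesh a N"
  shows "segregated_at m U z"
  unfolding segregated_at_def
proof (intro conjI ballI impI)
  fix l p assume lp: "l \<in> {1..m}" "p \<in> {1..m}" "l \<noteq> p"
  show "U l z * U p z = 0"
    using assms
  proof (cases rule: mesh_cases)
    case 1
    then show ?thesis using disjoint_interior lp by blast
  next
    case 2
    have "z \<in> frontier (square a)" using 2 mesh_boundary_subset_frontier[OF a N] by blast
    then have "\<phi> l z * \<phi> p z = 0" using data lp unfolding admissible_boundary_data_def by blast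
    then show ?thesis using boundary_eq[OF lp(1) 2] boundary_eq[OF lp(2) 2] by simp
  qed
qed (use nonneg assms in blast)

text \<open>The components are discretely subharmonic: all other terms in the scheme have a negative sign.\<close>

lemma le_avg:
  assumes "l \<in> {1..m}" "z \<in> mesh_interior a N"
  shows "U l z \<le> avg (U l) z"
proof -
  have "(\<Sum>r\<in>{1..m} - {l}. avg (U r) z) \<ge> 0"
    using avg_nonneg[OF _ assms(2)] by (intro sum_nonneg) auto
  moreover have "(h\<^sup>2 / 4) * f l z (U l z) \<ge> 0" using f_nonneg[OF assms] by simp
  ultimately show ?thesis using scheme_eq[OF assms] avg_nonneg[OF assms] by linarith
qed

lemma avg_excess: "avg (excess m U l) z = avg (U l) z - (\<Sum>p\<in>{1..m} - {l}. avg (U p) z)"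
proof -
  have "excess m U l = (\<lambda>z. U l z - (\<Sum>p\<in>{1..m} - {l}. U p z))" by (simp add: excess_def fun_eq_iff)
  then show ?thesis by (simp add: neighbour_average_diff neighbour_average_sum)
qed

lemma discrete_laplacian_excess_eq:
  assumes "l \<in> {1..m}" "z \<in> mesh_interior a N" "U l z > 0"
  shows "discrete_laplacian h (excess m U l) z = f l z (U l z)"
proof -
  have z: "z \<in> mesh a N" using assms(2) mesh_interior_subset by blast
  have "excess m U l z = - (h\<^sup>2 / 4) * f l z (U l z) + avg (excess m U l) z"
    using scheme_eq[OF assms(1,2)] assms(3) excess_eq_if_pos[of m U z l, OF segregated[OF z] assms(1,3)] avg_excess[of l z]
    by linarith
  then have "avg (excess m U l) z - excess m U l z = (h\<^sup>2 / 4) * f l z (U l z)" by simp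
  then have "discrete_laplacian h (excess m U l) z = (4 / h\<^sup>2) * ((h\<^sup>2 / 4) * f l z (U l z))"
    unfolding discrete_laplacian_def by (simp only:)
  also have "\<dots> = f l z (U l z)"
    by (rule cancel)
  finally show ?thesis .
qed

text \<open>The case that needs an argument is a node at which another component \<open>p\<close> is positive: there the
  excess of \<open>l\<close> is \<open>- U p\<close>. The averages of \<open>U l\<close> and \<open>U p\<close> enter the excesses of \<open>l\<close> and \<open>p\<close> with opposite
  signs, and all other averages enter both with a negative sign; the equation for \<open>p\<close> thus bounds
  the average of the excess of \<open>l\<close> by \<open>- U p\<close>.\<close>

lemma discrete_laplacian_excess_le:
  assumes "l \<in> {1..m}" "z \<in> mesh_interior a N"
  shows "discrete_laplacian h (excess m U l) z \<le> f l z (U l z)"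
proof -
  have z: "z \<in> mesh a N" using assms(2) mesh_interior_subset by blast
  note seg = segregated[OF z]
  have *: ?thesis if "avg (excess m U l) z - excess m U l z \<le> (h\<^sup>2 / 4) * f l z (U l z)"
  proof -
    have "(4 / h\<^sup>2) * (avg (excess m U l) z - excess m U l z) \<le> (4 / h\<^sup>2) * ((h\<^sup>2 / 4) * f l z (U l z))"
      using that by (intro mult_left_mono) auto
    then show ?thesis unfolding cancel discrete_laplacian_def by simp
  qed
  show ?thesis
  proof (cases "U l z > 0")
    case True
    then show ?thesis using discrete_laplacian_excess_eq assms by simp
  next
    case False
    then have 0: "U l z = 0" using nonneg[OF assms(1) z] by simp
    have fl: "(h\<^sup>2 / 4) * f l z (U l z) \<ge> 0" using f_nonneg[OF assms] by simp
    show ?thesis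
    proof (cases "\<exists>p\<in>{1..m} - {l}. U p z > 0")
      case False
      then have "(\<Sum>p\<in>{1..m} - {l}. U p z) = 0"
        using nonneg[OF _ z] by (intro sum.neutral) force
      then have "excess m U l z = 0" using 0 by (simp add: excess_def)
      moreover have "- (h\<^sup>2 / 4) * f l z (U l z) + avg (excess m U l) z \<le> 0"
        using scheme_eq[OF assms] 0 avg_excess[of l z] by linarith
      ultimately show ?thesis by (intro *) simp
    next
      case True
      then obtain p where "p \<in> {1..m} - {l}" "U p z > 0" by blast
      then have p: "p \<in> {1..m}" "p \<noteq> l" "U p z > 0" by simp_all
      have fp: "(h\<^sup>2 / 4) * f p z (U p z) \<ge> 0" using f_nonneg[OF p(1) assms(2)] by simp
      have "U p z = - (h\<^sup>2 / 4) * f p z (U p z) + avg (U p) z - (\<Sum>r\<in>{1..m} - {p}. avg (U r) z)"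
        using scheme_eq[OF p(1) assms(2)] p(3) by linarith
      moreover have "avg (U l) z \<le> (\<Sum>r\<in>{1..m} - {p}. avg (U r) z)"
        using p assms avg_nonneg[OF _ assms(2)] by (intro member_le_sum) auto
      moreover have "avg (U p) z \<le> (\<Sum>r\<in>{1..m} - {l}. avg (U r) z)"
        using p assms avg_nonneg[OF _ assms(2)] by (intro member_le_sum) auto
      moreover have "excess m U l z = - U p z"
      proof -
        have "(\<Sum>r\<in>{1..m} - {l}. U r z) = (\<Sum>r\<in>{p}. U r z)"
          using p segregated_at_eq_0[OF seg p(1,3)] by (intro sum.mono_neutral_right) auto
        then show ?thesis using 0 by (simp add: excess_def)
      qed
      ultimately show ?thesis using avg_excess[of l z] fl fp by (intro *) linarith
    qed
  qed
qed

end

section \<open>Barriers\<close>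

definition near_boundary :: "real \<Rightarrow> real \<Rightarrow> (real \<times> real) set" where
  "near_boundary a d = {z \<in> cbox (0, 0) (a, a). \<not> (d < fst z \<and> fst z < a - d \<and> d < snd z \<and> snd z < a - d)}"

text \<open>For \<open>\<xi> = (p, 0)\<close> on the lower side take \<open>b (x, y) = (x - p)\<^sup>2 + y (3 a - 2 y)\<close>. Differences of
  quadratic polynomials are exact, so \<open>b\<close> has discrete Laplacian \<open>-2\<close> on every mesh. Since \<open>y \<le> a\<close>, the
  second factor is at least \<open>y\<close>, whence \<open>b\<close> dominates the squared distance from \<open>\<xi>\<close>; on the line
  through \<open>\<xi>\<close> normal to the side \<open>b\<close> is small near \<open>\<xi>\<close>. The other sides follow by symmetry.\<close>

lemma boundary_barrier:
  assumes a: "a > 0" and "z \<in> near_boundary a d"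
  obtains \<xi> b where "\<xi> \<in> frontier (square a)" "dist z \<xi> \<le> d"
    "\<And>w. w \<in> cbox (0, 0) (a, a) \<Longrightarrow> (dist w \<xi>)\<^sup>2 \<le> b w"
    "\<And>w. w \<in> cbox (0, 0) (a, a) \<Longrightarrow> b w \<le> 4 * a\<^sup>2"
    "\<And>h w. neighbour_average h b w = b w - h\<^sup>2 / 2"
    "b z \<le> 3 * a * d"
proof -
  obtain x y where z: "z = (x, y)" "0 \<le> x" "x \<le> a" "0 \<le> y" "y \<le> a"
    and near: "x \<le> d \<or> a - x \<le> d \<or> y \<le> d \<or> a - y \<le> d"
    using assms(2) by (cases z) (auto simp: near_boundary_def mem_cbox_pair)
  define q where "q p s r = (s - p)\<^sup>2 + r * (3 * a - 2 * r)" for p s r :: real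
  have q1: "(s - p)\<^sup>2 + r\<^sup>2 \<le> q p s r" if "0 \<le> r" "r \<le> a" for p s r
    using mult_left_mono[of r "3 * a - 2 * r" r] that by (simp add: q_def power2_eq_square)
  have q2: "q p s r \<le> 4 * a\<^sup>2" if "0 \<le> r" "r \<le> a" "0 \<le> p" "p \<le> a" "0 \<le> s" "s \<le> a" for p s r
  proof -
    have "(s - p)\<^sup>2 \<le> a\<^sup>2" using that by (intro power2_le_iff_abs_le[THEN iffD2]) auto
    moreover have "r * (3 * a - 2 * r) \<le> a * (3 * a)" using that by (intro mult_mono) auto
    ultimately show ?thesis by (simp add: q_def power2_eq_square)
  qed
  have q3: "q s s r \<le> 3 * a * d" if "0 \<le> r" "r \<le> d" for s r
  proof -
    have "q s s r \<le> r * (3 * a)" using that by (simp add: q_def mult_left_mono)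
    also have "\<dots> \<le> d * (3 * a)" using that a by (intro mult_right_mono) auto
    finally show ?thesis by (simp add: mult_ac)
  qed
  have avg: "q p (s + k) r + q p (s - k) r + q p s (r + k) + q p s (r - k) = 4 * q p s r - 2 * k\<^sup>2" for p s r k
    by (simp add: q_def power2_eq_square algebra_simps)
  have fr: "w \<in> frontier (square a) \<longleftrightarrow> w \<in> cbox (0,0) (a,a) \<and> w \<notin> square a" for w
    using frontier_square[OF a] by blast
  have d2: "(dist (s, t) (p, r))\<^sup>2 = (s - p)\<^sup>2 + (t - r)\<^sup>2" for s t p r :: real
    by (simp add: dist_Pair_Pair dist_real_def)
  have d1: "dist (s, t) (s, r) = \<bar>t - r\<bar>" "dist (s, t) (r, t) = \<bar>s - r\<bar>" for s t p r :: real
    by (simp_all add: dist_Pair_Pair dist_real_def)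
  from near consider "x \<le> d" | "a - x \<le> d" | "y \<le> d" | "a - y \<le> d" by blast
  then show ?thesis
  proof cases
    case 1
    show ?thesis
    proof (rule that[of "(0, y)" "\<lambda>w. q y (snd w) (fst w)"])
      show "neighbour_average h (\<lambda>w. q y (snd w) (fst w)) w = q y (snd w) (fst w) - h\<^sup>2 / 2" for h w
        using avg[of y "snd w" h "fst w"] by (simp add: neighbour_average_def)
    qed (use 1 z q1[of _ _ y] q2 q3 d1 in \<open>auto simp: fr mem_cbox_pair square_iff d2 add.commute\<close>)
  next
    case 2
    show ?thesis
    proof (rule that[of "(a, y)" "\<lambda>w. q y (snd w) (a - fst w)"])
      show "neighbour_average h (\<lambda>w. q y (snd w) (a - fst w)) w = q y (snd w) (a - fst w) - h\<^sup>2 / 2" for h w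
      proof -
        have *: "a - (fst w + h) = (a - fst w) - h" "a - (fst w - h) = (a - fst w) + h" by simp_all
        show ?thesis
          using avg[of y "snd w" h "a - fst w"] unfolding neighbour_average_def by (simp add: * del: diff_diff_eq2 diff_diff_eq)
      qed
      show "(dist w (a, y))\<^sup>2 \<le> q y (snd w) (a - fst w)" if "w \<in> cbox (0,0) (a,a)" for w
        using that q1[of "a - fst w" "snd w" y] by (cases w) (auto simp: mem_cbox_pair d2 power2_commute[of a])
    qed (use 2 z q2 q3 d1 in \<open>auto simp: fr mem_cbox_pair square_iff add.commute\<close>)
  next
    case 3
    show ?thesis
    proof (rule that[of "(x, 0)" "\<lambda>w. q x (fst w) (snd w)"])
      show "neighbour_average h (\<lambda>w. q x (fst w) (snd w)) w = q x (fst w) (snd w) - h\<^sup>2 / 2" for h w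
        using avg[of x "fst w" h "snd w"] by (simp add: neighbour_average_def)
    qed (use 3 z q1[of _ _ x] q2 q3 d1 in \<open>auto simp: fr mem_cbox_pair square_iff d2 add.commute\<close>)
  next
    case 4
    show ?thesis
    proof (rule that[of "(x, a)" "\<lambda>w. q x (fst w) (a - snd w)"])
      show "neighbour_average h (\<lambda>w. q x (fst w) (a - snd w)) w = q x (fst w) (a - snd w) - h\<^sup>2 / 2" for h w
      proof -
        have *: "a - (snd w + h) = (a - snd w) - h" "a - (snd w - h) = (a - snd w) + h" by simp_all
        show ?thesis
          using avg[of x "fst w" h "a - snd w"] unfolding neighbour_average_def by (simp add: * del: diff_diff_eq2 diff_diff_eq)
      qed
      show "(dist w (x, a))\<^sup>2 \<le> q x (fst w) (a - snd w)" if "w \<in> cbox (0,0) (a,a)" for w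
        using that q1[of "a - snd w" "fst w" x] by (cases w) (auto simp: mem_cbox_pair d2 power2_commute[of a])
    qed (use 4 z q2 q3 d1 in \<open>auto simp: fr mem_cbox_pair square_iff add.commute\<close>)
  qed
qed


context scheme
begin

text \<open>The component is discretely subharmonic and the barrier strictly superharmonic.\<close>

lemma upper_barrier:
  assumes "l \<in> {1..m}" "C > 0"
    and bdry: "\<And>w. w \<in> frontier (square a) \<Longrightarrow> \<phi> l w \<le> c + C * b w"
    and b: "\<And>w. avg b w = b w - h\<^sup>2 / 2"
    and "z \<in> mesh a N"
  shows "U l z \<le> c + C * b z"
proof -
  have "U l z - (c + C * b z) \<le> 0"
  proof (rule discrete_maximum_principle[OF _ _ assms(5)])
    fix w assume w: "w \<in> mesh_boundary a N"
    then have "w \<in> frontier (square a)" using mesh_boundary_subset_frontier[OF a N] by blast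
    then show "U l w - (c + C * b w) \<le> 0" using bdry boundary_eq[OF assms(1) w] by simp
  next
    fix w assume w: "w \<in> mesh_interior a N"
    have "avg (\<lambda>z. U l z - (c + C * b z)) w = avg (U l) w - (c + C * (b w - h\<^sup>2 / 2))"
      unfolding neighbour_average_diff neighbour_average_add neighbour_average_cmult neighbour_average_const b ..
    also have "\<dots> > U l w - (c + C * b w)"
    proof -
      have "C * (h\<^sup>2 / 2) > 0" using a N assms(2) by simp
      then show ?thesis using le_avg[OF assms(1) w] by (simp only: right_diff_distrib)
    qed
    finally show "U l w - (c + C * b w) \<le> 0 \<or>
        U l w - (c + C * b w) < avg (\<lambda>z. U l z - (c + C * b z)) w" ..
  qed
  then show ?thesis by simp
qed

text \<open>The discrete Laplacian of the excess is at most \<open>F\<close>, while that of the lower barrier is \<open>2 C\<close>.\<close>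

lemma lower_barrier:
  assumes "l \<in> {1..m}" "F < 2 * C"
    and F: "\<And>w. w \<in> mesh_interior a N \<Longrightarrow> f l w (U l w) \<le> F"
    and bdry: "\<And>w. w \<in> frontier (square a) \<Longrightarrow> c - C * b w \<le> excess m \<phi> l w"
    and b: "\<And>w. avg b w = b w - h\<^sup>2 / 2"
    and "z \<in> mesh a N"
  shows "c - C * b z \<le> excess m U l z"
proof -
  have "(c - C * b z) - excess m U l z \<le> 0"
  proof (rule discrete_maximum_principle[OF _ _ assms(6)])
    fix w assume w: "w \<in> mesh_boundary a N"
    then have "w \<in> frontier (square a)" using mesh_boundary_subset_frontier[OF a N] by blast
    moreover have "excess m U l w = excess m \<phi> l w"
      unfolding excess_def using boundary_eq[OF _ w] assms(1) by (auto intro!: arg_cong2[where f = minus] sum.cong)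
    ultimately show "(c - C * b w) - excess m U l w \<le> 0" using bdry by simp
  next
    fix w assume w: "w \<in> mesh_interior a N"
    have "avg (\<lambda>z. (c - C * b z) - excess m U l z) w = (c - C * (b w - h\<^sup>2 / 2)) - avg (excess m U l) w"
      unfolding neighbour_average_diff neighbour_average_cmult neighbour_average_const b ..
    also have "\<dots> > (c - C * b w) - excess m U l w"
    proof -
      have "discrete_laplacian h (excess m U l) w \<le> F"
        using discrete_laplacian_excess_le[OF assms(1) w] F[OF w] by simp
      also note assms(2)
      finally have "discrete_laplacian h (excess m U l) w < 2 * C" .
      moreover have "h\<^sup>2 / 4 > 0" using a N by simp
      ultimately have "(h\<^sup>2 / 4) * discrete_laplacian h (excess m U l) w < (h\<^sup>2 / 4) * (2 * C)"
        by (rule mult_strict_left_mono)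
      moreover have "(h\<^sup>2 / 4) * discrete_laplacian h (excess m U l) w = avg (excess m U l) w - excess m U l w"
        unfolding discrete_laplacian_def using a N by (simp add: field_simps)
      ultimately show ?thesis by (simp only: right_diff_distrib) simp
    qed
    finally show "(c - C * b w) - excess m U l w \<le> 0 \<or>
        (c - C * b w) - excess m U l w < avg (\<lambda>z. (c - C * b z) - excess m U l z) w" ..
  qed
  then show ?thesis by simp
qed

end

text \<open>Near \<open>\<xi>\<close> the oscillation of \<open>g\<close> is at most \<open>\<epsilon>\<close>; at distance at least \<open>d\<close> it is at most twice the bound
  of \<open>\<bar>g\<bar>\<close>, and there \<open>b \<ge> d\<^sup>2\<close>.\<close>

lemma barrier_dominates:
  fixes g :: "real \<times> real \<Rightarrow> real"
  assumes "continuous_on S g" "compact S" "\<epsilon> > 0"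
  obtains C0 where "C0 > 0" "\<And>C \<xi> w b. C \<ge> C0 \<Longrightarrow> \<xi> \<in> S \<Longrightarrow> w \<in> S \<Longrightarrow> (dist w \<xi>)\<^sup>2 \<le> b \<Longrightarrow> \<bar>g w - g \<xi>\<bar> \<le> \<epsilon> + C * b"
proof -
  have "uniformly_continuous_on S g" using assms compact_uniformly_continuous by blast
  then obtain d where d: "d > 0" "\<And>x y. x \<in> S \<Longrightarrow> y \<in> S \<Longrightarrow> dist y x < d \<Longrightarrow> dist (g y) (g x) < \<epsilon>"
    using assms(3) unfolding uniformly_continuous_on_def by metis
  have "bounded (g ` S)" using assms compact_continuous_image compact_imp_bounded by blast
  then obtain K where K: "K > 0" "\<And>x. x \<in> S \<Longrightarrow> \<bar>g x\<bar> \<le> K"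
    unfolding bounded_pos by auto
  show ?thesis
  proof (rule that[of "2 * K / d\<^sup>2"])
    show "2 * K / d\<^sup>2 > 0" using K d by simp
    fix C \<xi> w b assume C: "2 * K / d\<^sup>2 \<le> C" and S: "\<xi> \<in> S" "w \<in> S" and b: "(dist w \<xi>)\<^sup>2 \<le> b"
    have C0: "C \<ge> 0" using C K d by (meson divide_nonneg_nonneg dual_order.trans less_imp_le mult_nonneg_nonneg zero_le_numeral zero_le_power2)
    have b0: "b \<ge> 0" using b zero_le_power2 order_trans by blast
    show "\<bar>g w - g \<xi>\<bar> \<le> \<epsilon> + C * b"
    proof (cases "dist w \<xi> < d")
      case True
      then have "\<bar>g w - g \<xi>\<bar> < \<epsilon>" using d(2)[OF S] by (simp add: dist_real_def)
      then show ?thesis using mult_nonneg_nonneg[OF C0 b0] by linarith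
    next
      case False
      have "\<bar>g w - g \<xi>\<bar> \<le> 2 * K" using K(2)[OF S(1)] K(2)[OF S(2)] by linarith
      also have "\<dots> = (2 * K / d\<^sup>2) * d\<^sup>2" using d by simp
      also have "\<dots> \<le> C * b"
      proof (intro mult_mono C C0)
        show "d\<^sup>2 \<le> b" using False d(1) b by (smt (verit) power_mono)
      qed simp
      finally show ?thesis using assms(3) by linarith
    qed
  qed
qed

text \<open>A barrier at \<open>\<xi>\<close> bounds \<open>U l\<close> from above by nearly \<open>\<phi> l \<xi>\<close>, and the excess of \<open>U l\<close>, which is at most \<open>U l\<close>,
  from below by nearly the excess of \<open>\<phi> l\<close> at \<open>\<xi>\<close>. Where \<open>\<phi> l \<xi> > 0\<close> this excess is \<open>\<phi> l \<xi>\<close>; where \<open>\<phi> l \<xi> = 0\<close>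
  the lower bound is \<open>U l \<ge> 0\<close>. The constants depend on the data only, which makes \<open>d\<close> independent of
  the mesh.\<close>

theorem scheme_boundary_values:
  assumes a: "a > 0"
    and reaction: "\<And>l. l \<in> {1..m} \<Longrightarrow> \<exists>L. monotone_reaction a L (f l)"
    and data: "admissible_boundary_data a m \<phi>"
    and l: "l \<in> {1..m}" and "\<epsilon> > 0"
  shows "\<forall>\<^sub>F d in at_right 0. \<forall>N\<ge>1. \<forall>U. discrete_solution a m f \<phi> N U \<longrightarrow>
    (\<forall>z\<in>mesh a N \<inter> near_boundary a d. \<exists>\<xi>\<in>frontier (square a). dist z \<xi> \<le> d \<and> \<bar>U l z - \<phi> l \<xi>\<bar> \<le> \<epsilon>)"
proof -
  define S where "S = frontier (square a)"
  have S: "compact S" unfolding S_def by (rule compact_frontier_square)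
  have cont: "continuous_on S (\<phi> p)" if "p \<in> {1..m}" for p
    using data that unfolding admissible_boundary_data_def S_def by blast
  have \<phi>nn: "\<phi> p w \<ge> 0" if "p \<in> {1..m}" "w \<in> S" for p w
    using data that unfolding admissible_boundary_data_def S_def by blast
  have seg: "segregated_at m \<phi> w" if "w \<in> S" for w
    using data that unfolding admissible_boundary_data_def segregated_at_def S_def by blast
  have cont': "continuous_on S (excess m \<phi> l)"
    unfolding excess_def using cont l by (intro continuous_on_diff continuous_on_sum) auto
  obtain C1 where C1: "C1 > 0" "\<And>C \<xi> w b. C \<ge> C1 \<Longrightarrow> \<xi> \<in> S \<Longrightarrow> w \<in> S \<Longrightarrow> (dist w \<xi>)\<^sup>2 \<le> b \<Longrightarrow> \<bar>\<phi> l w - \<phi> l \<xi>\<bar> \<le> \<epsilon> / 2 + C * b"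
    using barrier_dominates[OF cont[OF l] S, of "\<epsilon> / 2"] \<open>\<epsilon> > 0\<close> by (metis half_gt_zero)
  obtain C2 where C2: "C2 > 0" "\<And>C \<xi> w b. C \<ge> C2 \<Longrightarrow> \<xi> \<in> S \<Longrightarrow> w \<in> S \<Longrightarrow> (dist w \<xi>)\<^sup>2 \<le> b \<Longrightarrow> \<bar>excess m \<phi> l w - excess m \<phi> l \<xi>\<bar> \<le> \<epsilon> / 2 + C * b"
    using barrier_dominates[OF cont' S, of "\<epsilon> / 2"] \<open>\<epsilon> > 0\<close> by (metis half_gt_zero)
  have "bounded (\<phi> l ` S)" using cont[OF l] S compact_continuous_image compact_imp_bounded by blast
  then obtain K where K: "K > 0" "\<And>w. w \<in> S \<Longrightarrow> \<phi> l w \<le> K"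
    unfolding bounded_pos by (metis abs_le_D1 imageI real_norm_def)
  obtain L where L: "monotone_reaction a L (f l)" using reaction[OF l] by blast
  obtain F where F: "F \<ge> 0" "\<And>x s. x \<in> square a \<Longrightarrow> 0 \<le> s \<Longrightarrow> s \<le> K + 4 * a\<^sup>2 \<Longrightarrow> f l x s \<le> F"
    using monotone_reaction_bounded[OF L, of "K + 4 * a\<^sup>2"] K(1) by (metis add_nonneg_nonneg less_imp_le mult_nonneg_nonneg zero_le_numeral zero_le_power2)
  \<comment> \<open>the first two terms dominate the boundary values, the third one the reaction term\<close>
  define C where "C = C1 + C2 + F"
  have C: "C \<ge> C1" "C \<ge> C2" "C > 0" "F < 2 * C" using C1(1) C2(1) F(1) by (simp_all add: C_def)
  have main: "\<exists>\<xi>\<in>S. dist z \<xi> \<le> d \<and> \<bar>U l z - \<phi> l \<xi>\<bar> \<le> \<epsilon>"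
    if d: "C * (3 * a * d) < \<epsilon> / 2" and N: "N \<ge> 1" and U: "discrete_solution a m f \<phi> N U"
      and z: "z \<in> mesh a N" "z \<in> near_boundary a d" for d N U z
  proof -
    interpret scheme a m f \<phi> N U using a N reaction data U by unfold_locales auto
    obtain \<xi> b where \<xi>: "\<xi> \<in> S" "dist z \<xi> \<le> d"
      and b: "\<And>w. w \<in> cbox (0, 0) (a, a) \<Longrightarrow> (dist w \<xi>)\<^sup>2 \<le> b w"
        "\<And>w. w \<in> cbox (0, 0) (a, a) \<Longrightarrow> b w \<le> 4 * a\<^sup>2"
        "\<And>h w. neighbour_average h b w = b w - h\<^sup>2 / 2"
        "b z \<le> 3 * a * d"
      using boundary_barrier[OF a z(2)] unfolding S_def by metis
    have Ssub: "w \<in> cbox (0, 0) (a, a)" if "w \<in> S" for w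
      using that frontier_square[OF a] unfolding S_def by blast
    have Cb: "C * b z \<le> \<epsilon> / 2"
      using mult_left_mono[OF b(4), of C] C(3) d by linarith
    have "\<phi> l w \<le> (\<phi> l \<xi> + \<epsilon> / 2) + C * b w" if "w \<in> S" for w
      using C1(2)[OF C(1) \<xi>(1) that b(1)[OF Ssub[OF that]]] by linarith
    then have "U l z \<le> (\<phi> l \<xi> + \<epsilon> / 2) + C * b z"
      using upper_barrier[OF l C(3), of "\<phi> l \<xi> + \<epsilon> / 2" b z] b(3) z(1) unfolding S_def by blast
    then have up: "U l z \<le> \<phi> l \<xi> + \<epsilon>" using Cb by linarith
    have bd: "U l w \<le> K + 4 * a\<^sup>2" if "w \<in> mesh a N" for w
    proof -
      have "\<phi> l w' \<le> K + 1 * b w'" if "w' \<in> S" for w'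
        using K(2)[OF that] b(1)[OF Ssub[OF that]] zero_le_power2[of "dist w' \<xi>"] by linarith
      then have "U l w \<le> K + 1 * b w"
        using upper_barrier[OF l zero_less_one, of K b w] b(3) that unfolding S_def by blast
      moreover have "w \<in> cbox (0, 0) (a, a)" using mesh_subset_closed_square[OF a] that by blast
      ultimately show ?thesis using b(2)[of w] by linarith
    qed
    have "f l w (U l w) \<le> F" if "w \<in> mesh_interior a N" for w
    proof -
      have "w \<in> square a" "w \<in> mesh a N"
        using that mesh_interior_subset_square[OF a, of N] mesh_interior_subset[of a N] by blast+
      then show ?thesis using F(2) nonneg[OF l] bd by blast
    qed
    moreover have "(excess m \<phi> l \<xi> - \<epsilon> / 2) - C * b w \<le> excess m \<phi> l w" if "w \<in> S" for w
      using C2(2)[OF C(2) \<xi>(1) that b(1)[OF Ssub[OF that]]] by linarith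
    ultimately have "(excess m \<phi> l \<xi> - \<epsilon> / 2) - C * b z \<le> excess m U l z"
      using lower_barrier[OF l C(4), of "excess m \<phi> l \<xi> - \<epsilon> / 2" b z] b(3) z(1) unfolding S_def by blast
    then have low: "excess m \<phi> l \<xi> - \<epsilon> \<le> U l z"
      using Cb excess_le[OF segregated[OF z(1)], of l] by linarith
    have "\<phi> l \<xi> - \<epsilon> \<le> U l z"
    proof (cases "\<phi> l \<xi> > 0")
      case True
      then show ?thesis using low excess_eq_if_pos[OF seg[OF \<xi>(1)] l] by simp
    next
      case False
      then show ?thesis using nonneg[OF l z(1)] \<open>\<epsilon> > 0\<close> by linarith
    qed
    then show ?thesis using up \<xi> by (intro bexI[of _ \<xi>]) auto
  qed
  have "((\<lambda>d. C * (3 * a * d)) \<longlongrightarrow> C * (3 * a * 0)) (at_right 0)"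
    by (intro tendsto_intros)
  then have "\<forall>\<^sub>F d in at_right 0. C * (3 * a * d) < \<epsilon> / 2"
    using \<open>\<epsilon> > 0\<close> by (intro order_tendstoD(2)[where y = "C * (3 * a * 0)"]) auto
  then show ?thesis
    by eventually_elim (use main S_def in blast)
qed

section \<open>Functions of class two\<close>

definition laplacian :: "(real \<times> real \<Rightarrow> real) \<Rightarrow> real \<times> real \<Rightarrow> real" where
  "laplacian u z = D1 (D1 u) z + D2 (D2 u) z"

lemma Ck_on_1D:
  assumes "Ck_on 1 S u"
  shows "z \<in> S \<Longrightarrow> u differentiable (at z)" "continuous_on S (D1 u)" "continuous_on S (D2 u)" "continuous_on S u"
  using assms by (auto intro!: differentiable_imp_continuous_on simp: differentiable_on_def differentiable_at_withinI)

lemma Ck_on_2D: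
  assumes "Ck_on 2 S u"
  shows "Ck_on 1 S u" "Ck_on 1 S (D1 u)" "Ck_on 1 S (D2 u)"
proof -
  have *: "\<forall>z\<in>S. u differentiable (at z)" "Ck_on 1 S (D1 u)" "Ck_on 1 S (D2 u)"
    using assms by (auto simp: numeral_2_eq_2)
  then show "Ck_on 1 S u" "Ck_on 1 S (D1 u)" "Ck_on 1 S (D2 u)"
    using Ck_on_1D(4)[OF *(2)] Ck_on_1D(4)[OF *(3)] by auto
qed

lemma continuous_on_laplacian:
  assumes "Ck_on 2 S u"
  shows "continuous_on S (laplacian u)"
  unfolding laplacian_def
  using Ck_on_1D(2)[OF Ck_on_2D(2)[OF assms]] Ck_on_1D(3)[OF Ck_on_2D(3)[OF assms]]
  by (intro continuous_on_add)

lemma D1_has_real_derivative: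
  assumes "u differentiable (at (x, y))"
  shows "((\<lambda>s. u (s, y)) has_real_derivative D1 u (x, y)) (at x)"
proof -
  have "(u has_derivative frechet_derivative u (at (x, y))) (at (x, y))"
    using assms by (simp add: frechet_derivative_works)
  moreover have "((\<lambda>s. (s, y)) has_derivative (\<lambda>s. (s, 0))) (at x)"
    by (auto intro!: derivative_eq_intros)
  ultimately have d: "((\<lambda>s. u (s, y)) has_derivative (\<lambda>s. frechet_derivative u (at (x, y)) (s, 0))) (at x)"
    by (rule has_derivative_compose[rotated])
  have "linear (frechet_derivative u (at (x, y)))"
    using assms by (rule linear_frechet_derivative)
  from linear_scale[OF this, of _ "(1, 0)"]
  have "frechet_derivative u (at (x, y)) (s, 0) = D1 u (x, y) * s" for s
    unfolding D1_def scaleR_Pair by (metis mult.commute mult.right_neutral mult_zero_right real_scaleR_def)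
  then have "(\<lambda>s. frechet_derivative u (at (x, y)) (s, 0)) = (*) (D1 u (x, y))" by (rule ext)
  with d show ?thesis unfolding has_field_derivative_def by simp
qed

lemma D2_has_real_derivative:
  assumes "u differentiable (at (x, y))"
  shows "((\<lambda>s. u (x, s)) has_real_derivative D2 u (x, y)) (at y)"
proof -
  have "(u has_derivative frechet_derivative u (at (x, y))) (at (x, y))"
    using assms by (simp add: frechet_derivative_works)
  moreover have "((\<lambda>s. (x, s)) has_derivative (\<lambda>s. (0, s))) (at y)"
    by (auto intro!: derivative_eq_intros)
  ultimately have d: "((\<lambda>s. u (x, s)) has_derivative (\<lambda>s. frechet_derivative u (at (x, y)) (0, s))) (at y)"
    by (rule has_derivative_compose[rotated])
  have "linear (frechet_derivative u (at (x, y)))"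
    using assms by (rule linear_frechet_derivative)
  from linear_scale[OF this, of _ "(0, 1)"]
  have "frechet_derivative u (at (x, y)) (0, s) = D2 u (x, y) * s" for s
    unfolding D2_def scaleR_Pair by (metis mult.commute mult.right_neutral mult_zero_right real_scaleR_def)
  then have "(\<lambda>s. frechet_derivative u (at (x, y)) (0, s)) = (*) (D2 u (x, y))" by (rule ext)
  with d show ?thesis unfolding has_field_derivative_def by simp
qed

lemma partial_derivatives_eq:
  assumes "(u has_derivative (\<lambda>v. p * fst v + q * snd v)) (at z)"
  shows "u differentiable (at z)" "D1 u z = p" "D2 u z = q"
proof -
  show "u differentiable (at z)" using assms differentiable_def by blast
  have "frechet_derivative u (at z) = (\<lambda>v. p * fst v + q * snd v)"
    using frechet_derivative_at[OF assms] by simp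
  then show "D1 u z = p" "D2 u z = q" by (simp_all add: D1_def D2_def)
qed

section \<open>Green's identity on a rectangle\<close>

lemma green_interval:
  fixes p p1 p2 q q1 q2 :: "real \<Rightarrow> real"
  assumes "\<alpha> \<le> \<beta>"
    and p: "\<And>t. t \<in> {\<alpha>..\<beta>} \<Longrightarrow> (p has_real_derivative p1 t) (at t)" "\<And>t. t \<in> {\<alpha>..\<beta>} \<Longrightarrow> (p1 has_real_derivative p2 t) (at t)"
    and q: "\<And>t. t \<in> {\<alpha>..\<beta>} \<Longrightarrow> (q has_real_derivative q1 t) (at t)" "\<And>t. t \<in> {\<alpha>..\<beta>} \<Longrightarrow> (q1 has_real_derivative q2 t) (at t)"
    and c: "continuous_on {\<alpha>..\<beta>} p2" "continuous_on {\<alpha>..\<beta>} q2"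
    and z: "q \<alpha> = 0" "q \<beta> = 0" "q1 \<alpha> = 0" "q1 \<beta> = 0"
  shows "integral {\<alpha>..\<beta>} (\<lambda>t. p t * q2 t) = integral {\<alpha>..\<beta>} (\<lambda>t. q t * p2 t)"
proof -
  have cp: "continuous_on {\<alpha>..\<beta>} p" "continuous_on {\<alpha>..\<beta>} q"
    using p(1) q(1) by (meson DERIV_isCont continuous_at_imp_continuous_on)+
  have "((\<lambda>t. p t * q2 t - q t * p2 t) has_integral (p \<beta> * q1 \<beta> - p1 \<beta> * q \<beta>) - (p \<alpha> * q1 \<alpha> - p1 \<alpha> * q \<alpha>)) {\<alpha>..\<beta>}"
  proof (rule fundamental_theorem_of_calculus[OF assms(1)])
    fix t assume t: "t \<in> {\<alpha>..\<beta>}"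
    have "((\<lambda>t. p t * q1 t - p1 t * q t) has_real_derivative p t * q2 t - q t * p2 t) (at t)"
      by (rule derivative_eq_intros p(1)[OF t] p(2)[OF t] q(1)[OF t] q(2)[OF t] refl)+ (simp add: algebra_simps)
    then show "((\<lambda>t. p t * q1 t - p1 t * q t) has_vector_derivative p t * q2 t - q t * p2 t) (at t within {\<alpha>..\<beta>})"
      by (simp add: has_real_derivative_iff_has_vector_derivative has_vector_derivative_at_within)
  qed
  then have "integral {\<alpha>..\<beta>} (\<lambda>t. p t * q2 t - q t * p2 t) = 0"
    using z by (simp add: integral_unique)
  moreover have "(\<lambda>t. p t * q2 t) integrable_on {\<alpha>..\<beta>}" "(\<lambda>t. q t * p2 t) integrable_on {\<alpha>..\<beta>}"
    using c cp by (auto intro!: integrable_continuous_interval continuous_intros)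
  ultimately show ?thesis by (simp add: integral_diff)
qed

lemma integral_cbox_pair_iterated:
  fixes F :: "real \<times> real \<Rightarrow> real"
  assumes "continuous_on (cbox (\<alpha>, \<gamma>) (\<beta>, \<delta>)) F"
  shows "integral (cbox (\<alpha>, \<gamma>) (\<beta>, \<delta>)) F = integral {\<alpha>..\<beta>} (\<lambda>x. integral {\<gamma>..\<delta>} (\<lambda>y. F (x, y)))"
    and "integral (cbox (\<alpha>, \<gamma>) (\<beta>, \<delta>)) F = integral {\<gamma>..\<delta>} (\<lambda>y. integral {\<alpha>..\<beta>} (\<lambda>x. F (x, y)))"
proof -
  show *: "integral (cbox (\<alpha>, \<gamma>) (\<beta>, \<delta>)) F = integral {\<alpha>..\<beta>} (\<lambda>x. integral {\<gamma>..\<delta>} (\<lambda>y. F (x, y)))"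
    using integral_prod_continuous[OF assms] by simp
  show "integral (cbox (\<alpha>, \<gamma>) (\<beta>, \<delta>)) F = integral {\<gamma>..\<delta>} (\<lambda>y. integral {\<alpha>..\<beta>} (\<lambda>x. F (x, y)))"
    unfolding * using integral_swap_continuous[of \<alpha> \<gamma> \<beta> \<delta> "\<lambda>x y. F (x, y)"] assms by simp
qed

lemma continuous_on_sections:
  fixes F :: "real \<times> real \<Rightarrow> real"
  assumes "continuous_on (cbox (\<alpha>, \<gamma>) (\<beta>, \<delta>)) F"
  shows "y \<in> {\<gamma>..\<delta>} \<Longrightarrow> continuous_on {\<alpha>..\<beta>} (\<lambda>x. F (x, y))"
    and "x \<in> {\<alpha>..\<beta>} \<Longrightarrow> continuous_on {\<gamma>..\<delta>} (\<lambda>y. F (x, y))"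
  by (auto intro!: continuous_on_compose2[OF assms] continuous_intros)

text \<open>Together with its normal derivative \<open>G\<close> vanishes on the boundary of the rectangle; integrating by
  parts twice along horizontal and vertical lines therefore leaves no boundary terms.\<close>

lemma green_rectangle:
  fixes G :: "real \<times> real \<Rightarrow> real"
  assumes u: "Ck_on 2 S u" and sub: "cbox (\<alpha>, \<gamma>) (\<beta>, \<delta>) \<subseteq> S" and le: "\<alpha> \<le> \<beta>" "\<gamma> \<le> \<delta>"
    and G1: "\<And>x y. (x, y) \<in> cbox (\<alpha>, \<gamma>) (\<beta>, \<delta>) \<Longrightarrow> ((\<lambda>s. G (s, y)) has_real_derivative Gx (x, y)) (at x)"
      "\<And>x y. (x, y) \<in> cbox (\<alpha>, \<gamma>) (\<beta>, \<delta>) \<Longrightarrow> ((\<lambda>s. Gx (s, y)) has_real_derivative Gxx (x, y)) (at x)"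
    and G2: "\<And>x y. (x, y) \<in> cbox (\<alpha>, \<gamma>) (\<beta>, \<delta>) \<Longrightarrow> ((\<lambda>s. G (x, s)) has_real_derivative Gy (x, y)) (at y)"
      "\<And>x y. (x, y) \<in> cbox (\<alpha>, \<gamma>) (\<beta>, \<delta>) \<Longrightarrow> ((\<lambda>s. Gy (x, s)) has_real_derivative Gyy (x, y)) (at y)"
    and cG: "continuous_on (cbox (\<alpha>, \<gamma>) (\<beta>, \<delta>)) G"
    and c: "continuous_on (cbox (\<alpha>, \<gamma>) (\<beta>, \<delta>)) Gxx" "continuous_on (cbox (\<alpha>, \<gamma>) (\<beta>, \<delta>)) Gyy"
    and z1: "\<And>x y. y \<in> {\<gamma>..\<delta>} \<Longrightarrow> x = \<alpha> \<or> x = \<beta> \<Longrightarrow> G (x, y) = 0 \<and> Gx (x, y) = 0"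
    and z2: "\<And>x y. x \<in> {\<alpha>..\<beta>} \<Longrightarrow> y = \<gamma> \<or> y = \<delta> \<Longrightarrow> G (x, y) = 0 \<and> Gy (x, y) = 0"
  shows "integral (cbox (\<alpha>, \<gamma>) (\<beta>, \<delta>)) (\<lambda>z. u z * (Gxx z + Gyy z)) =
    integral (cbox (\<alpha>, \<gamma>) (\<beta>, \<delta>)) (\<lambda>z. G z * laplacian u z)"
proof -
  let ?Q = "cbox (\<alpha>, \<gamma>) (\<beta>, \<delta>)"
  note C1 = Ck_on_1D[OF Ck_on_2D(1)[OF u]]
  note C2 = Ck_on_1D[OF Ck_on_2D(2)[OF u]]
  note C3 = Ck_on_1D[OF Ck_on_2D(3)[OF u]]
  have mem: "(x, y) \<in> ?Q" if "x \<in> {\<alpha>..\<beta>}" "y \<in> {\<gamma>..\<delta>}" for x y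
    using that by (simp add: cbox_Pair_eq)
  have cu: "continuous_on ?Q u" "continuous_on ?Q (D1 (D1 u))" "continuous_on ?Q (D2 (D2 u))"
    using C1(4) C2(2) C3(3) sub continuous_on_subset by blast+
  have cc: "continuous_on ?Q (\<lambda>z. u z * Gxx z)" "continuous_on ?Q (\<lambda>z. u z * Gyy z)"
    "continuous_on ?Q (\<lambda>z. G z * D1 (D1 u) z)" "continuous_on ?Q (\<lambda>z. G z * D2 (D2 u) z)"
    using cu c cG by (auto intro: continuous_on_mult)
  have "integral ?Q (\<lambda>z. u z * Gxx z) = integral ?Q (\<lambda>z. G z * D1 (D1 u) z)"
    unfolding integral_cbox_pair_iterated(2)[OF cc(1)] integral_cbox_pair_iterated(2)[OF cc(3)]
  proof (rule Henstock_Kurzweil_Integration.integral_cong)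
    fix y assume y: "y \<in> {\<gamma>..\<delta>}"
    show "integral {\<alpha>..\<beta>} (\<lambda>x. u (x, y) * Gxx (x, y)) = integral {\<alpha>..\<beta>} (\<lambda>x. G (x, y) * D1 (D1 u) (x, y))"
    proof (rule green_interval[of _ _ _ "\<lambda>x. D1 u (x, y)" _ _ "\<lambda>x. Gx (x, y)", OF le(1)])
      fix t assume "t \<in> {\<alpha>..\<beta>}"
      note t = mem[OF this y]
      show "((\<lambda>t. u (t, y)) has_real_derivative D1 u (t, y)) (at t)"
        using C1(1) t sub by (intro D1_has_real_derivative) blast
      show "((\<lambda>t. D1 u (t, y)) has_real_derivative D1 (D1 u) (t, y)) (at t)"
        using C2(1) t sub by (intro D1_has_real_derivative) blast
      show "((\<lambda>t. G (t, y)) has_real_derivative Gx (t, y)) (at t)"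
        "((\<lambda>t. Gx (t, y)) has_real_derivative Gxx (t, y)) (at t)" using G1 t by auto
    qed (use z1 y continuous_on_sections(1)[OF cu(2) y] continuous_on_sections(1)[OF c(1) y] in auto)
  qed
  moreover have "integral ?Q (\<lambda>z. u z * Gyy z) = integral ?Q (\<lambda>z. G z * D2 (D2 u) z)"
    unfolding integral_cbox_pair_iterated(1)[OF cc(2)] integral_cbox_pair_iterated(1)[OF cc(4)]
  proof (rule Henstock_Kurzweil_Integration.integral_cong)
    fix x assume x: "x \<in> {\<alpha>..\<beta>}"
    show "integral {\<gamma>..\<delta>} (\<lambda>y. u (x, y) * Gyy (x, y)) = integral {\<gamma>..\<delta>} (\<lambda>y. G (x, y) * D2 (D2 u) (x, y))"
    proof (rule green_interval[of _ _ _ "\<lambda>y. D2 u (x, y)" _ _ "\<lambda>y. Gy (x, y)", OF le(2)])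
      fix t assume "t \<in> {\<gamma>..\<delta>}"
      note t = mem[OF x this]
      show "((\<lambda>t. u (x, t)) has_real_derivative D2 u (x, t)) (at t)"
        using C1(1) t sub by (intro D2_has_real_derivative) blast
      show "((\<lambda>t. D2 u (x, t)) has_real_derivative D2 (D2 u) (x, t)) (at t)"
        using C3(1) t sub by (intro D2_has_real_derivative) blast
      show "((\<lambda>t. G (x, t)) has_real_derivative Gy (x, t)) (at t)"
        "((\<lambda>t. Gy (x, t)) has_real_derivative Gyy (x, t)) (at t)" using G2 t by auto
    qed (use z2 x continuous_on_sections(2)[OF cu(3) x] continuous_on_sections(2)[OF c(2) x] in auto)
  qed
  ultimately show ?thesis
    using cc unfolding laplacian_def distrib_left
    by (simp add: Henstock_Kurzweil_Integration.integral_add integrable_continuous)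
qed

section \<open>Radial kernels\<close>

definition square_around :: "real \<times> real \<Rightarrow> real \<Rightarrow> (real \<times> real) set" where
  "square_around z0 R = cbox (fst z0 - R, snd z0 - R) (fst z0 + R, snd z0 + R)"

lemma square_around_iff: "(x, y) \<in> square_around z0 R \<longleftrightarrow> \<bar>x - fst z0\<bar> \<le> R \<and> \<bar>y - snd z0\<bar> \<le> R"
  by (auto simp: square_around_def cbox_Pair_eq abs_le_iff)

definition scaled_square_dist :: "real \<times> real \<Rightarrow> real \<Rightarrow> real \<times> real \<Rightarrow> real" where
  "scaled_square_dist z0 R z = ((fst z - fst z0)\<^sup>2 + (snd z - snd z0)\<^sup>2) / R\<^sup>2"

lemma scaled_square_dist_nonneg: "scaled_square_dist z0 R z \<ge> 0"
  by (simp add: scaled_square_dist_def)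

lemma continuous_on_scaled_square_dist: "continuous_on S (scaled_square_dist z0 R)"
proof (cases "R = 0")
  case True
  then show ?thesis by (simp add: scaled_square_dist_def continuous_on_const)
next
  case False
  then show ?thesis unfolding scaled_square_dist_def by (intro continuous_intros) auto
qed

text \<open>For \<open>G z = T s\<close> with \<open>s = \<bar>z - z0\<bar>\<^sup>2 / R\<^sup>2\<close> the chain rule gives the Laplacian \<open>4 / R\<^sup>2 (s T'' s + T' s)\<close>.
  Since \<open>T\<close> vanishes for \<open>s \<ge> 1\<close>, so does \<open>G\<close> with its gradient on the boundary of the square.\<close>

lemma green_radial:
  fixes T T1 T2 :: "real \<Rightarrow> real"
  assumes u: "Ck_on 2 S u" and sub: "square_around z0 R \<subseteq> S" and R: "R > 0"
    and T: "\<And>s. s \<ge> 0 \<Longrightarrow> (T has_real_derivative T1 s) (at s)" "\<And>s. s \<ge> 0 \<Longrightarrow> (T1 has_real_derivative T2 s) (at s)"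
    and T2: "continuous_on {0..} T2"
    and T0: "\<And>s. s \<ge> 1 \<Longrightarrow> T s = 0" "\<And>s. s \<ge> 1 \<Longrightarrow> T1 s = 0"
  shows "integral (square_around z0 R) (\<lambda>z. u z * (4 / R\<^sup>2 *
        (scaled_square_dist z0 R z * T2 (scaled_square_dist z0 R z) + T1 (scaled_square_dist z0 R z)))) =
    integral (square_around z0 R) (\<lambda>z. T (scaled_square_dist z0 R z) * laplacian u z)"
proof -
  define \<rho> where "\<rho> = scaled_square_dist z0 R"
  obtain x0 y0 where z0: "z0 = (x0, y0)" by (cases z0)
  have \<rho>: "\<rho> (x, y) = ((x - x0)\<^sup>2 + (y - y0)\<^sup>2) / R\<^sup>2" for x y
    by (simp add: \<rho>_def scaled_square_dist_def z0)
  have \<rho>0: "\<rho> z \<ge> 0" for z by (simp add: \<rho>_def scaled_square_dist_nonneg)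
  have \<rho>1: "\<rho> (x, y) \<ge> 1" if "\<bar>x - x0\<bar> = R \<or> \<bar>y - y0\<bar> = R" for x y
  proof -
    have "(x - x0)\<^sup>2 + (y - y0)\<^sup>2 \<ge> R\<^sup>2" using that by (metis le_add_same_cancel1 le_add_same_cancel2 power2_abs zero_le_power2)
    then show ?thesis using R by (simp add: \<rho>)
  qed
  have d\<rho>: "((\<lambda>s. \<rho> (s, y)) has_real_derivative 2 * (x - x0) / R\<^sup>2) (at x)"
    "((\<lambda>s. \<rho> (x, s)) has_real_derivative 2 * (y - y0) / R\<^sup>2) (at y)" for x y
    unfolding \<rho> by (intro DERIV_cdivide; auto intro!: derivative_eq_intros)+
  have cT: "continuous_on {0..} T" "continuous_on {0..} T1"
    using T by (meson DERIV_isCont atLeast_iff continuous_at_imp_continuous_on)+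
  have c\<rho>: "continuous_on A \<rho>" for A unfolding \<rho>_def by (rule continuous_on_scaled_square_dist)
  have comp: "continuous_on A (\<lambda>z. h (\<rho> z))" if "continuous_on {0..} h" for h :: "real \<Rightarrow> real" and A
    by (rule continuous_on_compose2[OF that c\<rho>]) (use \<rho>0 in blast)
  have dT: "((\<lambda>s. T (\<rho> (s, y))) has_real_derivative T1 (\<rho> (x, y)) * (2 * (x - x0) / R\<^sup>2)) (at x)"
    "((\<lambda>s. T (\<rho> (x, s))) has_real_derivative T1 (\<rho> (x, y)) * (2 * (y - y0) / R\<^sup>2)) (at y)"
    "((\<lambda>s. T1 (\<rho> (s, y))) has_real_derivative T2 (\<rho> (x, y)) * (2 * (x - x0) / R\<^sup>2)) (at x)"
    "((\<lambda>s. T1 (\<rho> (x, s))) has_real_derivative T2 (\<rho> (x, y)) * (2 * (y - y0) / R\<^sup>2)) (at y)" for x y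
    using DERIV_chain2[OF T(1)[OF \<rho>0] d\<rho>(1)] DERIV_chain2[OF T(1)[OF \<rho>0] d\<rho>(2)]
      DERIV_chain2[OF T(2)[OF \<rho>0] d\<rho>(1)] DERIV_chain2[OF T(2)[OF \<rho>0] d\<rho>(2)] by blast+
  have dl: "((\<lambda>s. 2 * (s - c) / R\<^sup>2) has_real_derivative 2 / R\<^sup>2) (at x)" for c x
    by (rule DERIV_cdivide) (auto intro!: derivative_eq_intros)
  define Gxx where "Gxx z = T2 (\<rho> z) * (2 * (fst z - x0) / R\<^sup>2) * (2 * (fst z - x0) / R\<^sup>2) + T1 (\<rho> z) * (2 / R\<^sup>2)" for z
  define Gyy where "Gyy z = T2 (\<rho> z) * (2 * (snd z - y0) / R\<^sup>2) * (2 * (snd z - y0) / R\<^sup>2) + T1 (\<rho> z) * (2 / R\<^sup>2)" for z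
  have "integral (cbox (x0 - R, y0 - R) (x0 + R, y0 + R)) (\<lambda>z. u z * (Gxx z + Gyy z)) =
    integral (cbox (x0 - R, y0 - R) (x0 + R, y0 + R)) (\<lambda>z. T (\<rho> z) * laplacian u z)"
  proof (rule green_rectangle[where Gx = "\<lambda>z. T1 (\<rho> z) * (2 * (fst z - x0) / R\<^sup>2)" and
        Gy = "\<lambda>z. T1 (\<rho> z) * (2 * (snd z - y0) / R\<^sup>2)", OF u])
    show "cbox (x0 - R, y0 - R) (x0 + R, y0 + R) \<subseteq> S" using sub by (simp add: square_around_def z0)
    show "((\<lambda>s. T1 (\<rho> (s, y)) * (2 * (fst (s, y) - x0) / R\<^sup>2)) has_real_derivative Gxx (x, y)) (at x)" for x y
      using DERIV_mult[OF dT(3)[of y x] dl[of x0 x]] by (simp add: Gxx_def mult_ac)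
    show "((\<lambda>s. T1 (\<rho> (x, s)) * (2 * (snd (x, s) - y0) / R\<^sup>2)) has_real_derivative Gyy (x, y)) (at y)" for x y
      using DERIV_mult[OF dT(4)[of x y] dl[of y0 y]] by (simp add: Gyy_def mult_ac)
    show "continuous_on (cbox (x0 - R, y0 - R) (x0 + R, y0 + R)) Gxx"
      unfolding Gxx_def using comp[OF T2] comp[OF cT(2)] R by (intro continuous_intros) auto
    show "continuous_on (cbox (x0 - R, y0 - R) (x0 + R, y0 + R)) Gyy"
      unfolding Gyy_def using comp[OF T2] comp[OF cT(2)] R by (intro continuous_intros) auto
  qed (use R dT(1,2) comp[OF cT(1)] T0 \<rho>1 in auto)
  moreover have "Gxx z + Gyy z = 4 / R\<^sup>2 * (\<rho> z * T2 (\<rho> z) + T1 (\<rho> z))" for z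
    using R by (cases z) (simp add: Gxx_def Gyy_def \<rho> field_simps power2_eq_square)
  ultimately show ?thesis by (simp add: square_around_def z0 \<rho>_def)
qed

lemma has_real_derivative_positive_part_power:
  "((\<lambda>t. (max 0 t) ^ Suc (Suc n)) has_real_derivative real (Suc (Suc n)) * (max 0 t) ^ Suc n) (at t)"
proof -
  consider "t < 0" | "t > 0" | "t = 0" by linarith
  then show ?thesis
  proof cases
    case 1
    have "((\<lambda>t. 0) has_real_derivative real (Suc (Suc n)) * (max 0 t) ^ Suc n) (at t)"
      using 1 by simp
    then show ?thesis
      by (rule has_field_derivative_transform_within_open[of _ _ _ "{..<0}"]) (use 1 in auto)
  next
    case 2
    have "((\<lambda>t. t ^ Suc (Suc n)) has_real_derivative real (Suc (Suc n)) * (max 0 t) ^ Suc n) (at t)"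
      using 2 DERIV_pow[of "Suc (Suc n)" t] by simp
    then show ?thesis
      by (rule has_field_derivative_transform_within_open[of _ _ _ "{0<..}"]) (use 2 in auto)
  next
    case 3
    have "((\<lambda>h. (max 0 h) ^ Suc n) \<longlongrightarrow> (max 0 0) ^ Suc n) (at (0::real))"
      by (intro tendsto_intros)
    moreover have "(max 0 h) ^ Suc n = (max 0 h) ^ Suc (Suc n) / h" if "h \<noteq> 0" for h :: real
      using that by (cases "h > 0") (auto simp: max_def)
    ultimately have "((\<lambda>h. (max 0 h) ^ Suc (Suc n) / h) \<longlongrightarrow> 0) (at (0::real))"
      by (subst (asm) tendsto_cong) (auto simp: eventually_at_filter)
    then show ?thesis using 3 by (simp add: DERIV_def)
  qed
qed

section \<open>A mean value inequality\<close>

text \<open>The integral from \<open>s\<close> to \<open>1\<close> of \<open>k\<close> is a regularisation of \<open>- ln s\<close>, cut off smoothly at \<open>s = 1\<close>; it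
  is zero for \<open>s > 1\<close> because the interval is empty. As a radial function
  it is nonnegative, of class two and compactly supported, and its Laplacian is a bounded function
  minus a multiple of an approximate Dirac mass.\<close>

lemma truncated_logarithm:
  fixes e :: real
  assumes "e > 0"
  defines "k \<equiv> \<lambda>s. (max 0 (1 - s))\<^sup>2 / (s + e)"
  shows "s \<ge> 0 \<Longrightarrow> ((\<lambda>s. integral {s..1} k) has_real_derivative - k s) (at s)"
    and "s \<ge> 0 \<Longrightarrow> ((\<lambda>s. - k s) has_real_derivative
        2 * max 0 (1 - s) / (s + e) + (max 0 (1 - s))\<^sup>2 / (s + e)\<^sup>2) (at s)"
    and "s \<ge> 0 \<Longrightarrow> integral {s..1} k \<ge> 0"
proof -
  have ck: "continuous_on {- (e/2)..b} k" for b
    unfolding k_def using assms(1) by (intro continuous_intros) auto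
  show "integral {s..1} k \<ge> 0" if "s \<ge> 0"
  proof (cases "s \<le> 1")
    case True
    show ?thesis
      using that assms(1) by (intro integral_nonneg integrable_continuous_interval continuous_on_subset[OF ck[of 1]])
        (auto simp: k_def)
  qed auto
  show "((\<lambda>s. - k s) has_real_derivative
        2 * max 0 (1 - s) / (s + e) + (max 0 (1 - s))\<^sup>2 / (s + e)\<^sup>2) (at s)" if "s \<ge> 0"
  proof -
    have 1: "((\<lambda>t. (max 0 t)\<^sup>2) has_real_derivative 2 * max 0 t) (at t)" for t :: real
      using has_real_derivative_positive_part_power[of 0 t] by (simp add: numeral_2_eq_2)
    have 2: "((\<lambda>s. 1 - s) has_real_derivative - 1) (at s)" by (auto intro!: derivative_eq_intros)
    have "((\<lambda>s. (max 0 (1 - s))\<^sup>2) has_real_derivative 2 * max 0 (1 - s) * - 1) (at s)"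
      by (rule DERIV_chain2[OF 1 2])
    then have "((\<lambda>s. - k s) has_real_derivative
        - ((2 * max 0 (1 - s) * - 1 * (s + e) - (max 0 (1 - s))\<^sup>2 * 1) / ((s + e) * (s + e)))) (at s)"
      unfolding k_def
    proof (intro DERIV_minus DERIV_divide)
      show "((\<lambda>s. s + e) has_real_derivative 1) (at s)" by (auto intro!: derivative_eq_intros)
      show "s + e \<noteq> 0" using that assms(1) by simp
    qed
    moreover have "- ((2 * max 0 (1 - s) * - 1 * (s + e) - (max 0 (1 - s))\<^sup>2 * 1) / ((s + e) * (s + e))) =
      2 * max 0 (1 - s) / (s + e) + (max 0 (1 - s))\<^sup>2 / (s + e)\<^sup>2"
    proof -
      have "s + e \<noteq> 0" using that assms(1) by simp
      moreover have "- ((2 * M * - 1 * n - M\<^sup>2 * 1) / (n * n)) = 2 * M / n + M\<^sup>2 / n\<^sup>2" if "n \<noteq> 0" for M n :: real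
        using that by (simp add: field_simps power2_eq_square)
      ultimately show ?thesis by blast
    qed
    ultimately show ?thesis by (simp only:)
  qed
  show "((\<lambda>s. integral {s..1} k) has_real_derivative - k s) (at s)" if "s \<ge> 0"
  proof -
    define J where "J = integral {- (e/2)..1} k"
    have eq: "integral {t..1} k = J - integral {- (e/2)..t} k" if "t \<in> {- (e/2)<..<s + 1}" for t
    proof (cases "t \<le> 1")
      case True
      have "integral {- (e/2)..t} k + integral {t..1} k = J"
        unfolding J_def using True that
        by (intro Henstock_Kurzweil_Integration.integral_combine integrable_continuous_interval ck) auto
      then show ?thesis by simp
    next
      case False
      have "J + integral {1..t} k = integral {- (e/2)..t} k"
        unfolding J_def using False assms(1)
        by (intro Henstock_Kurzweil_Integration.integral_combine integrable_continuous_interval ck) auto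
      moreover have "integral {1..t} k = integral {1..t} (\<lambda>_. 0)"
        by (intro Henstock_Kurzweil_Integration.integral_cong) (simp add: k_def)
      ultimately show ?thesis using False by simp
    qed
    have "((\<lambda>t. integral {- (e/2)..t} k) has_real_derivative k s) (at s within {- (e/2)..s + 1})"
      using that assms(1) by (intro integral_has_real_derivative ck) auto
    then have "((\<lambda>t. integral {- (e/2)..t} k) has_real_derivative k s) (at s)"
      using that assms(1) by (subst (asm) at_within_Icc_at) auto
    then have "((\<lambda>t. J - integral {- (e/2)..t} k) has_real_derivative - k s) (at s)"
      by (auto intro!: derivative_eq_intros)
    then show ?thesis
      by (rule has_field_derivative_transform_within_open[of _ _ _ "{- (e/2)<..<s + 1}"])
        (use that assms(1) eq in auto)
  qed
qed

lemma content_square_around: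
  assumes "R \<ge> 0"
  shows "measure lborel (square_around z0 R) = 4 * R\<^sup>2"
  unfolding square_around_def using assms by (simp add: content_Pair power2_eq_square)

lemma square_around_mono: "r \<le> R \<Longrightarrow> square_around z0 r \<subseteq> square_around z0 R"
  by (auto simp: square_around_iff)

lemma scaled_square_dist_le:
  assumes "z \<in> square_around z0 r" "R > 0"
  shows "scaled_square_dist z0 R z \<le> 2 * r\<^sup>2 / R\<^sup>2"
proof -
  have "(fst z - fst z0)\<^sup>2 \<le> r\<^sup>2" "(snd z - snd z0)\<^sup>2 \<le> r\<^sup>2"
    using assms(1) by (cases z, auto simp: square_around_iff intro!: power2_le_iff_abs_le[THEN iffD2])+
  then show ?thesis unfolding scaled_square_dist_def by (intro divide_right_mono) auto
qed

lemma scaled_square_dist_ge: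
  assumes "z \<notin> square_around z0 r" "r \<ge> 0"
  shows "scaled_square_dist z0 R z \<ge> r\<^sup>2 / R\<^sup>2"
proof -
  have "r\<^sup>2 \<le> (fst z - fst z0)\<^sup>2 \<or> r\<^sup>2 \<le> (snd z - snd z0)\<^sup>2"
    using assms by (cases z) (auto simp: square_around_iff abs_le_square_iff[symmetric])
  then have "r\<^sup>2 \<le> (fst z - fst z0)\<^sup>2 + (snd z - snd z0)\<^sup>2" by (smt (verit) zero_le_power2)
  then show ?thesis unfolding scaled_square_dist_def by (intro divide_right_mono) auto
qed

text \<open>Tested with the truncated logarithm, \<open>laplacian u \<ge> 0\<close> says that the integral of \<open>u\<close> against the
  concentrating part \<open>k\<close> of the kernel is at most its integral against the bounded part \<open>P\<close>. If \<open>u z0 > 0\<close>,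
  then \<open>u \<ge> u z0 / 2\<close> on a small square, which for \<open>e\<close> small carries a fixed portion of the mass
  of \<open>k\<close>; outside it \<open>k \<le> 1\<close>, so that this part is absorbed into the integral of \<open>\<bar>u\<bar>\<close>.\<close>

theorem subharmonic_le_mean:
  assumes u: "Ck_on 2 S u" and sub: "square_around z0 R \<subseteq> S" and R: "R > 0"
    and pos: "\<And>z. z \<in> square_around z0 R \<Longrightarrow> laplacian u z \<ge> 0"
  shows "u z0 \<le> 54 / R\<^sup>2 * integral (square_around z0 R) (\<lambda>z. \<bar>u z\<bar>)"
proof (cases "u z0 > 0")
  case False
  have "integral (square_around z0 R) (\<lambda>z. \<bar>u z\<bar>) \<ge> 0"
    by (cases "(\<lambda>z. \<bar>u z\<bar>) integrable_on square_around z0 R") (auto intro: integral_nonneg simp: not_integrable_integral)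
  then have "54 / R\<^sup>2 * integral (square_around z0 R) (\<lambda>z. \<bar>u z\<bar>) \<ge> 0" by simp
  then show ?thesis using False by linarith
next
  case True
  let ?Q = "square_around z0 R"
  have z0: "z0 \<in> square_around z0 r" if "r \<ge> 0" for r using that by (cases z0) (simp add: square_around_iff)
  have cu: "continuous_on ?Q u" using Ck_on_1D(4)[OF Ck_on_2D(1)[OF u]] sub continuous_on_subset by blast
  have "\<exists>\<rho>. 0 < \<rho> \<and> \<rho> \<le> R \<and> (\<forall>z\<in>square_around z0 \<rho>. u z \<ge> u z0 / 2)"
  proof -
    obtain d where d: "d > 0" "\<And>z. z \<in> ?Q \<Longrightarrow> dist z z0 < d \<Longrightarrow> dist (u z) (u z0) < u z0 / 2"
      using cu z0[of R] R True unfolding continuous_on_iff by (metis half_gt_zero less_imp_le)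
    define \<rho> where "\<rho> = min R (d / 3)"
    have "u z \<ge> u z0 / 2" if z: "z \<in> square_around z0 \<rho>" for z
    proof -
      have "dist (fst z) (fst z0) \<le> d/3" "dist (snd z) (snd z0) \<le> d/3"
        using z by (cases z, auto simp: square_around_iff \<rho>_def dist_real_def)+
      then have "dist z z0 < d"
        using d(1) sqrt_sum_squares_le_sum[of "dist (fst z) (fst z0)" "dist (snd z) (snd z0)"]
        by (simp add: dist_prod_def)
      moreover have "z \<in> ?Q" using z square_around_mono[of \<rho> R z0] by (auto simp: \<rho>_def)
      ultimately have "dist (u z) (u z0) < u z0 / 2" using d(2) by blast
      then show ?thesis unfolding dist_real_def by linarith
    qed
    then show ?thesis using R d(1) by (intro exI[of _ \<rho>]) (auto simp: \<rho>_def)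
  qed
  then obtain \<rho> where \<rho>: "0 < \<rho>" "\<rho> \<le> R" "\<And>z. z \<in> square_around z0 \<rho> \<Longrightarrow> u z \<ge> u z0 / 2" by blast
  \<comment> \<open>the half-width of the square on which the kernel concentrates; \<open>w R \<le> \<rho>\<^sup>2\<close> gives \<open>k \<le> 1\<close> outside the square of half-width \<open>\<rho>\<close>\<close>
  define w where "w = min (\<rho> / 2) (\<rho>\<^sup>2 / R)"
  have w: "0 < w" "w \<le> \<rho>" "w \<le> R / 2" "w * R \<le> \<rho>\<^sup>2"
  proof -
    show "0 < w" using \<rho> R by (simp add: w_def)
    have "w \<le> \<rho> / 2" unfolding w_def by (rule min.cobounded1)
    then show "w \<le> \<rho>" "w \<le> R / 2" using \<rho> by simp_all
    have "w \<le> \<rho>\<^sup>2 / R" unfolding w_def by (rule min.cobounded2)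
    then show "w * R \<le> \<rho>\<^sup>2" using R by (simp add: field_simps)
  qed
  define e where "e = w\<^sup>2 / R\<^sup>2"
  have e: "e > 0" using w R by (simp add: e_def)
  have e4: "e \<le> 1/4"
  proof -
    have "w\<^sup>2 \<le> (R/2)\<^sup>2" using w by (intro power_mono) auto
    then show ?thesis using R by (simp add: e_def field_simps power2_eq_square)
  qed
  define s where "s = scaled_square_dist z0 R"
  define c where "c t = max 0 (1 - t)" for t :: real
  have s0: "s z \<ge> 0" for z by (simp add: s_def scaled_square_dist_nonneg)
  have cs: "continuous_on A s" for A unfolding s_def by (rule continuous_on_scaled_square_dist)
  define T1 where "T1 t = - ((c t)\<^sup>2 / (t + e))" for t
  define T2 where "T2 t = 2 * c t / (t + e) + (c t)\<^sup>2 / (t + e)\<^sup>2" for t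
  define T where "T t = integral {t..1} (\<lambda>t. (c t)\<^sup>2 / (t + e))" for t
  define P where "P z = 2 * s z * c (s z) / (s z + e)" for z
  define k where "k z = e * (c (s z))\<^sup>2 / (s z + e)\<^sup>2" for z
  have se: "s z + e \<noteq> 0" "s z + e > 0" for z using s0[of z] e by linarith+
  have cP: "continuous_on A P" "continuous_on A k" for A
    unfolding P_def k_def c_def using se by (auto intro!: continuous_intros cs)
  have k0: "k z \<ge> 0" for z using e s0[of z] by (simp add: k_def)
  have P2: "0 \<le> P z" "P z \<le> 2" for z
  proof -
    have "s z * c (s z) \<le> s z * 1" by (intro mult_left_mono s0) (use s0[of z] in \<open>auto simp: c_def\<close>)
    then show "P z \<le> 2" "0 \<le> P z" using e s0[of z] se(2)[of z] by (auto simp: P_def field_simps c_def)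
  qed
  have "integral ?Q (\<lambda>z. u z * (4 / R\<^sup>2 * (s z * T2 (s z) + T1 (s z)))) = integral ?Q (\<lambda>z. T (s z) * laplacian u z)"
    unfolding s_def
  proof (rule green_radial[OF u sub R])
    fix t :: real assume t: "t \<ge> 0"
    show "(T has_real_derivative T1 t) (at t)" "(T1 has_real_derivative T2 t) (at t)"
      using truncated_logarithm(1,2)[OF e t] unfolding T_def T1_def T2_def c_def by simp_all
  next
    show "continuous_on {0..} T2" unfolding T2_def c_def using e by (intro continuous_intros) auto
    fix t :: real assume t: "t \<ge> 1"
    show "T t = 0" unfolding T_def using t by (cases "t = 1") auto
    show "T1 t = 0" unfolding T1_def c_def using t by simp
  qed
  moreover have "integral ?Q (\<lambda>z. T (s z) * laplacian u z) \<ge> 0"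
  proof (cases "(\<lambda>z. T (s z) * laplacian u z) integrable_on ?Q")
    case True
    have "T (s z) \<ge> 0" for z unfolding T_def c_def by (rule truncated_logarithm(3)[OF e s0])
    then show ?thesis using True pos by (intro integral_nonneg) auto
  qed (simp add: not_integrable_integral)
  moreover have "s z * T2 (s z) + T1 (s z) = P z - k z" for z
  proof -
    have "r * (2 * M / n + M\<^sup>2 / n\<^sup>2) + - (M\<^sup>2 / n) = 2 * r * M / n - (n - r) * M\<^sup>2 / n\<^sup>2"
      if "n \<noteq> 0" for M n r :: real
      using that by (simp add: field_simps power2_eq_square)
    from this[OF se(1)[of z], of "s z" "c (s z)"] show ?thesis
      by (simp add: T2_def T1_def P_def k_def)
  qed
  ultimately have "0 \<le> integral ?Q (\<lambda>z. u z * (4 / R\<^sup>2 * (P z - k z)))" by simp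
  also have "\<dots> = integral ?Q (\<lambda>z. (4 / R\<^sup>2) * (u z * P z - u z * k z))"
    by (intro Henstock_Kurzweil_Integration.integral_cong) (simp only: right_diff_distrib left_diff_distrib mult_ac)
  also have "\<dots> = 4 / R\<^sup>2 * integral ?Q (\<lambda>z. u z * P z - u z * k z)"
    by (rule Henstock_Kurzweil_Integration.integral_mult_right)
  finally have "integral ?Q (\<lambda>z. u z * P z - u z * k z) \<ge> 0"
    using R by (simp add: zero_le_mult_iff zero_le_divide_iff)
  moreover have int: "h integrable_on ?Q" if "continuous_on ?Q h" for h :: "real \<times> real \<Rightarrow> real"
    using that unfolding square_around_def by (rule integrable_continuous)
  ultimately have "integral ?Q (\<lambda>z. u z * k z) \<le> integral ?Q (\<lambda>z. u z * P z)"
    using cu cP by (subst (asm) Henstock_Kurzweil_Integration.integral_diff) (auto intro!: int continuous_intros)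
  also have "\<dots> \<le> integral ?Q (\<lambda>z. 2 * \<bar>u z\<bar>)"
  proof (rule integral_le)
    fix z
    have "u z * P z \<le> \<bar>u z\<bar> * P z" using P2(1)[of z] by (intro mult_right_mono) auto
    also have "\<dots> \<le> \<bar>u z\<bar> * 2" using P2(2)[of z] by (intro mult_left_mono) auto
    finally show "u z * P z \<le> 2 * \<bar>u z\<bar>" by simp
  qed (use cu cP in \<open>auto intro!: int continuous_intros\<close>)
  finally have upper: "integral ?Q (\<lambda>z. u z * k z) \<le> 2 * integral ?Q (\<lambda>z. \<bar>u z\<bar>)" by simp
  define g where "g z = u z * k z + \<bar>u z\<bar>" for z
  have cg: "continuous_on ?Q g" unfolding g_def using cu cP by (intro continuous_intros)
  have g0: "g z \<ge> 0" if z: "z \<in> ?Q" for z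
  proof (cases "z \<in> square_around z0 \<rho>")
    case True
    then have "u z \<ge> 0" using \<rho>(3)[of z] \<open>u z0 > 0\<close> by simp
    then show ?thesis using k0[of z] by (simp add: g_def)
  next
    case False
    have "\<rho>\<^sup>2 / R\<^sup>2 \<le> s z" unfolding s_def using scaled_square_dist_ge[OF False] \<rho>(1) by simp
    then have 1: "(\<rho>\<^sup>2 / R\<^sup>2)\<^sup>2 \<le> (s z + e)\<^sup>2" using e by (intro power_mono) auto
    have 2: "e \<le> (\<rho>\<^sup>2 / R\<^sup>2)\<^sup>2"
    proof -
      have "(w * R)\<^sup>2 \<le> (\<rho>\<^sup>2)\<^sup>2" using w R by (intro power_mono) auto
      then show ?thesis using R by (simp add: e_def field_simps power2_eq_square)
    qed
    have "e * (c (s z))\<^sup>2 \<le> e * 1\<^sup>2"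
      using e s0[of z] by (intro mult_left_mono power_mono) (auto simp: c_def)
    then have "e * (c (s z))\<^sup>2 \<le> e" by simp
    then have "e * (c (s z))\<^sup>2 \<le> (s z + e)\<^sup>2" using 1 2 by linarith
    then have "k z \<le> 1" using se(2)[of z] by (simp add: k_def)
    then have "\<bar>u z\<bar> * k z \<le> \<bar>u z\<bar> * 1" by (intro mult_left_mono) auto
    moreover have "- (\<bar>u z\<bar> * k z) \<le> u z * k z"
      using k0[of z] by (metis abs_ge_minus_self abs_mult abs_of_nonneg minus_le_iff)
    ultimately show ?thesis by (simp add: g_def)
  qed
  have gw: "g z \<ge> u z0 / (72 * e)" if z: "z \<in> square_around z0 w" for z
  proof -
    have s1: "s z \<le> 2 * e" unfolding s_def e_def using scaled_square_dist_le[OF z R] by simp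
    then have "c (s z) \<ge> 1/2" using e4 by (simp add: c_def)
    then have "(c (s z))\<^sup>2 \<ge> (1/2)\<^sup>2" by (intro power_mono) auto
    then have "e * (1/4) \<le> e * (c (s z))\<^sup>2" using e by (intro mult_left_mono) (auto simp: power2_eq_square)
    moreover have "(s z + e)\<^sup>2 \<le> (3 * e)\<^sup>2" using s1 s0[of z] e by (intro power_mono) auto
    ultimately have "e * (1/4) / (3 * e)\<^sup>2 \<le> k z"
      unfolding k_def using e se(2)[of z] by (intro frac_le) auto
    then have k: "1 / (36 * e) \<le> k z" using e by (simp add: power2_eq_square field_simps)
    have "u z \<ge> u z0 / 2" using \<rho>(3) z square_around_mono[OF w(2)] by blast
    then have "u z0 / 2 * (1 / (36 * e)) \<le> u z * k z" using k e \<open>u z0 > 0\<close> by (intro mult_mono) auto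
    then show ?thesis by (simp add: g_def)
  qed
  have "u z0 * R\<^sup>2 / 18 = integral (square_around z0 w) (\<lambda>z. u z0 / (72 * e))"
  proof -
    have "integral (square_around z0 w) (\<lambda>z. u z0 / (72 * e)) = measure lborel (square_around z0 w) * (u z0 / (72 * e))"
      unfolding square_around_def by simp
    also have "\<dots> = 4 * w\<^sup>2 * (u z0 / (72 * e))" using w(1) by (subst content_square_around) auto
    also have "\<dots> = u z0 * R\<^sup>2 / 18" using w(1) R by (simp add: e_def field_simps)
    finally show ?thesis ..
  qed
  also have "\<dots> \<le> integral (square_around z0 w) g"
  proof (rule integral_le)
    show "g integrable_on square_around z0 w"
      using continuous_on_subset[OF cg square_around_mono[of w R z0]] w R
      unfolding square_around_def by (intro integrable_continuous) auto
  qed (use gw in \<open>auto simp: square_around_def\<close>)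
  also have "\<dots> \<le> integral ?Q g"
  proof (rule integral_subset_le)
    show "square_around z0 w \<subseteq> ?Q" using w R by (intro square_around_mono) auto
    then show "g integrable_on square_around z0 w"
      using continuous_on_subset[OF cg] unfolding square_around_def by (intro integrable_continuous) auto
    show "g integrable_on ?Q" using cg by (rule int)
  qed (use g0 in auto)
  also have "\<dots> = integral ?Q (\<lambda>z. u z * k z) + integral ?Q (\<lambda>z. \<bar>u z\<bar>)"
    unfolding g_def using cu cP by (intro Henstock_Kurzweil_Integration.integral_add int continuous_intros) auto
  also have "\<dots> \<le> 3 * integral ?Q (\<lambda>z. \<bar>u z\<bar>)" using upper by simp
  finally show ?thesis using R by (simp add: field_simps)
qed

section \<open>Consistency of the discrete Laplacian\<close>

lemma second_difference:
  fixes p :: "real \<Rightarrow> real"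
  assumes "h > 0"
    and "\<And>t. \<bar>t - x\<bar> \<le> h \<Longrightarrow> (p has_real_derivative p1 t) (at t)"
      "\<And>t. \<bar>t - x\<bar> \<le> h \<Longrightarrow> (p1 has_real_derivative p2 t) (at t)"
    and "\<And>t. \<bar>t - x\<bar> \<le> h \<Longrightarrow> \<bar>p2 t - p2 x\<bar> \<le> \<tau>"
  shows "\<bar>p (x + h) + p (x - h) - 2 * p x - h\<^sup>2 * p2 x\<bar> \<le> h\<^sup>2 * \<tau>"
proof -
  define D where "D k = (if k = 0 then p else if k = Suc 0 then p1 else p2)" for k :: nat
  have D: "\<forall>k t. k < 2 \<and> x - h \<le> t \<and> t \<le> x + h \<longrightarrow> (D k has_real_derivative D (Suc k) t) (at t)"
    using assms(2,3) by (auto simp: D_def less_2_cases_iff abs_le_iff)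
  obtain r where r: "x < r" "r < x + h"
    "p (x + h) = (\<Sum>k<2. D k x / fact k * (x + h - x) ^ k) + D 2 r / fact 2 * (x + h - x) ^ 2"
    using Taylor_up[of 2 D p "x - h" "x + h" x] D assms(1) by (auto simp: D_def)
  obtain q where q: "x - h < q" "q < x"
    "p (x - h) = (\<Sum>k<2. D k x / fact k * (x - h - x) ^ k) + D 2 q / fact 2 * (x - h - x) ^ 2"
    using Taylor_down[of 2 D p "x - h" "x + h" x] D assms(1) by (auto simp: D_def)
  have "p (x + h) + p (x - h) - 2 * p x - h\<^sup>2 * p2 x = h\<^sup>2 * (((p2 r - p2 x) + (p2 q - p2 x)) / 2)"
    unfolding r(3) q(3) by (simp add: D_def numeral_2_eq_2 field_simps)
  moreover have "\<bar>((p2 r - p2 x) + (p2 q - p2 x)) / 2\<bar> \<le> \<tau>"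
    using assms(4)[of r] assms(4)[of q] r q by (auto simp: abs_le_iff)
  then have "\<bar>h\<^sup>2 * (((p2 r - p2 x) + (p2 q - p2 x)) / 2)\<bar> \<le> h\<^sup>2 * \<tau>"
    unfolding abs_mult abs_power2 by (intro mult_left_mono) simp_all
  ultimately show ?thesis by simp
qed

text \<open>Taylor's formula expresses a second difference through second derivatives at intermediate points,
  and these derivatives are uniformly continuous at a positive distance from the boundary.\<close>

theorem discrete_laplacian_consistent:
  assumes u: "Ck_on 2 (square a) u" and "d > 0" "\<tau> > 0"
  shows "\<forall>\<^sub>F h in at_right 0. \<forall>z\<in>cbox (d, d) (a - d, a - d). \<bar>discrete_laplacian h u z - laplacian u z\<bar> \<le> \<tau>"
proof -
  define K where "K = cbox (d/2, d/2) (a - d/2, a - d/2)"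
  have K: "K \<subseteq> square a" using \<open>d > 0\<close> by (auto simp: K_def cbox_Pair_eq square_iff)
  note C1 = Ck_on_1D[OF Ck_on_2D(1)[OF u]]
  note C2 = Ck_on_1D[OF Ck_on_2D(2)[OF u]]
  note C3 = Ck_on_1D[OF Ck_on_2D(3)[OF u]]
  have "uniformly_continuous_on K (D1 (D1 u))" "uniformly_continuous_on K (D2 (D2 u))"
    using continuous_on_subset[OF C2(2) K] continuous_on_subset[OF C3(3) K]
    unfolding K_def by (auto intro: compact_uniformly_continuous)
  then obtain e1 e2 where e: "e1 > 0" "e2 > 0"
    "\<And>z w. z \<in> K \<Longrightarrow> w \<in> K \<Longrightarrow> dist w z < e1 \<Longrightarrow> dist (D1 (D1 u) w) (D1 (D1 u) z) < \<tau> / 2"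
    "\<And>z w. z \<in> K \<Longrightarrow> w \<in> K \<Longrightarrow> dist w z < e2 \<Longrightarrow> dist (D2 (D2 u) w) (D2 (D2 u) z) < \<tau> / 2"
    unfolding uniformly_continuous_on_def using \<open>\<tau> > 0\<close> by (metis half_gt_zero)
  have main: "\<bar>discrete_laplacian h u z - laplacian u z\<bar> \<le> \<tau>"
    if h: "0 < h" "h < e1" "h < e2" "h \<le> d/2" and z: "z \<in> cbox (d, d) (a - d, a - d)" for h z
  proof -
    obtain x y where xy: "z = (x, y)" "d \<le> x" "x \<le> a - d" "d \<le> y" "y \<le> a - d"
      using z by (cases z) (auto simp: cbox_Pair_eq)
    have mem: "(t, y) \<in> K" if "\<bar>t - x\<bar> \<le> h" for t
      using that xy h by (auto simp: K_def cbox_Pair_eq abs_le_iff)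
    have mem': "(x, t) \<in> K" if "\<bar>t - y\<bar> \<le> h" for t
      using that xy h by (auto simp: K_def cbox_Pair_eq abs_le_iff)
    have "\<bar>u (x + h, y) + u (x - h, y) - 2 * u (x, y) - h\<^sup>2 * D1 (D1 u) (x, y)\<bar> \<le> h\<^sup>2 * (\<tau> / 2)"
    proof (rule second_difference[where p = "\<lambda>t. u (t, y)" and x = x, OF h(1)])
      fix t assume t: "\<bar>t - x\<bar> \<le> h"
      show "((\<lambda>t. u (t, y)) has_real_derivative D1 u (t, y)) (at t)"
        using C1(1) mem[OF t] K by (intro D1_has_real_derivative) blast
      show "((\<lambda>t. D1 u (t, y)) has_real_derivative D1 (D1 u) (t, y)) (at t)"
        using C2(1) mem[OF t] K by (intro D1_has_real_derivative) blast
      have "dist (t, y) (x, y) < e1" using t h by (simp add: dist_Pair_Pair dist_real_def)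
      then show "\<bar>D1 (D1 u) (t, y) - D1 (D1 u) (x, y)\<bar> \<le> \<tau> / 2"
        using e(3)[OF mem[of x] mem[OF t]] h by (simp add: dist_real_def)
    qed
    moreover have "\<bar>u (x, y + h) + u (x, y - h) - 2 * u (x, y) - h\<^sup>2 * D2 (D2 u) (x, y)\<bar> \<le> h\<^sup>2 * (\<tau> / 2)"
    proof (rule second_difference[where p = "\<lambda>t. u (x, t)" and x = y, OF h(1)])
      fix t assume t: "\<bar>t - y\<bar> \<le> h"
      show "((\<lambda>t. u (x, t)) has_real_derivative D2 u (x, t)) (at t)"
        using C1(1) mem'[OF t] K by (intro D2_has_real_derivative) blast
      show "((\<lambda>t. D2 u (x, t)) has_real_derivative D2 (D2 u) (x, t)) (at t)"
        using C3(1) mem'[OF t] K by (intro D2_has_real_derivative) blast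
      have "dist (x, t) (x, y) < e2" using t h by (simp add: dist_Pair_Pair dist_real_def)
      then show "\<bar>D2 (D2 u) (x, t) - D2 (D2 u) (x, y)\<bar> \<le> \<tau> / 2"
        using e(4)[OF mem'[of y] mem'[OF t]] h by (simp add: dist_real_def)
    qed
    moreover have "h\<^sup>2 * (discrete_laplacian h u z - laplacian u z) =
      (u (x + h, y) + u (x - h, y) - 2 * u (x, y) - h\<^sup>2 * D1 (D1 u) (x, y)) +
      (u (x, y + h) + u (x, y - h) - 2 * u (x, y) - h\<^sup>2 * D2 (D2 u) (x, y))"
      using h(1) by (simp add: discrete_laplacian_def neighbour_average_def laplacian_def xy(1) field_simps)
    moreover have "\<bar>A + B\<bar> \<le> k * \<tau>" if "\<bar>A\<bar> \<le> k * (\<tau> / 2)" "\<bar>B\<bar> \<le> k * (\<tau> / 2)" for A B k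
      using add_mono[OF that] abs_triangle_ineq[of A B] by (simp add: mult.commute)
    ultimately have "\<bar>h\<^sup>2 * (discrete_laplacian h u z - laplacian u z)\<bar> \<le> h\<^sup>2 * \<tau>" by (simp only:)
    then show ?thesis using h(1) by (simp add: abs_mult)
  qed
  have "\<forall>\<^sub>F h in at_right 0. 0 < h \<and> h < min (min e1 e2) (d / 2)"
    using e(1,2) \<open>d > 0\<close> eventually_at_right_real[of 0 "min (min e1 e2) (d / 2)"] by simp
  then show ?thesis by eventually_elim (use main in auto)
qed

section \<open>Test functions of product form\<close>

definition C1_line :: "(real \<Rightarrow> real) \<Rightarrow> (real \<Rightarrow> real) \<Rightarrow> bool" where
  "C1_line p p' \<longleftrightarrow> (\<forall>t. (p has_real_derivative p' t) (at t)) \<and> continuous_on UNIV p'"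

lemma C1_lineD:
  assumes "C1_line p p'"
  shows "(p has_real_derivative p' t) (at t)" "continuous_on UNIV p'" "continuous_on UNIV p"
proof -
  show *: "(p has_real_derivative p' t) (at t)" for t using assms unfolding C1_line_def by blast
  show "continuous_on UNIV p'" using assms unfolding C1_line_def by blast
  show "continuous_on UNIV p" by (intro continuous_at_imp_continuous_on ballI DERIV_isCont[OF *])
qed

lemma C1_product:
  assumes "C1_line p p'" "C1_line q q'"
  defines "\<psi> \<equiv> \<lambda>z. p (fst z) * q (snd z)"
  shows "Ck_on 1 UNIV \<psi>" "D1 \<psi> = (\<lambda>z. p' (fst z) * q (snd z))" "D2 \<psi> = (\<lambda>z. p (fst z) * q' (snd z))"
proof -
  have "(\<psi> has_derivative (\<lambda>v. (p' (fst z) * q (snd z)) * fst v + (p (fst z) * q' (snd z)) * snd v)) (at z)" for z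
  proof -
    have "((\<lambda>z. p (fst z)) has_derivative (\<lambda>v. p' (fst z) * fst v)) (at z)"
      by (rule has_derivative_compose[of fst fst z UNIV p "\<lambda>v. p' (fst z) * v"])
        (use C1_lineD(1)[OF assms(1)] in \<open>auto intro: has_derivative_fst simp: has_field_derivative_def\<close>)
    moreover have "((\<lambda>z. q (snd z)) has_derivative (\<lambda>v. q' (snd z) * snd v)) (at z)"
      by (rule has_derivative_compose[of snd snd z UNIV q "\<lambda>v. q' (snd z) * v"])
        (use C1_lineD(1)[OF assms(2)] in \<open>auto intro: has_derivative_snd simp: has_field_derivative_def\<close>)
    ultimately have "(\<psi> has_derivative (\<lambda>v. p (fst z) * (q' (snd z) * snd v) + p' (fst z) * fst v * q (snd z))) (at z)"
      unfolding \<psi>_def by (rule has_derivative_mult)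
    then show ?thesis by (simp add: algebra_simps)
  qed
  note D = partial_derivatives_eq[OF this]
  show D1: "D1 \<psi> = (\<lambda>z. p' (fst z) * q (snd z))" and D2: "D2 \<psi> = (\<lambda>z. p (fst z) * q' (snd z))"
    using D(2,3) by auto
  have c: "continuous_on UNIV (\<lambda>z::real \<times> real. h (fst z))" "continuous_on UNIV (\<lambda>z::real \<times> real. h (snd z))"
    if "continuous_on UNIV h" for h :: "real \<Rightarrow> real"
    by (rule continuous_on_compose2[OF that]; simp add: continuous_on_fst continuous_on_snd)+
  note cp = c(1)[OF C1_lineD(2)[OF assms(1)]] c(1)[OF C1_lineD(3)[OF assms(1)]]
    c(2)[OF C1_lineD(2)[OF assms(2)]] c(2)[OF C1_lineD(3)[OF assms(2)]]
  show "Ck_on 1 UNIV \<psi>"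
    unfolding One_nat_def Ck_on.simps D1 D2 using D(1) cp by (intro conjI ballI continuous_on_mult) simp_all
qed

lemma test_function_product:
  assumes p: "C1_line p p'" "\<And>t. t \<notin> {\<alpha>..\<beta>} \<Longrightarrow> p t = 0"
    and q: "C1_line q q'" "\<And>t. t \<notin> {\<gamma>..\<delta>} \<Longrightarrow> q t = 0"
    and sub: "cbox (\<alpha>, \<gamma>) (\<beta>, \<delta>) \<subseteq> square a"
  shows "test_function a (\<lambda>z. p (fst z) * q (snd z))"
proof -
  have *: "{z. p (fst z) * q (snd z) \<noteq> 0} \<subseteq> cbox (\<alpha>, \<gamma>) (\<beta>, \<delta>)"
    using p(2) q(2) by (force simp: cbox_Pair_eq)
  then have cl: "closure {z. p (fst z) * q (snd z) \<noteq> 0} \<subseteq> cbox (\<alpha>, \<gamma>) (\<beta>, \<delta>)"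
    by (intro closure_minimal) auto
  have "bounded {z. p (fst z) * q (snd z) \<noteq> 0}" by (rule bounded_subset[OF bounded_cbox *])
  then have "compact (closure {z. p (fst z) * q (snd z) \<noteq> 0})" by (simp only: compact_closure)
  then show ?thesis
    unfolding test_function_def using cl sub C1_product(1)[OF p(1) q(1)] by blast
qed

lemma test_function_zero_outside: "test_function a \<psi> \<Longrightarrow> z \<notin> square a \<Longrightarrow> \<psi> z = 0"
  unfolding test_function_def using closure_subset[of "{z. \<psi> z \<noteq> 0}"] by blast

lemma test_function_continuous: "test_function a \<psi> \<Longrightarrow> continuous_on UNIV \<psi>"
  unfolding test_function_def using Ck_on_1D(4) by blast

section \<open>The fundamental lemma of the calculus of variations\<close>

text \<open>The function \<open>\<kappa> = ((t - \<alpha>)\<^sub>+ (\<beta> - t)\<^sub>+)\<^sup>2\<close> is continuously differentiable and positive exactly between \<open>\<alpha>\<close>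
  and \<open>\<beta>\<close>; hence \<open>n \<kappa> / (1 + n \<kappa>)\<close> tends to the indicator of that interval.\<close>

definition plateau :: "real \<Rightarrow> real \<Rightarrow> real \<Rightarrow> real \<Rightarrow> real" where
  "plateau \<alpha> \<beta> n t = n * ((max 0 (t - \<alpha>))\<^sup>2 * (max 0 (\<beta> - t))\<^sup>2) / (1 + n * ((max 0 (t - \<alpha>))\<^sup>2 * (max 0 (\<beta> - t))\<^sup>2))"

lemma plateau_bounds: "n \<ge> 0 \<Longrightarrow> 0 \<le> plateau \<alpha> \<beta> n t" "n \<ge> 0 \<Longrightarrow> plateau \<alpha> \<beta> n t \<le> 1"
proof -
  have *: "0 \<le> n * \<kappa> / (1 + n * \<kappa>)" "n * \<kappa> / (1 + n * \<kappa>) \<le> 1" if "n \<ge> 0" "\<kappa> \<ge> 0" for \<kappa> :: real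
    using mult_nonneg_nonneg[OF that] by (auto simp: divide_le_eq_1)
  show "n \<ge> 0 \<Longrightarrow> 0 \<le> plateau \<alpha> \<beta> n t" "n \<ge> 0 \<Longrightarrow> plateau \<alpha> \<beta> n t \<le> 1"
    unfolding plateau_def by (intro *; simp)+
qed

lemma plateau_zero: "t \<notin> {\<alpha>..\<beta>} \<Longrightarrow> plateau \<alpha> \<beta> n t = 0"
  by (auto simp: plateau_def)

lemma plateau_C1:
  assumes "n \<ge> 0"
  shows "\<exists>p'. C1_line (plateau \<alpha> \<beta> n) p'"
proof -
  define \<kappa> where "\<kappa> t = (max 0 (t - \<alpha>))\<^sup>2 * (max 0 (\<beta> - t))\<^sup>2" for t
  define \<kappa>' where "\<kappa>' t = (2 * max 0 (t - \<alpha>)) * (max 0 (\<beta> - t))\<^sup>2 - 2 * max 0 (\<beta> - t) * (max 0 (t - \<alpha>))\<^sup>2" for t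
  have 1: "((\<lambda>t. (max 0 t)\<^sup>2) has_real_derivative 2 * max 0 t) (at t)" for t :: real
    using has_real_derivative_positive_part_power[of 0 t] by (simp add: numeral_2_eq_2)
  have "((\<lambda>t. (max 0 (t - \<alpha>))\<^sup>2) has_real_derivative 2 * max 0 (t - \<alpha>) * 1) (at t)" for t
    by (rule DERIV_chain2[OF 1]) (auto intro!: derivative_eq_intros)
  moreover have "((\<lambda>t. (max 0 (\<beta> - t))\<^sup>2) has_real_derivative 2 * max 0 (\<beta> - t) * - 1) (at t)" for t
    by (rule DERIV_chain2[OF 1]) (auto intro!: derivative_eq_intros)
  ultimately have d\<kappa>: "(\<kappa> has_real_derivative \<kappa>' t) (at t)" for t
    unfolding \<kappa>_def \<kappa>'_def using DERIV_mult by fastforce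
  have \<kappa>0: "\<kappa> t \<ge> 0" for t by (simp add: \<kappa>_def)
  have ne: "1 + n * \<kappa> t \<noteq> 0" for t using mult_nonneg_nonneg[OF assms \<kappa>0[of t]] by linarith
  have c: "continuous_on UNIV \<kappa>" "continuous_on UNIV \<kappa>'" unfolding \<kappa>_def \<kappa>'_def by (intro continuous_intros)+
  have d: "((\<lambda>t. n * \<kappa> t / (1 + n * \<kappa> t)) has_real_derivative
      (n * \<kappa>' t * (1 + n * \<kappa> t) - n * \<kappa> t * (n * \<kappa>' t)) / ((1 + n * \<kappa> t) * (1 + n * \<kappa> t))) (at t)" for t
  proof (rule DERIV_divide)
    show "1 + n * \<kappa> t \<noteq> 0" by (rule ne)
    show "((\<lambda>t. n * \<kappa> t) has_real_derivative n * \<kappa>' t) (at t)" by (rule DERIV_cmult[OF d\<kappa>])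
    show "((\<lambda>t. 1 + n * \<kappa> t) has_real_derivative n * \<kappa>' t) (at t)"
      using DERIV_add[OF DERIV_const DERIV_cmult[OF d\<kappa>], of 1 n t] by simp
  qed
  have "plateau \<alpha> \<beta> n = (\<lambda>t. n * \<kappa> t / (1 + n * \<kappa> t))" by (simp add: plateau_def \<kappa>_def fun_eq_iff)
  then have "C1_line (plateau \<alpha> \<beta> n) (\<lambda>t. (n * \<kappa>' t * (1 + n * \<kappa> t) - n * \<kappa> t * (n * \<kappa>' t)) / ((1 + n * \<kappa> t) * (1 + n * \<kappa> t)))"
    unfolding C1_line_def using d c ne by (auto intro!: continuous_intros)
  then show ?thesis by blast
qed

lemma plateau_tendsto:
  "(\<lambda>n. plateau (\<alpha> + 1 / real (Suc n)) (\<beta> - 1 / real (Suc n)) (real (Suc n)) t) \<longlonglongrightarrow> indicator {\<alpha><..<\<beta>} t"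
proof (cases "t \<in> {\<alpha><..<\<beta>}")
  case False
  have "plateau (\<alpha> + 1 / real (Suc n)) (\<beta> - 1 / real (Suc n)) (real (Suc n)) t = 0" for n
  proof (rule plateau_zero)
    have "1 / real (Suc n) > 0" by simp
    then show "t \<notin> {\<alpha> + 1 / real (Suc n)..\<beta> - 1 / real (Suc n)}" 
      using False unfolding atLeastAtMost_iff greaterThanLessThan_iff by linarith
  qed
  then show ?thesis using False by simp
next
  case True
  define \<kappa> where "\<kappa> n = (max 0 (t - (\<alpha> + 1 / real (Suc n))))\<^sup>2 * (max 0 (\<beta> - 1 / real (Suc n) - t))\<^sup>2" for n
  have r0: "(\<lambda>n. 1 / real (Suc n)) \<longlonglongrightarrow> 0" using LIMSEQ_inverse_real_of_nat by (simp add: inverse_eq_divide)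
  have "\<kappa> \<longlonglongrightarrow> (max 0 (t - (\<alpha> + 0)))\<^sup>2 * (max 0 (\<beta> - 0 - t))\<^sup>2"
    unfolding \<kappa>_def by (intro tendsto_intros r0)
  note * = this
  have pos: "(max 0 (t - (\<alpha> + 0)))\<^sup>2 * (max 0 (\<beta> - 0 - t))\<^sup>2 > 0" using True by simp
  have \<kappa>: "\<kappa> \<longlonglongrightarrow> (max 0 (t - (\<alpha> + 0)))\<^sup>2 * (max 0 (\<beta> - 0 - t))\<^sup>2" "(\<lambda>n. 1 / real (Suc n) + \<kappa> n) \<longlonglongrightarrow> 0 + (max 0 (t - (\<alpha> + 0)))\<^sup>2 * (max 0 (\<beta> - 0 - t))\<^sup>2"
    by (rule *, rule tendsto_add[OF r0 *])
  have "(\<lambda>n. \<kappa> n / (1 / real (Suc n) + \<kappa> n)) \<longlonglongrightarrow> ((max 0 (t - (\<alpha> + 0)))\<^sup>2 * (max 0 (\<beta> - 0 - t))\<^sup>2) / (0 + (max 0 (t - (\<alpha> + 0)))\<^sup>2 * (max 0 (\<beta> - 0 - t))\<^sup>2)"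
    by (rule tendsto_divide[OF \<kappa>]) (use pos in linarith)
  moreover have "plateau (\<alpha> + 1 / real (Suc n)) (\<beta> - 1 / real (Suc n)) (real (Suc n)) t = \<kappa> n / (1 / real (Suc n) + \<kappa> n)" for n
  proof -
    have *: "x * \<kappa> n / (1 + x * \<kappa> n) = \<kappa> n / (1 / x + \<kappa> n)" if "x > 0" for x
    proof -
      have "x * \<kappa> n / (1 + x * \<kappa> n) = (x * \<kappa> n) / (x * (1 / x + \<kappa> n))" using that by (simp add: distrib_left)
      then show ?thesis using that by simp
    qed
    show ?thesis unfolding plateau_def \<kappa>_def[symmetric] by (rule *) simp
  qed
  ultimately show ?thesis using True pos by simp
qed

lemma integrable_lebesgue_on_borel_version:
  fixes h :: "'a::euclidean_space \<Rightarrow> real"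
  assumes "integrable (lebesgue_on S) h" "S \<in> sets lebesgue"
  obtains h' where "integrable lborel h'" "AE z in lebesgue. indicator S z * h z = h' z"
proof -
  have int: "integrable lebesgue (\<lambda>z. indicator S z * h z)"
    using assms integrable_restrict_space[of S lebesgue h] by simp
  then obtain h' where h': "h' \<in> borel_measurable lborel" "AE z in lborel. indicator S z * h z = h' z"
    using completion_ex_borel_measurable_real[of "\<lambda>z. indicator S z * h z" lborel] by auto
  have AE: "AE z in lebesgue. indicator S z * h z = h' z" using h'(2) by (rule AE_completion)
  have m: "h' \<in> borel_measurable lebesgue" using h'(1) by (rule measurable_completion)
  have "integrable lebesgue h'"
    using int AE m by (subst integrable_cong_AE[of _ _ "\<lambda>z. indicator S z * h z"]) auto
  then have "integrable lborel h'" using h'(1) by (simp add: integrable_completion)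
  then show ?thesis using that AE by blast
qed

text \<open>Products of plateaus converge boundedly to the indicator of an open box intersected with the
  square; shrinking them by \<open>1 / (n + 1)\<close> keeps their supports compact in the square. So the integral of
  \<open>h\<close> over every box vanishes, and by Dynkin's argument also over every Borel set.\<close>

theorem fundamental_lemma:
  fixes h :: "real \<times> real \<Rightarrow> real"
  assumes int: "integrable (lebesgue_on (square a)) h"
    and zero: "\<And>\<psi>. test_function a \<psi> \<Longrightarrow> (LINT z|lebesgue_on (square a). \<psi> z * h z) = 0"
  shows "AE z in lebesgue_on (square a). h z = 0"
proof -
  have S: "square a \<in> sets lebesgue" unfolding square_eq_box by (rule fmeasurableD[OF lmeasurable_box])
  obtain h' where h': "integrable lborel h'" "AE z in lebesgue. indicator (square a) z * h z = h' z"
    using integrable_lebesgue_on_borel_version[OF int S] by blast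
  have m': "h' \<in> borel_measurable lborel" using h'(1) by auto
  have eq: "(LINT z|lebesgue_on (square a). \<psi> z * h z) = (LINT z|lborel. \<psi> z * h' z)"
    if \<psi>: "continuous_on UNIV \<psi>" for \<psi>
  proof -
    have mb: "\<psi> \<in> borel_measurable lborel" using \<psi> by (simp add: borel_measurable_continuous_onI)
    have "(LINT z|lebesgue_on (square a). \<psi> z * h z) = (LINT z|lebesgue. indicator (square a) z *\<^sub>R (\<psi> z * h z))"
      using S by (simp add: integral_restrict_space)
    also have "\<dots> = (LINT z|lebesgue. \<psi> z * h' z)"
    proof (rule integral_cong_AE)
      have "\<psi> \<in> borel_measurable lebesgue" using mb by (rule measurable_completion)
      moreover have "h' \<in> borel_measurable lebesgue" using m' by (rule measurable_completion)
      ultimately show "(\<lambda>z. \<psi> z * h' z) \<in> borel_measurable lebesgue" by measurable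
      have "(\<lambda>z. indicator (square a) z * h z) \<in> borel_measurable lebesgue"
        using int S integrable_restrict_space[of "square a" lebesgue h] by auto
      then have "(\<lambda>z. \<psi> z * (indicator (square a) z * h z)) \<in> borel_measurable lebesgue"
        using \<open>\<psi> \<in> borel_measurable lebesgue\<close> by measurable
      then show "(\<lambda>z. indicator (square a) z *\<^sub>R (\<psi> z * h z)) \<in> borel_measurable lebesgue"
        by (simp add: mult_ac)
      show "AE z in lebesgue. indicator (square a) z *\<^sub>R (\<psi> z * h z) = \<psi> z * h' z"
        using h'(2) by eventually_elim (simp add: mult_ac flip: mult.assoc)
    qed
    also have "\<dots> = (LINT z|lborel. \<psi> z * h' z)"
      by (intro integral_completion borel_measurable_times mb m')
    finally show ?thesis .
  qed
  have out: "AE z in lborel. h' z = indicator (square a) z * h' z"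
  proof -
    have "AE z in lebesgue. h' z = indicator (square a) z * h' z"
      using h'(2) by eventually_elim (auto simp: indicator_def)
    then show ?thesis by (simp only: AE_completion_iff)
  qed
  have mi: "(\<lambda>z. indicator A z * h' z) \<in> borel_measurable lborel" if "A \<in> sets borel" for A
    using that m' by (intro borel_measurable_times borel_measurable_indicator) auto
  have bs: "box l u \<inter> square a \<in> sets borel" "box l u \<in> sets borel" "square a \<in> sets borel" for l u :: "real \<times> real"
    using open_square by (auto intro: borel_open)
  have box0: "(LINT z:box l u|lborel. h' z) = 0" for l u :: "real \<times> real"
  proof -
    define \<alpha> \<beta> \<gamma> \<delta> where "\<alpha> = max 0 (fst l)" and "\<beta> = min a (fst u)" and "\<gamma> = max 0 (snd l)" and "\<delta> = min a (snd u)"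
    define \<psi> where "\<psi> n z = plateau (\<alpha> + 1 / real (Suc n)) (\<beta> - 1 / real (Suc n)) (real (Suc n)) (fst z) *
      plateau (\<gamma> + 1 / real (Suc n)) (\<delta> - 1 / real (Suc n)) (real (Suc n)) (snd z)" for n :: nat and z :: "real \<times> real"
    have test: "test_function a (\<psi> n)" for n
    proof -
      have n: "real (Suc n) \<ge> 0" by simp
      obtain p' where p': "C1_line (plateau (\<alpha> + 1 / real (Suc n)) (\<beta> - 1 / real (Suc n)) (real (Suc n))) p'"
        using plateau_C1[OF n] by blast
      obtain q' where q': "C1_line (plateau (\<gamma> + 1 / real (Suc n)) (\<delta> - 1 / real (Suc n)) (real (Suc n))) q'"
        using plateau_C1[OF n] by blast
      have r: "1 / real (Suc n) > 0" by simp
      show ?thesis unfolding \<psi>_def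
      proof (rule test_function_product[OF p' plateau_zero q' plateau_zero])
        show "cbox (\<alpha> + 1 / real (Suc n), \<gamma> + 1 / real (Suc n)) (\<beta> - 1 / real (Suc n), \<delta> - 1 / real (Suc n)) \<subseteq> square a"
        proof
          fix z assume z: "z \<in> cbox (\<alpha> + 1 / real (Suc n), \<gamma> + 1 / real (Suc n)) (\<beta> - 1 / real (Suc n), \<delta> - 1 / real (Suc n))"
          obtain x y where xy: "z = (x, y)" by (cases z)
          have "\<alpha> + 1 / real (Suc n) \<le> x" "x \<le> \<beta> - 1 / real (Suc n)"
            "\<gamma> + 1 / real (Suc n) \<le> y" "y \<le> \<delta> - 1 / real (Suc n)"
            using z unfolding xy mem_cbox_pair by blast+
          moreover have "0 \<le> \<alpha>" "\<beta> \<le> a" "0 \<le> \<gamma>" "\<delta> \<le> a" by (simp_all add: \<alpha>_def \<beta>_def \<gamma>_def \<delta>_def)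
          ultimately have "0 < x" "x < a" "0 < y" "y < a" using r by linarith+
          then show "z \<in> square a" unfolding xy by (simp add: square_iff)
        qed
      qed
    qed
    have lim: "(\<lambda>n. \<psi> n z) \<longlonglongrightarrow> indicator (box l u \<inter> square a) z" for z
    proof -
      have "(\<lambda>n. \<psi> n z) \<longlonglongrightarrow> indicator {\<alpha><..<\<beta>} (fst z) * indicator {\<gamma><..<\<delta>} (snd z)"
        unfolding \<psi>_def by (intro tendsto_mult plateau_tendsto)
      moreover have "indicator {\<alpha><..<\<beta>} (fst z) * indicator {\<gamma><..<\<delta>} (snd z) = (indicator (box l u \<inter> square a) z :: real)"
        by (cases z; cases l; cases u) (auto simp: \<alpha>_def \<beta>_def \<gamma>_def \<delta>_def indicator_def square_iff box_def Basis_prod_def)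
      ultimately show ?thesis by simp
    qed
    have bd: "\<bar>\<psi> n z\<bar> \<le> 1" for n z
      unfolding \<psi>_def abs_mult using plateau_bounds by (intro mult_le_one) auto
    have m\<psi>: "\<psi> n \<in> borel_measurable lborel" for n
      using test_function_continuous[OF test] by (simp add: borel_measurable_continuous_onI)
    have "(\<lambda>n. LINT z|lborel. \<psi> n z * h' z) \<longlonglongrightarrow> (LINT z|lborel. indicator (box l u \<inter> square a) z * h' z)"
    proof (rule integral_dominated_convergence[where w = "\<lambda>z. \<bar>h' z\<bar>"])
      show "(\<lambda>z. indicator (box l u \<inter> square a) z * h' z) \<in> borel_measurable lborel"
        by (rule mi[OF bs(1)])
      show "AE z in lborel. norm (\<psi> n z * h' z) \<le> \<bar>h' z\<bar>" for n
        using mult_right_mono[OF bd] by (auto simp: abs_mult)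
      show "AE z in lborel. (\<lambda>n. \<psi> n z * h' z) \<longlonglongrightarrow> indicator (box l u \<inter> square a) z * h' z"
        by (intro AE_I2 tendsto_mult lim tendsto_const)
    qed (use h'(1) m' m\<psi> in auto)
    moreover have "(LINT z|lborel. \<psi> n z * h' z) = 0" for n
      using eq[OF test_function_continuous[OF test]] zero[OF test] by simp
    ultimately have "(LINT z|lborel. indicator (box l u \<inter> square a) z * h' z) = 0"
      by (simp add: LIMSEQ_const_iff)
    moreover have "(LINT z|lborel. indicator (box l u \<inter> square a) z * h' z) = (LINT z:box l u|lborel. h' z)"
      unfolding set_lebesgue_integral_def
    proof (rule integral_cong_AE)
      show "AE z in lborel. indicator (box l u \<inter> square a) z * h' z = indicator (box l u) z *\<^sub>R h' z"
        using out by eventually_elim (auto simp: indicator_def)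
    qed (use mi[OF bs(1)] mi[OF bs(2)] in simp_all)
    ultimately show ?thesis by simp
  qed
  have set0: "(LINT z:A|lborel. h' z) = 0" if "A \<in> sets lborel" for A
  proof -
    let ?G = "range (\<lambda>(l, u). box l u) :: (real \<times> real) set set"
    have meas: "B \<in> sets lborel" if "B \<in> sigma_sets UNIV ?G" for B
      using that by (simp add: borel_eq_box)
    have si: "set_integrable lborel B h'" if "B \<in> sets lborel" for B
      unfolding set_integrable_def using that h'(1) by (rule integrable_mult_indicator)
    have whole: "(LINT z:UNIV|lborel. h' z) = 0"
    proof -
      have "(LINT z:UNIV|lborel. h' z) = (LINT z:square a|lborel. h' z)"
        unfolding set_lebesgue_integral_def
        by (rule integral_cong_AE) (use m' out mi[OF bs(3)] in \<open>auto elim!: eventually_mono\<close>)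
      then show ?thesis using box0 by (simp add: square_eq_box)
    qed
    show ?thesis
    proof (rule sigma_sets_induct_disjoint[where G = ?G and \<Omega> = UNIV and P = "\<lambda>A. (LINT z:A|lborel. h' z) = 0"])
      show "Int_stable ?G" by (auto simp: Int_stable_def box_Int_box)
      show "A \<in> sigma_sets UNIV ?G" using that by (simp add: borel_eq_box)
    next
      fix B assume "B \<in> ?G"
      then show "(LINT z:B|lborel. h' z) = 0" using box0 by auto
    next
      fix B assume B: "B \<in> sigma_sets UNIV ?G" and 0: "(LINT z:B|lborel. h' z) = 0"
      have "(LINT z:(B \<union> (UNIV - B))|lborel. h' z) = (LINT z:B|lborel. h' z) + (LINT z:UNIV - B|lborel. h' z)"
        using meas[OF B] by (intro set_integral_Un si) auto
      then show "(LINT z:UNIV - B|lborel. h' z) = 0" using 0 whole by simp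
    next
      fix B :: "nat \<Rightarrow> (real \<times> real) set"
      assume B: "disjoint_family B" "range B \<subseteq> sigma_sets UNIV ?G" and 0: "\<And>i. (LINT z:B i|lborel. h' z) = 0"
      have m: "B i \<in> sets lborel" for i using B(2) by (intro meas) auto
      have "(LINT z:(\<Union>i. B i)|lborel. h' z) = (\<Sum>i. (LINT z:B i|lborel. h' z))"
        using m B(1) by (intro lebesgue_integral_countable_add si) (auto simp: disjoint_family_on_def)
      then show "(LINT z:\<Union> (range B)|lborel. h' z) = 0" using 0 by simp
    qed (auto simp: set_lebesgue_integral_def)
  qed
  have "AE z in lborel. h' z = 0"
    using sigma_finite_measure.density_zero[OF sigma_finite_lborel h'(1)] set0 by blast
  then have "AE z in lebesgue. h' z = 0" by (rule AE_completion)
  with h'(2) have "AE z in lebesgue. z \<in> square a \<longrightarrow> h z = 0"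
    by eventually_elim (auto simp: indicator_def)
  then show ?thesis using S by (simp add: AE_restrict_space_iff)
qed

section \<open>Square integrable functions on the square\<close>

lemma square_lebesgue: "square a \<in> sets lebesgue"
  unfolding square_eq_box by (rule fmeasurableD[OF lmeasurable_box])

lemma finite_measure_square: "finite_measure (lebesgue_on (square a))"
  unfolding square_eq_box by (rule finite_measure_lebesgue_on[OF lmeasurable_box])

lemma continuous_on_measurable_square:
  fixes f :: "real \<times> real \<Rightarrow> 'b::euclidean_space"
  shows "continuous_on (square a) f \<Longrightarrow> f \<in> borel_measurable (lebesgue_on (square a))"
  by (rule continuous_imp_measurable_on_sets_lebesgue[OF _ square_lebesgue])

lemma square_subset_closed: "square a \<subseteq> cbox (0, 0) (a, a)"
  unfolding square_eq_box by (rule box_subset_cbox)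

lemma integrable_bounded_square:
  fixes f :: "real \<times> real \<Rightarrow> 'b::euclidean_space"
  assumes "f \<in> borel_measurable (lebesgue_on (square a))" "\<And>z. z \<in> square a \<Longrightarrow> norm (f z) \<le> B"
  shows "integrable (lebesgue_on (square a)) f"
  by (rule finite_measure.integrable_const_bound[OF finite_measure_square, where B = B])
    (use assms in \<open>auto intro!: AE_I2\<close>)

lemma continuous_bounded_on_square:
  fixes f :: "real \<times> real \<Rightarrow> 'b::euclidean_space"
  assumes "continuous_on (cbox (0, 0) (a, a)) f"
  obtains B where "B > 0" "\<And>z. z \<in> square a \<Longrightarrow> norm (f z) \<le> B"
proof -
  have "bounded (f ` cbox (0, 0) (a, a))"
    using assms by (intro compact_imp_bounded compact_continuous_image) auto
  then obtain B where "B > 0" "\<forall>y\<in>f ` cbox (0, 0) (a, a). norm y \<le> B" unfolding bounded_pos by blast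
  then show ?thesis using that[of B] square_subset_closed[of a] by blast
qed

lemma continuous_integrable_square:
  fixes f :: "real \<times> real \<Rightarrow> 'b::euclidean_space"
  assumes "continuous_on (cbox (0, 0) (a, a)) f"
  shows "integrable (lebesgue_on (square a)) f"
proof -
  obtain B where "\<And>z. z \<in> square a \<Longrightarrow> norm (f z) \<le> B" using continuous_bounded_on_square[OF assms] by blast
  then show ?thesis
    using continuous_on_subset[OF assms square_subset_closed]
    by (intro integrable_bounded_square continuous_on_measurable_square) auto
qed

lemma continuous_L2:
  fixes f :: "real \<times> real \<Rightarrow> 'b::euclidean_space"
  assumes "continuous_on (cbox (0, 0) (a, a)) f"
  shows "f \<in> L2 (lebesgue_on (square a))"
  unfolding L2_def using assms continuous_on_subset[OF assms square_subset_closed]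
  by (auto intro!: continuous_on_measurable_square continuous_integrable_square continuous_intros)

lemma L2D:
  assumes "f \<in> L2 M"
  shows "f \<in> borel_measurable M" "integrable M (\<lambda>z. (norm (f z))\<^sup>2)"
  using assms by (auto simp: L2_def)

lemma L2_scaleR_integrable:
  fixes f :: "'a \<Rightarrow> real" and g :: "'a \<Rightarrow> 'b::euclidean_space"
  assumes "f \<in> L2 M" "g \<in> L2 M"
  shows "integrable M (\<lambda>z. f z *\<^sub>R g z)"
proof (rule Bochner_Integration.integrable_bound[OF Bochner_Integration.integrable_add[OF L2D(2)[OF assms(1)] L2D(2)[OF assms(2)]]])
  show "(\<lambda>z. f z *\<^sub>R g z) \<in> borel_measurable M"
    using L2D(1)[OF assms(1)] L2D(1)[OF assms(2)] by measurable
  have "x * y \<le> x\<^sup>2 + y\<^sup>2" if "x \<ge> 0" "y \<ge> 0" for x y :: real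
    using sum_squares_bound[of x y] mult_nonneg_nonneg[OF that] by linarith
  note * = this[OF norm_ge_zero norm_ge_zero]
  show "AE z in M. norm (f z *\<^sub>R g z) \<le> norm ((norm (f z))\<^sup>2 + (norm (g z))\<^sup>2)"
  proof (rule AE_I2)
    fix z show "norm (f z *\<^sub>R g z) \<le> norm ((norm (f z))\<^sup>2 + (norm (g z))\<^sup>2)"
      using *[of "f z" "g z"] by simp
  qed
qed

lemma L2_mult_integrable:
  fixes f g :: "'a \<Rightarrow> real"
  assumes "f \<in> L2 M" "g \<in> L2 M"
  shows "integrable M (\<lambda>z. f z * g z)"
  using L2_scaleR_integrable[OF assms] by simp

lemma L2_add_scaleR:
  fixes f g :: "'a \<Rightarrow> 'b::euclidean_space"
  assumes "f \<in> L2 M" "g \<in> L2 M"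
  shows "(\<lambda>z. f z + t *\<^sub>R g z) \<in> L2 M"
proof -
  have m: "(\<lambda>z. f z + t *\<^sub>R g z) \<in> borel_measurable M"
    using L2D(1)[OF assms(1)] L2D(1)[OF assms(2)] by measurable
  have i: "integrable M (\<lambda>z. 2 * (norm (f z))\<^sup>2 + 2 * t\<^sup>2 * (norm (g z))\<^sup>2)"
    using L2D(2)[OF assms(1)] L2D(2)[OF assms(2)] by simp
  have "(norm (x + t *\<^sub>R y))\<^sup>2 \<le> 2 * (norm x)\<^sup>2 + 2 * t\<^sup>2 * (norm y)\<^sup>2" for x y :: 'b
  proof -
    have "(norm (x + t *\<^sub>R y))\<^sup>2 \<le> (norm x + \<bar>t\<bar> * norm y)\<^sup>2"
      using norm_triangle_ineq[of x "t *\<^sub>R y"] by (intro power_mono) auto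
    also have "\<dots> \<le> 2 * (norm x)\<^sup>2 + 2 * (\<bar>t\<bar> * norm y)\<^sup>2"
      using sum_squares_bound[of "norm x" "\<bar>t\<bar> * norm y"] by (simp add: power2_sum)
    finally show ?thesis by (simp add: power_mult_distrib)
  qed
  then have "integrable M (\<lambda>z. (norm (f z + t *\<^sub>R g z))\<^sup>2)"
    using m by (intro Bochner_Integration.integrable_bound[OF i]) (auto intro!: AE_I2 order_trans[OF _ abs_ge_self])
  with m show ?thesis by (simp add: L2_def)
qed

lemma L2_components:
  assumes "g \<in> L2 M"
  shows "(\<lambda>z. fst (g z) :: real) \<in> L2 M" "(\<lambda>z. snd (g z) :: real) \<in> L2 M"
proof -
  have m: "(\<lambda>z. fst (g z)) \<in> borel_measurable M" "(\<lambda>z. snd (g z)) \<in> borel_measurable M"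
    using L2D(1)[OF assms] by (auto intro: borel_measurable_continuous_on[OF _ L2D(1)[OF assms], where f = fst, OF continuous_on_fst[OF continuous_on_id]]
        borel_measurable_continuous_on[OF _ L2D(1)[OF assms], where f = snd, OF continuous_on_snd[OF continuous_on_id]])
  have *: "(fst x)\<^sup>2 \<le> (norm x)\<^sup>2" "(snd x)\<^sup>2 \<le> (norm x)\<^sup>2" for x :: "real \<times> real"
    by (simp_all add: norm_prod_def)
  have "integrable M (\<lambda>z. (norm (fst (g z)))\<^sup>2)" "integrable M (\<lambda>z. (norm (snd (g z)))\<^sup>2)"
    using m *[of "g _"] by (auto intro!: AE_I2 Bochner_Integration.integrable_bound[OF L2D(2)[OF assms]])
  with m show "(\<lambda>z. fst (g z)) \<in> L2 M" "(\<lambda>z. snd (g z)) \<in> L2 M" by (simp_all add: L2_def)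
qed

lemma lebesgue_square_eq_integral:
  fixes f :: "real \<times> real \<Rightarrow> real"
  assumes "integrable (lebesgue_on (square a)) f"
  shows "(LINT z|lebesgue_on (square a). f z) = integral (cbox (0, 0) (a, a)) f"
  using lebesgue_integral_eq_integral[OF assms square_lebesgue] integral_open_interval
  by (metis square_eq_box)

section \<open>Weak gradients\<close>

lemma Ck_on_1_add_cmult:
  assumes "Ck_on 1 UNIV v" "Ck_on 1 UNIV w"
  shows "Ck_on 1 UNIV (\<lambda>z. v z + t * w z)" "grad (\<lambda>z. v z + t * w z) = (\<lambda>z. grad v z + t *\<^sub>R grad w z)"
proof -
  have d: "((\<lambda>z. v z + t * w z) has_derivative (\<lambda>h. frechet_derivative v (at z) h + t * frechet_derivative w (at z) h)) (at z)" for z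
    using Ck_on_1D(1)[OF assms(1), of z] Ck_on_1D(1)[OF assms(2), of z]
    by (intro has_derivative_add has_derivative_mult_right) (auto simp: frechet_derivative_works)
  have D: "D1 (\<lambda>z. v z + t * w z) = (\<lambda>z. D1 v z + t * D1 w z)" "D2 (\<lambda>z. v z + t * w z) = (\<lambda>z. D2 v z + t * D2 w z)"
    unfolding D1_def D2_def using frechet_derivative_at[OF d] by (auto simp: fun_eq_iff)
  show "grad (\<lambda>z. v z + t * w z) = (\<lambda>z. grad v z + t *\<^sub>R grad w z)"
    by (simp add: grad_def D fun_eq_iff)
  have "(\<lambda>z. v z + t * w z) differentiable (at z)" for z using d differentiable_def by blast
  then show "Ck_on 1 UNIV (\<lambda>z. v z + t * w z)"
    unfolding One_nat_def Ck_on.simps D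
    using Ck_on_1D(2,3)[OF assms(1)] Ck_on_1D(2,3)[OF assms(2)]
    by (intro conjI ballI continuous_on_add continuous_on_mult continuous_on_const) simp_all
qed

lemma continuous_grad:
  assumes "Ck_on 1 UNIV \<psi>"
  shows "continuous_on A (grad \<psi>)"
  unfolding grad_def[abs_def]
  using continuous_on_subset[OF Ck_on_1D(2)[OF assms]] continuous_on_subset[OF Ck_on_1D(3)[OF assms]]
  by (intro continuous_on_Pair) auto

lemma test_function_L2:
  assumes "test_function a \<psi>"
  shows "\<psi> \<in> L2 (lebesgue_on (square a))" "grad \<psi> \<in> L2 (lebesgue_on (square a))"
  using continuous_on_subset[OF test_function_continuous[OF assms]] continuous_grad assms
  by (auto intro!: continuous_L2 simp: test_function_def)

lemma integral_LINT_pair: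
  fixes F :: "'a \<Rightarrow> real \<times> real"
  assumes "integrable M F"
  shows "fst (integral\<^sup>L M F) = (LINT z|M. fst (F z))" "snd (integral\<^sup>L M F) = (LINT z|M. snd (F z))"
  using integral_bounded_linear[OF bounded_linear_fst assms] integral_bounded_linear[OF bounded_linear_snd assms] by simp_all

lemma weak_gradient_components:
  assumes "weak_gradient a u g" "u \<in> L2 (lebesgue_on (square a))" "test_function a \<psi>"
  shows "(LINT z|lebesgue_on (square a). u z * D1 \<psi> z) = - (LINT z|lebesgue_on (square a). \<psi> z * fst (g z))"
    and "(LINT z|lebesgue_on (square a). u z * D2 \<psi> z) = - (LINT z|lebesgue_on (square a). \<psi> z * snd (g z))"
proof -
  have g: "g \<in> L2 (lebesgue_on (square a))" using assms(1) by (simp add: weak_gradient_def)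
  have i: "integrable (lebesgue_on (square a)) (\<lambda>z. u z *\<^sub>R grad \<psi> z)" "integrable (lebesgue_on (square a)) (\<lambda>z. \<psi> z *\<^sub>R g z)"
    using test_function_L2[OF assms(3)] assms(2) g by (auto intro: L2_scaleR_integrable)
  have "(LINT z|lebesgue_on (square a). u z *\<^sub>R grad \<psi> z) = - (LINT z|lebesgue_on (square a). \<psi> z *\<^sub>R g z)"
    using assms(1,3) by (simp add: weak_gradient_def)
  from arg_cong[OF this, of fst] arg_cong[OF this, of snd]
  show "(LINT z|lebesgue_on (square a). u z * D1 \<psi> z) = - (LINT z|lebesgue_on (square a). \<psi> z * fst (g z))"
    and "(LINT z|lebesgue_on (square a). u z * D2 \<psi> z) = - (LINT z|lebesgue_on (square a). \<psi> z * snd (g z))"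
    using integral_LINT_pair[OF i(1)] integral_LINT_pair[OF i(2)] by (simp_all add: grad_def)
qed

text \<open>The function \<open>wgrad\<close> is an arbitrary choice of a weak gradient; uniqueness makes it computable,
  almost everywhere, for perturbations of a given function.\<close>

theorem weak_gradient_unique:
  assumes g: "weak_gradient a u g" "weak_gradient a u k" and u: "u \<in> L2 (lebesgue_on (square a))"
  shows "AE z in lebesgue_on (square a). g z = k z"
proof -
  let ?M = "lebesgue_on (square a)"
  have L2: "g \<in> L2 ?M" "k \<in> L2 ?M" using g by (auto simp: weak_gradient_def)
  have one: "(\<lambda>_. 1 :: real) \<in> L2 ?M" by (intro continuous_L2 continuous_intros)
  have int: "integrable ?M (\<lambda>z. h z)" if "h \<in> L2 ?M" for h :: "real \<times> real \<Rightarrow> real"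
    using L2_mult_integrable[OF one that] by simp
  have "AE z in ?M. fst (g z) - fst (k z) = 0"
  proof (rule fundamental_lemma)
    show "integrable ?M (\<lambda>z. fst (g z) - fst (k z))"
      by (intro Bochner_Integration.integrable_diff int L2_components L2)
    fix \<psi> assume \<psi>: "test_function a \<psi>"
    have "(LINT z|?M. \<psi> z * (fst (g z) - fst (k z))) = (LINT z|?M. \<psi> z * fst (g z)) - (LINT z|?M. \<psi> z * fst (k z))"
      unfolding right_diff_distrib
      by (intro Bochner_Integration.integral_diff L2_mult_integrable test_function_L2(1)[OF \<psi>] L2_components L2)
    then show "(LINT z|?M. \<psi> z * (fst (g z) - fst (k z))) = 0"
      using weak_gradient_components(1)[OF g(1) u \<psi>] weak_gradient_components(1)[OF g(2) u \<psi>] by simp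
  qed
  moreover have "AE z in ?M. snd (g z) - snd (k z) = 0"
  proof (rule fundamental_lemma)
    show "integrable ?M (\<lambda>z. snd (g z) - snd (k z))"
      by (intro Bochner_Integration.integrable_diff int L2_components L2)
    fix \<psi> assume \<psi>: "test_function a \<psi>"
    have "(LINT z|?M. \<psi> z * (snd (g z) - snd (k z))) = (LINT z|?M. \<psi> z * snd (g z)) - (LINT z|?M. \<psi> z * snd (k z))"
      unfolding right_diff_distrib
      by (intro Bochner_Integration.integral_diff L2_mult_integrable test_function_L2(1)[OF \<psi>] L2_components L2)
    then show "(LINT z|?M. \<psi> z * (snd (g z) - snd (k z))) = 0"
      using weak_gradient_components(2)[OF g(1) u \<psi>] weak_gradient_components(2)[OF g(2) u \<psi>] by simp
  qed
  ultimately show ?thesis by eventually_elim (simp add: prod_eq_iff)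
qed

lemma integral_deriv_zero:
  fixes p p' :: "real \<Rightarrow> real"
  assumes "a \<ge> 0" "\<And>t. (p has_real_derivative p' t) (at t)" "p 0 = p a"
  shows "integral {0..a} p' = 0"
proof -
  have "(p' has_integral p a - p 0) {0..a}"
    using assms(1,2)
    by (intro fundamental_theorem_of_calculus) (auto simp: has_real_derivative_iff_has_vector_derivative[symmetric] intro: has_field_derivative_at_within)
  then show ?thesis using assms(3) by (simp add: integral_unique)
qed

theorem weak_gradient_C1:
  assumes a: "a > 0" and \<psi>: "Ck_on 1 UNIV \<psi>"
  shows "weak_gradient a \<psi> (grad \<psi>)"
  unfolding weak_gradient_def
proof (intro conjI allI impI)
  let ?M = "lebesgue_on (square a)" and ?Q = "cbox (0, 0) (a, a)"
  have L2: "\<psi> \<in> L2 ?M" "grad \<psi> \<in> L2 ?M"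
    using continuous_on_subset[OF Ck_on_1D(4)[OF \<psi>]] continuous_grad[OF \<psi>] by (auto intro: continuous_L2)
  then show "grad \<psi> \<in> L2 ?M" by simp
  fix \<eta> assume \<eta>: "test_function a \<eta>"
  then have \<eta>1: "Ck_on 1 UNIV \<eta>" by (simp add: test_function_def)
  have i: "integrable ?M (\<lambda>z. \<psi> z *\<^sub>R grad \<eta> z)" "integrable ?M (\<lambda>z. \<eta> z *\<^sub>R grad \<psi> z)"
    using test_function_L2[OF \<eta>] L2 by (auto intro: L2_scaleR_integrable)
  have c: "continuous_on ?Q \<psi>" "continuous_on ?Q \<eta>" "continuous_on ?Q (D1 \<psi>)" "continuous_on ?Q (D1 \<eta>)"
    "continuous_on ?Q (D2 \<psi>)" "continuous_on ?Q (D2 \<eta>)"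
    using Ck_on_1D[OF \<psi>] Ck_on_1D[OF \<eta>1] continuous_on_subset by blast+
  have edge: "\<eta> (0, y) = 0" "\<eta> (a, y) = 0" "\<eta> (x, 0) = 0" "\<eta> (x, a) = 0" for x y
    using test_function_zero_outside[OF \<eta>] by (auto simp: square_iff)
  have d1: "((\<lambda>s. \<psi> (s, y) * \<eta> (s, y)) has_real_derivative \<psi> (x, y) * D1 \<eta> (x, y) + \<eta> (x, y) * D1 \<psi> (x, y)) (at x)" for x y
    using DERIV_mult[OF D1_has_real_derivative[OF Ck_on_1D(1)[OF \<psi> UNIV_I], where x = x and y = y] D1_has_real_derivative[OF Ck_on_1D(1)[OF \<eta>1 UNIV_I], where x = x and y = y]]
    by (simp add: algebra_simps)
  have d2: "((\<lambda>s. \<psi> (x, s) * \<eta> (x, s)) has_real_derivative \<psi> (x, y) * D2 \<eta> (x, y) + \<eta> (x, y) * D2 \<psi> (x, y)) (at y)" for x y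
    using DERIV_mult[OF D2_has_real_derivative[OF Ck_on_1D(1)[OF \<psi> UNIV_I], where x = x and y = y] D2_has_real_derivative[OF Ck_on_1D(1)[OF \<eta>1 UNIV_I], where x = x and y = y]]
    by (simp add: algebra_simps)
  have c1: "continuous_on ?Q (\<lambda>z. \<psi> z * D1 \<eta> z + \<eta> z * D1 \<psi> z)" "continuous_on ?Q (\<lambda>z. \<psi> z * D2 \<eta> z + \<eta> z * D2 \<psi> z)"
    using c by (auto intro!: continuous_intros)
  have "integral ?Q (\<lambda>z. \<psi> z * D1 \<eta> z + \<eta> z * D1 \<psi> z) = integral {0..a} (\<lambda>y. 0)"
    unfolding integral_cbox_pair_iterated(2)[OF c1(1)]
    by (intro Henstock_Kurzweil_Integration.integral_cong integral_deriv_zero[OF _ d1]) (use a edge in auto)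
  then have "(LINT z|?M. \<psi> z * D1 \<eta> z + \<eta> z * D1 \<psi> z) = 0"
    by (simp add: lebesgue_square_eq_integral[OF continuous_integrable_square[OF c1(1)]])
  moreover have "(LINT z|?M. \<psi> z * D1 \<eta> z + \<eta> z * D1 \<psi> z) = (LINT z|?M. \<psi> z * D1 \<eta> z) + (LINT z|?M. \<eta> z * D1 \<psi> z)"
    using c by (intro Bochner_Integration.integral_add continuous_integrable_square continuous_on_mult) auto
  ultimately have 1: "(LINT z|?M. \<psi> z * D1 \<eta> z) = - (LINT z|?M. \<eta> z * D1 \<psi> z)" by simp
  have "integral ?Q (\<lambda>z. \<psi> z * D2 \<eta> z + \<eta> z * D2 \<psi> z) = integral {0..a} (\<lambda>y. 0)"
    unfolding integral_cbox_pair_iterated(1)[OF c1(2)]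
    by (intro Henstock_Kurzweil_Integration.integral_cong integral_deriv_zero[OF _ d2]) (use a edge in auto)
  then have "(LINT z|?M. \<psi> z * D2 \<eta> z + \<eta> z * D2 \<psi> z) = 0"
    by (simp add: lebesgue_square_eq_integral[OF continuous_integrable_square[OF c1(2)]])
  moreover have "(LINT z|?M. \<psi> z * D2 \<eta> z + \<eta> z * D2 \<psi> z) = (LINT z|?M. \<psi> z * D2 \<eta> z) + (LINT z|?M. \<eta> z * D2 \<psi> z)"
    using c by (intro Bochner_Integration.integral_add continuous_integrable_square continuous_on_mult) auto
  ultimately have 2: "(LINT z|?M. \<psi> z * D2 \<eta> z) = - (LINT z|?M. \<eta> z * D2 \<psi> z)" by simp
  show "(LINT z|?M. \<psi> z *\<^sub>R grad \<eta> z) = - (LINT z|?M. \<eta> z *\<^sub>R grad \<psi> z)"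
    using 1 2 integral_LINT_pair[OF i(1)] integral_LINT_pair[OF i(2)] by (simp add: prod_eq_iff grad_def)
qed

lemma weak_gradient_add_cmult:
  assumes "weak_gradient a u g" "weak_gradient a v k" "u \<in> L2 (lebesgue_on (square a))" "v \<in> L2 (lebesgue_on (square a))"
  shows "weak_gradient a (\<lambda>z. u z + t * v z) (\<lambda>z. g z + t *\<^sub>R k z)"
  unfolding weak_gradient_def
proof (intro conjI allI impI)
  let ?M = "lebesgue_on (square a)"
  have L2: "g \<in> L2 ?M" "k \<in> L2 ?M" using assms(1,2) by (auto simp: weak_gradient_def)
  then show "(\<lambda>z. g z + t *\<^sub>R k z) \<in> L2 ?M" by (rule L2_add_scaleR)
  fix \<psi> assume \<psi>: "test_function a \<psi>"
  note i = L2_scaleR_integrable[OF assms(3) test_function_L2(2)[OF \<psi>]] L2_scaleR_integrable[OF assms(4) test_function_L2(2)[OF \<psi>]]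
    L2_scaleR_integrable[OF test_function_L2(1)[OF \<psi>] L2(1)] L2_scaleR_integrable[OF test_function_L2(1)[OF \<psi>] L2(2)]
  have "(LINT z|?M. (u z + t * v z) *\<^sub>R grad \<psi> z) = (LINT z|?M. u z *\<^sub>R grad \<psi> z + t *\<^sub>R (v z *\<^sub>R grad \<psi> z))"
    by (simp add: scaleR_add_left del: scaleR_scaleR) simp
  also have "\<dots> = (LINT z|?M. u z *\<^sub>R grad \<psi> z) + t *\<^sub>R (LINT z|?M. v z *\<^sub>R grad \<psi> z)"
    using i by (simp del: scaleR_scaleR)
  also have "\<dots> = - ((LINT z|?M. \<psi> z *\<^sub>R g z) + t *\<^sub>R (LINT z|?M. \<psi> z *\<^sub>R k z))"
    using assms(1,2) \<psi> by (simp add: weak_gradient_def)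
  also have "(LINT z|?M. \<psi> z *\<^sub>R g z) + t *\<^sub>R (LINT z|?M. \<psi> z *\<^sub>R k z) = (LINT z|?M. \<psi> z *\<^sub>R g z + t *\<^sub>R (\<psi> z *\<^sub>R k z))"
    using i by (simp del: scaleR_scaleR)
  also have "\<dots> = (LINT z|?M. \<psi> z *\<^sub>R (g z + t *\<^sub>R k z))"
    by (simp add: scaleR_add_right mult.commute)
  finally show "(LINT z|?M. (u z + t * v z) *\<^sub>R grad \<psi> z) = - (LINT z|?M. \<psi> z *\<^sub>R (g z + t *\<^sub>R k z))" .
qed

lemma W12D:
  assumes "u \<in> W12 a"
  shows "u \<in> L2 (lebesgue_on (square a))" "weak_gradient a u (wgrad a u)"
  using assms someI_ex[of "weak_gradient a u"] by (auto simp: W12_def wgrad_def)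

lemma wgrad_perturbed:
  assumes a: "a > 0" and u: "u \<in> W12 a" and \<psi>: "Ck_on 1 UNIV \<psi>"
  shows "(\<lambda>z. u z + t * \<psi> z) \<in> W12 a"
    and "AE z in lebesgue_on (square a). wgrad a (\<lambda>z. u z + t * \<psi> z) z = wgrad a u z + t *\<^sub>R grad \<psi> z"
proof -
  have \<psi>L: "\<psi> \<in> L2 (lebesgue_on (square a))"
    using continuous_on_subset[OF Ck_on_1D(4)[OF \<psi>]] by (auto intro: continuous_L2)
  have L: "(\<lambda>z. u z + t * \<psi> z) \<in> L2 (lebesgue_on (square a))"
    using L2_add_scaleR[OF W12D(1)[OF u] \<psi>L, of t] by simp
  have w: "weak_gradient a (\<lambda>z. u z + t * \<psi> z) (\<lambda>z. wgrad a u z + t *\<^sub>R grad \<psi> z)"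
    by (rule weak_gradient_add_cmult[OF W12D(2)[OF u] weak_gradient_C1[OF a \<psi>] W12D(1)[OF u] \<psi>L])
  with L show W: "(\<lambda>z. u z + t * \<psi> z) \<in> W12 a" by (auto simp: W12_def)
  show "AE z in lebesgue_on (square a). wgrad a (\<lambda>z. u z + t * \<psi> z) z = wgrad a u z + t *\<^sub>R grad \<psi> z"
    by (rule weak_gradient_unique[OF W12D(2)[OF W] w L])
qed

section \<open>Traces\<close>

lemma perimeter_borel: "perimeter a \<in> borel_measurable borel"
  unfolding perimeter_def[abs_def] by measurable

lemma perimeter_measurable: "perimeter a \<in> borel_measurable (restrict_space lborel {0..<4 * a})"
  using perimeter_borel by (simp add: measurable_restrict_space1)

lemma perimeter_frontier:
  assumes "a > 0" "t \<in> {0..<4 * a}"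
  shows "perimeter a t \<in> frontier (square a)"
  using assms by (auto simp: perimeter_def frontier_square mem_cbox_pair square_iff)

lemma AE_boundary_measure:
  assumes "a > 0" "\<And>z. z \<in> frontier (square a) \<Longrightarrow> P z"
  shows "AE z in boundary_measure a. P z"
proof -
  have "{z \<in> space borel. z \<in> frontier (square a)} \<in> sets borel"
    by (simp add: borel_closed)
  from AE_distr_iff[OF perimeter_measurable this]
  have "AE z in boundary_measure a. z \<in> frontier (square a)"
    unfolding boundary_measure_def
    using perimeter_frontier[OF assms(1)] by (auto intro!: AE_I2 simp: space_restrict_space)
  then show ?thesis by (rule eventually_mono) (rule assms(2))
qed

text \<open>Adding \<open>t \<psi>\<close> to the approximating functions leaves all three differences unchanged, since \<open>\<psi>\<close> vanishes on
  the boundary.\<close>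

lemma has_trace_perturbed:
  assumes a: "a > 0" and u: "has_trace a u \<phi>" and \<psi>: "test_function a \<psi>"
  shows "has_trace a (\<lambda>z. u z + t * \<psi> z) \<phi>"
proof -
  let ?M = "lebesgue_on (square a)"
  have \<psi>1: "Ck_on 1 UNIV \<psi>" using \<psi> by (simp add: test_function_def)
  have uW: "u \<in> W12 a" and \<phi>: "\<phi> \<in> L2 (boundary_measure a)" using u by (auto simp: has_trace_def)
  obtain v where v: "\<And>k. Ck_on 1 UNIV (v k)"
    "(\<lambda>k. LINT z|?M. (v k z - u z)\<^sup>2) \<longlonglongrightarrow> 0"
    "(\<lambda>k. LINT z|?M. (norm (grad (v k) z - wgrad a u z))\<^sup>2) \<longlonglongrightarrow> 0"
    "(\<lambda>k. LINT z|boundary_measure a. (v k z - \<phi> z)\<^sup>2) \<longlonglongrightarrow> 0"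
    using u by (auto simp: has_trace_def)
  define w where "w k z = v k z + t * \<psi> z" for k z
  have wdef: "w k = (\<lambda>z. v k z + t * \<psi> z)" for k by (simp add: w_def fun_eq_iff)
  note wg = wgrad_perturbed[OF a uW \<psi>1, of t]
  have "(LINT z|?M. (w k z - (u z + t * \<psi> z))\<^sup>2) = (LINT z|?M. (v k z - u z)\<^sup>2)" for k
    by (simp add: w_def)
  moreover have "(LINT z|?M. (norm (grad (w k) z - wgrad a (\<lambda>z. u z + t * \<psi> z) z))\<^sup>2)
      = (LINT z|?M. (norm (grad (v k) z - wgrad a u z))\<^sup>2)" for k
  proof (rule integral_cong_AE)
    have m: "wgrad a (\<lambda>z. u z + t * \<psi> z) \<in> borel_measurable ?M" "wgrad a u \<in> borel_measurable ?M"
      using W12D(2)[OF wg(1)] W12D(2)[OF uW] by (auto simp: weak_gradient_def L2_def)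
    have "grad (w k) \<in> borel_measurable ?M" "grad (v k) \<in> borel_measurable ?M"
      using continuous_grad[OF v(1)] continuous_grad[OF Ck_on_1_add_cmult(1)[OF v(1) \<psi>1]]
      by (auto intro: continuous_on_measurable_square simp: wdef)
    with m show "(\<lambda>z. (norm (grad (w k) z - wgrad a (\<lambda>z. u z + t * \<psi> z) z))\<^sup>2) \<in> borel_measurable ?M"
      "(\<lambda>z. (norm (grad (v k) z - wgrad a u z))\<^sup>2) \<in> borel_measurable ?M" by measurable
    show "AE z in ?M. (norm (grad (w k) z - wgrad a (\<lambda>z. u z + t * \<psi> z) z))\<^sup>2 = (norm (grad (v k) z - wgrad a u z))\<^sup>2"
      using wg(2) by eventually_elim (simp add: wdef Ck_on_1_add_cmult(2)[OF v(1) \<psi>1])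
  qed
  moreover have "(LINT z|boundary_measure a. (w k z - \<phi> z)\<^sup>2) = (LINT z|boundary_measure a. (v k z - \<phi> z)\<^sup>2)" for k
  proof (rule integral_cong_AE)
    have b: "g \<in> borel_measurable (boundary_measure a)" if "continuous_on UNIV g" for g :: "real \<times> real \<Rightarrow> real"
      using borel_measurable_continuous_onI[OF that] by (simp add: boundary_measure_def)
    have "w k \<in> borel_measurable (boundary_measure a)" "v k \<in> borel_measurable (boundary_measure a)"
      using Ck_on_1D(4)[OF v(1)] Ck_on_1D(4)[OF Ck_on_1_add_cmult(1)[OF v(1) \<psi>1]] by (auto intro: b simp: wdef)
    with L2D(1)[OF \<phi>] show "(\<lambda>z. (w k z - \<phi> z)\<^sup>2) \<in> borel_measurable (boundary_measure a)"
      "(\<lambda>z. (v k z - \<phi> z)\<^sup>2) \<in> borel_measurable (boundary_measure a)" by measurable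
    show "AE z in boundary_measure a. (w k z - \<phi> z)\<^sup>2 = (v k z - \<phi> z)\<^sup>2"
    proof (rule AE_boundary_measure[OF a])
      fix z assume "z \<in> frontier (square a)"
      then have "\<psi> z = 0" using test_function_zero_outside[OF \<psi>] frontier_square[OF a] by auto
      then show "(w k z - \<phi> z)\<^sup>2 = (v k z - \<phi> z)\<^sup>2" by (simp add: w_def)
    qed
  qed
  moreover have "Ck_on 1 UNIV (w k)" for k unfolding wdef by (rule Ck_on_1_add_cmult(1)[OF v(1) \<psi>1])
  ultimately show ?thesis
    unfolding has_trace_def using wg(1) \<phi> v(2-4) by (intro conjI exI[of _ w] allI) simp_all
qed

section \<open>The potential of a monotone reaction\<close>

lemma monotone_reaction_lipschitz:
  assumes g: "monotone_reaction a L g" and x: "x \<in> square a" and "s \<ge> 0" "t \<ge> 0"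
  shows "\<bar>g x s - g x t\<bar> \<le> L * \<bar>s - t\<bar>"
  using monotone_reactionD(3,4)[OF g x, of s t] monotone_reactionD(3,4)[OF g x, of t s] assms(3,4)
  by (cases "s \<le> t") (auto simp: abs_le_iff)

lemma monotone_reaction_joint_continuous:
  assumes g: "monotone_reaction a L g"
  shows "continuous_on (square a \<times> {0..}) (\<lambda>(x, s). g x s)"
  unfolding continuous_on_def
proof (rule ballI)
  fix p0 :: "(real \<times> real) \<times> real" assume p0: "p0 \<in> square a \<times> {0..}"
  define x s where "x = fst p0" and "s = snd p0"
  have x: "x \<in> square a" and s: "s \<in> {0..}" and xs: "p0 = (x, s)" using p0 by (auto simp: x_def s_def)
  let ?F = "at (x, s) within square a \<times> {0..}"
  have L: "L \<ge> 0" by (rule monotone_reactionD(1)[OF g])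
  have mem: "\<forall>\<^sub>F p in ?F. fst p \<in> square a \<and> snd p \<ge> 0"
    unfolding eventually_at_filter by (intro always_eventually) (simp add: mem_Times_iff)
  have tf: "(fst \<longlongrightarrow> x) ?F" "(snd \<longlongrightarrow> s) ?F"
    using tendsto_fst[OF tendsto_ident_at] tendsto_snd[OF tendsto_ident_at] by (auto simp: fun_eq_iff o_def)
  have "continuous_on (square a) (\<lambda>x. g x s)" using monotone_reactionD(5)[OF g] s by simp
  then have "isCont (\<lambda>x. g x s) x" using open_square x by (simp add: continuous_on_eq_continuous_at)
  then have 1: "((\<lambda>p. g (fst p) s) \<longlongrightarrow> g x s) ?F"
    using isCont_tendsto_compose tf(1) by blast
  have "((\<lambda>p. L * \<bar>snd p - s\<bar>) \<longlongrightarrow> L * \<bar>s - s\<bar>) ?F" by (intro tendsto_intros tf)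
  then have 0: "((\<lambda>p. L * \<bar>snd p - s\<bar>) \<longlongrightarrow> 0) ?F" by simp
  have "((\<lambda>p. g (fst p) (snd p) - g (fst p) s) \<longlongrightarrow> 0) ?F"
  proof (rule Lim_null_comparison[OF _ 0])
    show "\<forall>\<^sub>F p in ?F. norm (g (fst p) (snd p) - g (fst p) s) \<le> L * \<bar>snd p - s\<bar>"
      using mem by eventually_elim (use monotone_reaction_lipschitz[OF g] s in auto)
  qed
  from tendsto_add[OF this 1] show "((\<lambda>(x, s). g x s) \<longlongrightarrow> (case p0 of (x, s) \<Rightarrow> g x s)) (at p0 within square a \<times> {0..})"
    by (simp add: xs case_prod_beta')
qed

lemma monotone_reaction_compose_continuous:
  assumes g: "monotone_reaction a L g" and w: "continuous_on (square a) w" "\<And>x. x \<in> square a \<Longrightarrow> w x \<ge> 0"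
  shows "continuous_on (square a) (\<lambda>x. g x (w x))"
proof -
  have "continuous_on (square a) (\<lambda>x. (\<lambda>(x, s). g x s) (x, w x))"
    by (rule continuous_on_compose2[OF monotone_reaction_joint_continuous[OF g]])
      (use w in \<open>auto intro!: continuous_on_Pair continuous_on_id\<close>)
  then show ?thesis by simp
qed

lemma monotone_reaction_continuous_in_s:
  assumes g: "monotone_reaction a L g" and x: "x \<in> square a"
  shows "continuous_on {0..} (g x)"
proof -
  have "continuous_on {0..} (\<lambda>s. (\<lambda>(x, s). g x s) (x, s))"
    by (rule continuous_on_compose2[OF monotone_reaction_joint_continuous[OF g]])
      (use x in \<open>auto intro!: continuous_on_Pair continuous_on_id continuous_on_const\<close>)
  then show ?thesis by simp
qed

text \<open>The first-order expansion of the potential with a quadratic remainder, valid for both signs of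
  \<open>t - s\<close>: for \<open>t < s\<close> it is the lower bound \<open>g x t \<ge> g x s - L (s - t)\<close> that enters.\<close>

lemma primitive_diff_le:
  assumes g: "monotone_reaction a L g" and x: "x \<in> square a" and s: "s \<ge> 0" "t \<ge> 0"
  shows "primitive g x t - primitive g x s \<le> (t - s) * g x s + L * (t - s)\<^sup>2"
proof -
  have int: "g x integrable_on {\<alpha>..\<beta>}" if "\<alpha> \<ge> 0" for \<alpha> \<beta>
    using that by (intro integrable_continuous_interval continuous_on_subset[OF monotone_reaction_continuous_in_s[OF g x]]) auto
  show ?thesis
  proof (cases "s \<le> t")
    case True
    have "primitive g x s + integral {s..t} (g x) = primitive g x t"
      unfolding primitive_def using True s by (simp add: Henstock_Kurzweil_Integration.integral_combine int)
    moreover have "integral {s..t} (g x) \<le> integral {s..t} (\<lambda>_. g x t)"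
      using s monotone_reactionD(3)[OF g x] by (intro integral_le int) auto
    moreover have "integral {s..t} (\<lambda>_. g x t) = (t - s) * g x t" using True by simp
    moreover have "(t - s) * g x t \<le> (t - s) * (g x s + L * (t - s))"
      using True monotone_reactionD(4)[OF g x s(1) True] by (intro mult_left_mono) auto
    ultimately show ?thesis by (simp add: power2_eq_square algebra_simps)
  next
    case False
    have "primitive g x t + integral {t..s} (g x) = primitive g x s"
      unfolding primitive_def using False s by (simp add: Henstock_Kurzweil_Integration.integral_combine int)
    moreover have "integral {t..s} (\<lambda>_. g x t) \<le> integral {t..s} (g x)"
      using s monotone_reactionD(3)[OF g x] by (intro integral_le int) auto
    moreover have "integral {t..s} (\<lambda>_. g x t) = (s - t) * g x t" using False by simp
    moreover have "(s - t) * (g x s - L * (s - t)) \<le> (s - t) * g x t"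
      using False monotone_reactionD(4)[OF g x s(2), of s] by (intro mult_left_mono) auto
    ultimately show ?thesis by (simp add: power2_eq_square algebra_simps)
  qed
qed

lemma primitive_nonneg:
  assumes g: "monotone_reaction a L g" and x: "x \<in> square a"
  shows "primitive g x s \<ge> 0"
  unfolding primitive_def
  using monotone_reactionD(2)[OF g x] continuous_on_subset[OF monotone_reaction_continuous_in_s[OF g x]]
  by (intro integral_nonneg integrable_continuous_interval) auto

text \<open>Over the fixed interval \<open>[0, 1]\<close> the dependence on \<open>x\<close> and \<open>s\<close> is under the integral sign only, where
  continuity of parameter integrals applies.\<close>

lemma primitive_scaled:
  assumes g: "monotone_reaction a L g" and x: "x \<in> square a" and s: "s \<ge> 0"
  shows "primitive g x s = s * integral {0..1} (\<lambda>\<tau>. g x (\<tau> * s))"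
proof (cases "s = 0")
  case True
  then show ?thesis by (simp add: primitive_def)
next
  case False
  then have s: "s > 0" using s by simp
  have "g x integrable_on {0..s}"
    by (intro integrable_continuous_interval continuous_on_subset[OF monotone_reaction_continuous_in_s[OF g x]]) auto
  then have "(g x has_integral primitive g x s) {0..s}"
    using s by (simp add: primitive_def has_integral_iff)
  from has_integral_affinity[of "g x" "primitive g x s" 0 s s 0] this s
  have "((\<lambda>\<tau>. g x (s * \<tau>)) has_integral (1 / s) * primitive g x s) ((\<lambda>x. x / s) ` {0..s})" by simp
  moreover have "(\<lambda>x. x / s) ` {0..s} = {0..1}"
    using s by (auto simp: image_iff field_simps intro!: bexI[of _ "_ * s"])
  ultimately have "integral {0..1} (\<lambda>\<tau>. g x (\<tau> * s)) = (1 / s) * primitive g x s"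
    by (simp add: integral_unique mult.commute)
  then show ?thesis using s by simp
qed

lemma primitive_compose_continuous:
  assumes g: "monotone_reaction a L g" and w: "continuous_on (square a) w" "\<And>x. x \<in> square a \<Longrightarrow> w x \<ge> 0"
  shows "continuous_on (square a) (\<lambda>x. primitive g x (w x))"
proof -
  have "continuous_on (square a \<times> cbox 0 1) (\<lambda>(x, \<tau>). g x (\<tau> * w x))"
  proof -
    have "continuous_on (square a \<times> cbox 0 (1::real)) (\<lambda>p. (\<lambda>(x, s). g x s) (fst p, snd p * w (fst p)))"
    proof (rule continuous_on_compose2[OF monotone_reaction_joint_continuous[OF g]])
      show "continuous_on (square a \<times> cbox 0 (1::real)) (\<lambda>p. (fst p, snd p * w (fst p)))"
        by (intro continuous_intros continuous_on_compose2[OF w(1)]) auto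
      show "(\<lambda>p. (fst p, snd p * w (fst p))) ` (square a \<times> cbox 0 (1::real)) \<subseteq> square a \<times> {0..}"
        using w(2) by auto
    qed
    then show ?thesis by (simp add: case_prod_beta')
  qed
  from integral_continuous_on_param[OF this]
  have "continuous_on (square a) (\<lambda>x. w x * integral {0..1} (\<lambda>\<tau>. g x (\<tau> * w x)))"
    using w(1) by (auto intro: continuous_on_mult)
  then show ?thesis
    by (rule continuous_on_eq) (use primitive_scaled[OF g] w(2) in auto)
qed

lemma primitive_integrable:
  assumes g: "monotone_reaction a L g" and w: "continuous_on (square a) w" "\<And>x. x \<in> square a \<Longrightarrow> w x \<ge> 0"
    and L2: "w \<in> L2 (lebesgue_on (square a))"
  shows "integrable (lebesgue_on (square a)) (\<lambda>x. primitive g x (w x))"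
proof -
  let ?M = "lebesgue_on (square a)"
  obtain K where K: "\<And>x. x \<in> square a \<Longrightarrow> g x 0 \<le> K" using g unfolding monotone_reaction_def by blast
  have one: "(\<lambda>_. 1 :: real) \<in> L2 ?M" by (intro continuous_L2 continuous_intros)
  have i: "integrable ?M (\<lambda>x. w x * K + L * (w x)\<^sup>2)"
    using L2_mult_integrable[OF one L2] L2D(2)[OF L2] by simp
  show ?thesis
  proof (rule Bochner_Integration.integrable_bound[OF i])
    show "(\<lambda>x. primitive g x (w x)) \<in> borel_measurable ?M"
      by (rule continuous_on_measurable_square[OF primitive_compose_continuous[OF g w]])
    show "AE x in ?M. norm (primitive g x (w x)) \<le> norm (w x * K + L * (w x)\<^sup>2)"
    proof (rule AE_I2)
      fix x assume "x \<in> space ?M"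
      then have x: "x \<in> square a" by simp
      have "primitive g x (w x) \<le> w x * g x 0 + L * (w x)\<^sup>2"
        using primitive_diff_le[OF g x order_refl w(2)[OF x]] by (simp add: primitive_def)
      also have "\<dots> \<le> w x * K + L * (w x)\<^sup>2" using K[OF x] w(2)[OF x] by (simp add: mult_left_mono)
      finally show "norm (primitive g x (w x)) \<le> norm (w x * K + L * (w x)\<^sup>2)"
        using primitive_nonneg[OF g x] by simp
    qed
  qed
qed

lemma L2_dominated:
  fixes f g :: "'a \<Rightarrow> real"
  assumes "f \<in> borel_measurable M" "g \<in> L2 M" "\<And>x. x \<in> space M \<Longrightarrow> \<bar>f x\<bar> \<le> \<bar>g x\<bar>"
  shows "f \<in> L2 M"
proof -
  have "(f x)\<^sup>2 \<le> (g x)\<^sup>2" if "x \<in> space M" for x using assms(3)[OF that] by (simp add: abs_le_square_iff)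
  then have "integrable M (\<lambda>z. (norm (f z))\<^sup>2)"
    using assms(1) by (intro Bochner_Integration.integrable_bound[OF L2D(2)[OF assms(2)]]) (auto intro!: AE_I2)
  with assms(1) show ?thesis by (simp add: L2_def)
qed

lemma reaction_L2:
  assumes g: "monotone_reaction a L g" and w: "continuous_on (square a) w" "\<And>x. x \<in> square a \<Longrightarrow> w x \<ge> 0"
    and L2: "w \<in> L2 (lebesgue_on (square a))"
  shows "(\<lambda>x. g x (w x)) \<in> L2 (lebesgue_on (square a))"
proof -
  obtain K where K: "\<And>x. x \<in> square a \<Longrightarrow> g x 0 \<le> K" using g unfolding monotone_reaction_def by blast
  show ?thesis
  proof (rule L2_dominated)
    show "(\<lambda>x. g x (w x)) \<in> borel_measurable (lebesgue_on (square a))"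
      by (rule continuous_on_measurable_square[OF monotone_reaction_compose_continuous[OF g w]])
    show "(\<lambda>x. K + L *\<^sub>R w x) \<in> L2 (lebesgue_on (square a))"
      by (intro L2_add_scaleR L2 continuous_L2 continuous_intros)
    fix x assume "x \<in> space (lebesgue_on (square a))"
    then have x: "x \<in> square a" by simp
    show "\<bar>g x (w x)\<bar> \<le> \<bar>K + L *\<^sub>R w x\<bar>"
      using monotone_reactionD(4)[OF g x order_refl w(2)[OF x]] monotone_reactionD(2)[OF g x w(2)[OF x]] K[OF x] by simp
  qed
qed

lemma L2_inner_integrable:
  fixes g k :: "'a \<Rightarrow> real \<times> real"
  assumes "g \<in> L2 M" "k \<in> L2 M"
  shows "integrable M (\<lambda>z. g z \<bullet> k z)"
proof -
  have "integrable M (\<lambda>z. fst (g z) * fst (k z) + snd (g z) * snd (k z))"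
    by (intro Bochner_Integration.integrable_add L2_mult_integrable L2_components assms)
  then show ?thesis by (simp add: inner_prod_def)
qed

section \<open>The Euler-Lagrange equation\<close>

text \<open>The exceptional set is open in the square, and a nonempty open set is not negligible.\<close>

lemma AE_closed_imp_everywhere:
  fixes h :: "real \<times> real \<Rightarrow> real"
  assumes "continuous_on (square a) h" "closed C" "AE z in lebesgue_on (square a). h z \<in> C" "z \<in> square a"
  shows "h z \<in> C"
proof (rule ccontr)
  assume z: "h z \<notin> C"
  define V where "V = square a \<inter> h -` (- C)"
  have "open V" unfolding V_def
    using assms(1,2) open_square by (intro continuous_open_preimage) auto
  moreover have "negligible V"
  proof -
    have "AE z in lebesgue. z \<in> square a \<longrightarrow> h z \<in> C"
      using assms(3) square_lebesgue by (subst (asm) AE_restrict_space_iff) auto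
    then have "AE z in lebesgue. z \<notin> V" by eventually_elim (auto simp: V_def)
    moreover have "V \<in> sets lebesgue" using \<open>open V\<close> by simp
    ultimately have "V \<in> null_sets lebesgue" by (subst (asm) AE_iff_null_sets[symmetric])
    then show ?thesis by (simp add: negligible_iff_null_sets)
  qed
  moreover have "z \<in> V" using z assms(4) by (simp add: V_def)
  ultimately show False using open_not_negligible by blast
qed

lemma constraint_set_segregated:
  assumes "u \<in> constraint_set a m \<phi>" "\<And>l. l \<in> {1..m} \<Longrightarrow> continuous_on (square a) (u l)" "z \<in> square a"
  shows "segregated_at m u z"
  unfolding segregated_at_def
proof (intro conjI ballI impI)
  fix l assume l: "l \<in> {1..m}"
  have "AE z in lebesgue_on (square a). u l z \<in> {0..}" using assms(1) l by (auto simp: constraint_set_def)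
  then show "u l z \<ge> 0" using AE_closed_imp_everywhere[OF assms(2)[OF l], of "{0..}"] assms(3) by simp
  fix p assume p: "p \<in> {1..m}" "l \<noteq> p"
  have "AE z in lebesgue_on (square a). u l z * u p z \<in> {0}" using assms(1) l p by (auto simp: constraint_set_def)
  then show "u l z * u p z = 0"
    using AE_closed_imp_everywhere[OF continuous_on_mult[OF assms(2)[OF l] assms(2)[OF p(1)]], of "{0}"] assms(3) by simp
qed

lemma linear_le_quadratic_imp_zero:
  fixes A B :: real
  assumes "t0 > 0" "\<And>t. \<bar>t\<bar> \<le> t0 \<Longrightarrow> 0 \<le> t * A + t\<^sup>2 * B"
  shows "A = 0"
proof (rule ccontr)
  assume "A \<noteq> 0"
  \<comment> \<open>small enough for the linear term to outweigh the quadratic one\<close>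
  define t where "t = min t0 (\<bar>A\<bar> / (2 * (\<bar>B\<bar> + 1)))"
  have t: "t > 0" "t \<le> t0" using \<open>A \<noteq> 0\<close> assms(1) by (simp_all add: t_def)
  have "t \<le> \<bar>A\<bar> / (2 * (\<bar>B\<bar> + 1))" by (simp add: t_def)
  then have "t * (2 * (\<bar>B\<bar> + 1)) \<le> \<bar>A\<bar>" by (simp add: pos_le_divide_eq)
  then have tB: "t * \<bar>B\<bar> < \<bar>A\<bar>" using t(1) by (simp add: algebra_simps)
  have "0 \<le> (- sgn A * t) * A + (- sgn A * t)\<^sup>2 * B"
    using t \<open>A \<noteq> 0\<close> by (intro assms(2)) (simp add: abs_mult)
  also have "(- sgn A * t) * A = - (t * \<bar>A\<bar>)" by (simp add: abs_sgn mult_ac)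
  also have "(- sgn A * t)\<^sup>2 = t\<^sup>2" using \<open>A \<noteq> 0\<close> by (simp add: power_mult_distrib sgn_if)
  also have "t\<^sup>2 * B \<le> t * (t * \<bar>B\<bar>)" using t(1) by (simp add: power2_eq_square mult_left_mono)
  also have "\<dots> < t * \<bar>A\<bar>" using tB t(1) by simp
  finally show False by simp
qed

locale smooth_minimizer =
  fixes a :: real and m :: nat and f :: "nat \<Rightarrow> real \<times> real \<Rightarrow> real \<Rightarrow> real"
    and \<phi> u :: "nat \<Rightarrow> real \<times> real \<Rightarrow> real"
  assumes a: "a > 0"
    and reaction: "l \<in> {1..m} \<Longrightarrow> \<exists>L. monotone_reaction a L (f l)"
    and data: "admissible_boundary_data a m \<phi>"
    and min: "minimizer a m f \<phi> u"
    and smooth: "l \<in> {1..m} \<Longrightarrow> Ck_on 2 (square a) (u l)"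
begin

abbreviation "M \<equiv> lebesgue_on (square a)"

lemma in_constraint_set: "u \<in> constraint_set a m \<phi>"
  using min by (simp add: minimizer_def)

lemma u_continuous: "l \<in> {1..m} \<Longrightarrow> continuous_on (square a) (u l)"
  using Ck_on_1D(4)[OF Ck_on_2D(1)[OF smooth]] .

lemma u_segregated: "z \<in> square a \<Longrightarrow> segregated_at m u z"
  by (rule constraint_set_segregated[OF in_constraint_set u_continuous])

lemma u_nonneg: "l \<in> {1..m} \<Longrightarrow> z \<in> square a \<Longrightarrow> u l z \<ge> 0"
  using segregated_at_nonneg[OF u_segregated] .

lemma u_W12: "l \<in> {1..m} \<Longrightarrow> u l \<in> W12 a" and u_trace: "l \<in> {1..m} \<Longrightarrow> has_trace a (u l) (\<phi> l)"
  and u_boundary: "l \<in> {1..m} \<Longrightarrow> z \<in> frontier (square a) \<Longrightarrow> u l z = \<phi> l z"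
  using in_constraint_set by (auto simp: constraint_set_def)

text \<open>All other components vanish where \<open>u l > 0\<close>; a perturbation supported there preserves segregation.\<close>

lemma perturbation_admissible:
  assumes l: "l \<in> {1..m}" and \<psi>: "test_function a \<psi>"
    and pos: "\<And>z. z \<in> square a \<Longrightarrow> u l z + t * \<psi> z \<ge> 0"
    and supp: "\<And>z. \<psi> z \<noteq> 0 \<Longrightarrow> u l z > 0"
  shows "u(l := (\<lambda>z. u l z + t * \<psi> z)) \<in> constraint_set a m \<phi>"
proof -
  define v where "v = u(l := (\<lambda>z. u l z + t * \<psi> z))"
  have vp: "v p = u p" if "p \<noteq> l" for p using that by (simp add: v_def)
  have vl: "v l = (\<lambda>z. u l z + t * \<psi> z)" by (simp add: v_def)
  have tr: "has_trace a (v p) (\<phi> p)" if "p \<in> {1..m}" for p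
    using has_trace_perturbed[OF a u_trace[OF l] \<psi>, of t] u_trace[OF that] vp vl by (cases "p = l") auto
  have bd: "v p z = \<phi> p z" if "p \<in> {1..m}" "z \<in> frontier (square a)" for p z
  proof -
    have "\<psi> z = 0" using that(2) frontier_square[OF a] test_function_zero_outside[OF \<psi>] by auto
    then show ?thesis using u_boundary[OF that] vp vl by (cases "p = l") auto
  qed
  have nn: "v p z \<ge> 0" if "p \<in> {1..m}" "z \<in> square a" for p z
    using u_nonneg[OF that] pos[OF that(2)] vp vl by (cases "p = l") auto
  have 0: "(u l z + t * \<psi> z) * u p z = 0" if p: "p \<in> {1..m}" "p \<noteq> l" and z: "z \<in> square a" for p z
  proof (cases "\<psi> z = 0")
    case True
    then show ?thesis using u_segregated[OF z] p l by (auto simp: segregated_at_def)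
  next
    case False
    then have "u p z = 0" using segregated_at_eq_0[OF u_segregated[OF z] l supp] p by simp
    then show ?thesis by simp
  qed
  have seg: "v p z * v q z = 0" if pq: "p \<in> {1..m}" "q \<in> {1..m}" "p \<noteq> q" and z: "z \<in> square a" for p q z
  proof -
    have "u p z * u q z = 0" using u_segregated[OF z] pq by (simp add: segregated_at_def)
    then show ?thesis
      using 0[OF _ _ z, of p] 0[OF _ _ z, of q] pq vp[of p] vp[of q] vl
      by (cases "p = l"; cases "q = l") (auto simp: mult.commute)
  qed
  have "v \<in> constraint_set a m \<phi>"
    unfolding constraint_set_def mem_Collect_eq
    using tr bd nn seg by (intro conjI ballI impI AE_I2) (auto simp: has_trace_def)
  then show ?thesis by (simp add: v_def)
qed

definition energy_density :: "(nat \<Rightarrow> real \<times> real \<Rightarrow> real) \<Rightarrow> nat \<Rightarrow> real \<times> real \<Rightarrow> real" where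
  "energy_density w i z = 1/2 * (norm (wgrad a (w i) z))\<^sup>2 + primitive (f i) z (w i z)"

lemma energy_density_integrable:
  assumes "w \<in> constraint_set a m \<phi>" "i \<in> {1..m}" "continuous_on (square a) (w i)"
  shows "integrable M (energy_density w i)"
proof -
  have W: "w i \<in> W12 a" using assms(1,2) by (auto simp: constraint_set_def)
  obtain L where L: "monotone_reaction a L (f i)" using reaction[OF assms(2)] by blast
  have "AE z in M. w i z \<in> {0..}" using assms(1,2) by (auto simp: constraint_set_def)
  then have nn: "w i z \<ge> 0" if "z \<in> square a" for z
    using AE_closed_imp_everywhere[OF assms(3) closed_atLeast _ that] by simp
  have "wgrad a (w i) \<in> L2 M" using W12D(2)[OF W] by (simp add: weak_gradient_def)
  then show ?thesis
    unfolding energy_density_def[abs_def]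
    by (intro Bochner_Integration.integrable_add integrable_mult_right L2D(2)
        primitive_integrable[OF L assms(3) nn W12D(1)[OF W]])
qed

text \<open>The energy changes by at most a linear term in \<open>t\<close>, the first variation, plus a quadratic one.\<close>

lemma energy_variation:
  assumes l: "l \<in> {1..m}" and \<psi>: "test_function a \<psi>"
    and pos: "\<And>z. z \<in> square a \<Longrightarrow> u l z + t * \<psi> z \<ge> 0"
    and supp: "\<And>z. \<psi> z \<noteq> 0 \<Longrightarrow> u l z > 0"
    and L: "monotone_reaction a L (f l)"
  shows "0 \<le> t * (LINT z|M. wgrad a (u l) z \<bullet> grad \<psi> z + \<psi> z * f l z (u l z)) +
    t\<^sup>2 * (LINT z|M. 1/2 * (norm (grad \<psi> z))\<^sup>2 + L * (\<psi> z)\<^sup>2)"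
proof -
  define v where "v = u(l := (\<lambda>z. u l z + t * \<psi> z))"
  have vC: "v \<in> constraint_set a m \<phi>" unfolding v_def by (rule perturbation_admissible[OF assms(1-4)])
  have \<psi>1: "Ck_on 1 UNIV \<psi>" using \<psi> by (simp add: test_function_def)
  have vl: "v l = (\<lambda>z. u l z + t * \<psi> z)" and vp: "p \<noteq> l \<Longrightarrow> v p = u p" for p by (simp_all add: v_def)
  have "continuous_on (square a) (v p)" if "p \<in> {1..m}" for p
    using u_continuous[OF that] continuous_on_subset[OF test_function_continuous[OF \<psi>]] vl vp
    by (cases "p = l") (auto intro!: continuous_intros)
  then have iv: "integrable M (energy_density v p)" if "p \<in> {1..m}" for p
    using energy_density_integrable[OF vC that] that by blast
  have iu: "integrable M (energy_density u p)" if "p \<in> {1..m}" for p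
    using energy_density_integrable[OF in_constraint_set that u_continuous[OF that]] .
  have e: "energy a m f w = (LINT z|M. (\<Sum>i=1..m. energy_density w i z))" for w
    by (simp add: energy_def energy_density_def)
  have "energy a m f u \<le> energy a m f v" using min vC by (simp add: minimizer_def)
  then have "(LINT z|M. (\<Sum>i=1..m. energy_density u i z)) \<le> (LINT z|M. (\<Sum>i=1..m. energy_density v i z))" by (simp only: e)
  then have "(\<Sum>i=1..m. LINT z|M. energy_density u i z) \<le> (\<Sum>i=1..m. LINT z|M. energy_density v i z)"
    using iu iv by (simp add: Bochner_Integration.integral_sum)
  moreover have "(\<Sum>i\<in>{1..m}-{l}. LINT z|M. energy_density u i z) = (\<Sum>i\<in>{1..m}-{l}. LINT z|M. energy_density v i z)"
    using vp by (intro sum.cong Bochner_Integration.integral_cong) (auto simp: energy_density_def)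
  ultimately have "(LINT z|M. energy_density u l z) \<le> (LINT z|M. energy_density v l z)"
    using l by (simp add: sum.remove[of _ l])
  moreover have wL: "wgrad a (u l) \<in> L2 M" using W12D(2)[OF u_W12[OF l]] by (simp add: weak_gradient_def)
  have i1: "integrable M (\<lambda>z. wgrad a (u l) z \<bullet> grad \<psi> z + \<psi> z * f l z (u l z))"
    by (intro Bochner_Integration.integrable_add L2_inner_integrable L2_mult_integrable wL test_function_L2[OF \<psi>]
        reaction_L2[OF L u_continuous[OF l] u_nonneg[OF l] W12D(1)[OF u_W12[OF l]]])
  have i2: "integrable M (\<lambda>z. 1/2 * (norm (grad \<psi> z))\<^sup>2 + L * (\<psi> z)\<^sup>2)"
    using L2D(2)[OF test_function_L2(1)[OF \<psi>]] L2D(2)[OF test_function_L2(2)[OF \<psi>]] by simp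
  ultimately have "0 \<le> (LINT z|M. energy_density v l z - energy_density u l z)" using iu[OF l] iv[OF l] by simp
  also have "\<dots> \<le> (LINT z|M. t * (wgrad a (u l) z \<bullet> grad \<psi> z + \<psi> z * f l z (u l z)) +
    t\<^sup>2 * (1/2 * (norm (grad \<psi> z))\<^sup>2 + L * (\<psi> z)\<^sup>2))"
  proof (rule integral_mono_AE)
    show "integrable M (\<lambda>z. energy_density v l z - energy_density u l z)" using iu[OF l] iv[OF l] by simp
    show "integrable M (\<lambda>z. t * (wgrad a (u l) z \<bullet> grad \<psi> z + \<psi> z * f l z (u l z)) +
      t\<^sup>2 * (1/2 * (norm (grad \<psi> z))\<^sup>2 + L * (\<psi> z)\<^sup>2))"
      by (intro Bochner_Integration.integrable_add integrable_mult_right i1 i2)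
    show "AE z in M. energy_density v l z - energy_density u l z \<le> t * (wgrad a (u l) z \<bullet> grad \<psi> z + \<psi> z * f l z (u l z)) +
      t\<^sup>2 * (1/2 * (norm (grad \<psi> z))\<^sup>2 + L * (\<psi> z)\<^sup>2)"
      using wgrad_perturbed(2)[OF a u_W12[OF l] \<psi>1, of t] AE_space
    proof eventually_elim
      fix z assume w: "wgrad a (\<lambda>z. u l z + t * \<psi> z) z = wgrad a (u l) z + t *\<^sub>R grad \<psi> z" and "z \<in> space M"
      then have z: "z \<in> square a" by simp
      have "primitive (f l) z (u l z + t * \<psi> z) - primitive (f l) z (u l z) \<le> t * \<psi> z * f l z (u l z) + L * (t * \<psi> z)\<^sup>2"
        using primitive_diff_le[OF L z u_nonneg[OF l z] pos[OF z]] by simp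
      moreover have "(norm (wgrad a (u l) z + t *\<^sub>R grad \<psi> z))\<^sup>2 =
        (norm (wgrad a (u l) z))\<^sup>2 + 2 * t * (wgrad a (u l) z \<bullet> grad \<psi> z) + t\<^sup>2 * (norm (grad \<psi> z))\<^sup>2"
        unfolding power2_norm_eq_inner inner_add_left inner_add_right inner_scaleR_left inner_scaleR_right
          inner_commute[of "grad \<psi> z" "wgrad a (u l) z"]
        by (simp only: power2_eq_square distrib_left mult_ac add_ac)
      ultimately show "energy_density v l z - energy_density u l z \<le> t * (wgrad a (u l) z \<bullet> grad \<psi> z + \<psi> z * f l z (u l z)) +
        t\<^sup>2 * (1/2 * (norm (grad \<psi> z))\<^sup>2 + L * (\<psi> z)\<^sup>2)"
        unfolding energy_density_def vl w by (simp add: power_mult_distrib algebra_simps)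
    qed
  qed
  also have "\<dots> = t * (LINT z|M. wgrad a (u l) z \<bullet> grad \<psi> z + \<psi> z * f l z (u l z)) +
    t\<^sup>2 * (LINT z|M. 1/2 * (norm (grad \<psi> z))\<^sup>2 + L * (\<psi> z)\<^sup>2)"
    by (subst Bochner_Integration.integral_add[OF integrable_mult_right[OF i1] integrable_mult_right[OF i2]]) (simp only: integral_mult_right_zero)
  finally show ?thesis .
qed

end

lemma lebesgue_square_localize:
  fixes F :: "real \<times> real \<Rightarrow> real"
  assumes "integrable (lebesgue_on (square a)) F" "Q \<subseteq> square a" "\<And>z. z \<in> square a - Q \<Longrightarrow> F z = 0"
  shows "(LINT z|lebesgue_on (square a). F z) = integral Q F"
proof -
  have "(LINT z|lebesgue_on (square a). F z) = integral (square a) F"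
    by (rule lebesgue_integral_eq_integral[OF assms(1) square_lebesgue])
  also have "\<dots> = integral (square a) (\<lambda>z. if z \<in> Q then F z else 0)"
    using assms(3) by (intro Henstock_Kurzweil_Integration.integral_cong) auto
  also have "\<dots> = integral Q F" using assms(2) by (simp add: integral_restrict_Int Int_absorb2)
  finally show ?thesis .
qed

text \<open>The third power makes the bump twice continuously differentiable; \<open>bump1\<close> and \<open>bump2\<close> are its
  derivatives.\<close>

definition bump :: "real \<Rightarrow> real \<Rightarrow> real \<Rightarrow> real" where
  "bump r c t = (max 0 (r\<^sup>2 - (t - c)\<^sup>2)) ^ 3"

definition bump1 :: "real \<Rightarrow> real \<Rightarrow> real \<Rightarrow> real" where
  "bump1 r c t = 3 * (max 0 (r\<^sup>2 - (t - c)\<^sup>2))\<^sup>2 * (- 2 * (t - c))"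

definition bump2 :: "real \<Rightarrow> real \<Rightarrow> real \<Rightarrow> real" where
  "bump2 r c t = 24 * max 0 (r\<^sup>2 - (t - c)\<^sup>2) * (t - c)\<^sup>2 - 6 * (max 0 (r\<^sup>2 - (t - c)\<^sup>2))\<^sup>2"

lemma bump_C1: "C1_line (bump r c) (bump1 r c)" and bump1_C1: "C1_line (bump1 r c) (bump2 r c)"
proof -
  have 3: "((\<lambda>t. (max 0 t) ^ 3) has_real_derivative 3 * (max 0 t)\<^sup>2) (at t)" for t :: real
    using has_real_derivative_positive_part_power[of 1 t] by (simp add: numeral_3_eq_3 numeral_2_eq_2)
  have 2: "((\<lambda>t. (max 0 t)\<^sup>2) has_real_derivative 2 * max 0 t) (at t)" for t :: real
    using has_real_derivative_positive_part_power[of 0 t] by (simp add: numeral_2_eq_2)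
  have q: "((\<lambda>t. r\<^sup>2 - (t - c)\<^sup>2) has_real_derivative - 2 * (t - c)) (at t)" for t
    by (auto intro!: derivative_eq_intros)
  show "C1_line (bump r c) (bump1 r c)"
    unfolding C1_line_def bump_def[abs_def] bump1_def[abs_def]
    by (intro conjI allI DERIV_chain2[OF 3 q] continuous_intros)
  have "(bump1 r c has_real_derivative bump2 r c t) (at t)" for t
  proof -
    have "((\<lambda>t. - 2 * (t - c)) has_real_derivative - 2) (at t)" by (auto intro!: derivative_eq_intros)
    from DERIV_mult[OF DERIV_cmult[OF DERIV_chain2[OF 2 q], of 3 t] this]
    show ?thesis unfolding bump1_def[abs_def] bump2_def by (simp add: power2_eq_square algebra_simps)
  qed
  then show "C1_line (bump1 r c) (bump2 r c)"
    unfolding C1_line_def by (auto simp: bump2_def[abs_def] intro!: continuous_intros)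
qed

lemma bump_outside:
  assumes "r > 0" "\<bar>t - c\<bar> \<ge> r"
  shows "bump r c t = 0" "bump1 r c t = 0" "bump2 r c t = 0"
proof -
  have "r\<^sup>2 \<le> (t - c)\<^sup>2" using assms by (metis abs_le_square_iff abs_of_pos)
  then show "bump r c t = 0" "bump1 r c t = 0" "bump2 r c t = 0" by (auto simp: bump_def bump1_def bump2_def max_def)
qed

lemma bump_nonneg: "bump r c t \<ge> 0"
  by (simp add: bump_def)

lemma bump_pos:
  assumes "\<bar>t - c\<bar> < r"
  shows "bump r c t > 0"
  using power_strict_mono[OF assms, of 2] by (simp add: bump_def)

context smooth_minimizer
begin

text \<open>The first variation vanishes because \<open>t\<close> may have either sign. It pairs the weak gradient with \<open>grad \<psi>\<close>;
  as the bump is of class two, the partial derivatives of \<open>\<psi>\<close> are themselves test functions, and the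
  definition of the weak gradient turns the pairing into an integral of \<open>u l\<close> against the Laplacian
  of \<open>\<psi>\<close>. Green's identity moves the Laplacian to \<open>u l\<close>.\<close>

lemma tested_euler_lagrange:
  assumes l: "l \<in> {1..m}" and r: "r > 0" and sub: "square_around z0 r \<subseteq> square a"
    and pos: "\<And>z. z \<in> square_around z0 r \<Longrightarrow> u l z > 0"
  shows "integral (square_around z0 r) (\<lambda>z. bump r (fst z0) (fst z) * bump r (snd z0) (snd z) *
    (f l z (u l z) - laplacian (u l) z)) = 0"
proof -
  obtain x0 y0 where z0: "z0 = (x0, y0)" by (cases z0)
  define p p1 p2 where "p = bump r x0" and "p1 = bump1 r x0" and "p2 = bump2 r x0"
  define q q1 q2 where "q = bump r y0" and "q1 = bump1 r y0" and "q2 = bump2 r y0"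
  let ?Q = "cbox (x0 - r, y0 - r) (x0 + r, y0 + r)"
  have Q: "square_around z0 r = ?Q" by (simp add: square_around_def z0)
  note sub' = sub[unfolded Q]
  have C1: "C1_line p p1" "C1_line p1 p2" "C1_line q q1" "C1_line q1 q2"
    unfolding p_def p1_def p2_def q_def q1_def q2_def by (rule bump_C1 bump1_C1)+
  have out: "p t = 0 \<and> p1 t = 0 \<and> p2 t = 0" if "\<bar>t - x0\<bar> \<ge> r" for t
    using bump_outside[OF r that] by (simp add: p_def p1_def p2_def)
  have out': "q t = 0 \<and> q1 t = 0 \<and> q2 t = 0" if "\<bar>t - y0\<bar> \<ge> r" for t
    using bump_outside[OF r that] by (simp add: q_def q1_def q2_def)
  have o: "t \<notin> {x0 - r..x0 + r} \<Longrightarrow> p t = 0" "t \<notin> {x0 - r..x0 + r} \<Longrightarrow> p1 t = 0" for t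
    using out[of t] by auto
  have o': "t \<notin> {y0 - r..y0 + r} \<Longrightarrow> q t = 0" "t \<notin> {y0 - r..y0 + r} \<Longrightarrow> q1 t = 0" for t
    using out'[of t] by auto
  define \<psi> where "\<psi> z = p (fst z) * q (snd z)" for z
  define \<psi>1 where "\<psi>1 z = p1 (fst z) * q (snd z)" for z
  define \<psi>2 where "\<psi>2 z = p (fst z) * q1 (snd z)" for z
  note defs = \<psi>_def[abs_def] \<psi>1_def[abs_def] \<psi>2_def[abs_def]
  have test: "test_function a \<psi>" "test_function a \<psi>1" "test_function a \<psi>2"
    unfolding defs
    by (rule test_function_product[OF C1(1) o(1) C1(3) o'(1) sub'] test_function_product[OF C1(2) o(2) C1(3) o'(1) sub']
        test_function_product[OF C1(1) o(1) C1(4) o'(2) sub']; assumption)+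
  have D: "D1 \<psi> = \<psi>1" "D2 \<psi> = \<psi>2" "D1 \<psi>1 = (\<lambda>z. p2 (fst z) * q (snd z))" "D2 \<psi>2 = (\<lambda>z. p (fst z) * q2 (snd z))"
    unfolding defs using C1_product(2,3)[OF C1(1,3)] C1_product(2)[OF C1(2,3)] C1_product(3)[OF C1(1,4)] by simp_all
  have zero: "\<psi> z = 0" "p2 (fst z) * q (snd z) = 0" "p (fst z) * q2 (snd z) = 0" if "z \<notin> ?Q" for z
  proof -
    have "\<bar>fst z - x0\<bar> \<ge> r \<or> \<bar>snd z - y0\<bar> \<ge> r" using that by (cases z) (auto simp: mem_cbox_pair)
    then show "\<psi> z = 0" "p2 (fst z) * q (snd z) = 0" "p (fst z) * q2 (snd z) = 0"
      using out[of "fst z"] out'[of "snd z"] by (auto simp: \<psi>_def)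
  qed
  obtain L where L: "monotone_reaction a L (f l)" using reaction[OF l] by blast
  have uL: "u l \<in> L2 M" and g: "weak_gradient a (u l) (wgrad a (u l))" using W12D[OF u_W12[OF l]] .
  have gL: "wgrad a (u l) \<in> L2 M" using g by (simp add: weak_gradient_def)
  have fL: "(\<lambda>z. f l z (u l z)) \<in> L2 M" by (rule reaction_L2[OF L u_continuous[OF l] u_nonneg[OF l] uL])
  obtain B where B: "B > 0" "\<And>z. z \<in> square a \<Longrightarrow> norm (\<psi> z) \<le> B"
    using continuous_bounded_on_square[of a \<psi>] continuous_on_subset[OF test_function_continuous[OF test(1)]] by blast
  obtain c where c: "c > 0" "\<And>z. z \<in> ?Q \<Longrightarrow> u l z \<ge> c"
  proof -
    have "\<exists>z\<in>?Q. \<forall>w\<in>?Q. u l z \<le> u l w"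
    proof (rule continuous_attains_inf[OF compact_cbox _ continuous_on_subset[OF u_continuous[OF l] sub']])
      have "(x0, y0) \<in> ?Q" using r by (simp add: mem_cbox_pair)
      then show "?Q \<noteq> {}" by blast
    qed
    then show thesis using that pos Q by blast
  qed
  have sup: "u l z > 0" if "\<psi> z \<noteq> 0" for z using zero(1)[of z] that pos[of z] Q by blast
  have "(LINT z|M. wgrad a (u l) z \<bullet> grad \<psi> z + \<psi> z * f l z (u l z)) = 0"
  proof (rule linear_le_quadratic_imp_zero[of "c / B"])
    show "c / B > 0" using c(1) B(1) by simp
    fix t :: real assume t: "\<bar>t\<bar> \<le> c / B"
    show "0 \<le> t * (LINT z|M. wgrad a (u l) z \<bullet> grad \<psi> z + \<psi> z * f l z (u l z)) +
      t\<^sup>2 * (LINT z|M. 1/2 * (norm (grad \<psi> z))\<^sup>2 + L * (\<psi> z)\<^sup>2)"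
    proof (rule energy_variation[OF l test(1) _ sup L])
      fix z assume z: "z \<in> square a"
      show "u l z + t * \<psi> z \<ge> 0"
      proof (cases "z \<in> ?Q")
        case True
        have "\<bar>t\<bar> * \<bar>\<psi> z\<bar> \<le> (c / B) * B" using t B(2)[OF z] c(1) B(1) by (intro mult_mono) auto
        then have "\<bar>t * \<psi> z\<bar> \<le> c" using B(1) by (simp add: abs_mult)
        then show ?thesis using c(2)[OF True] by linarith
      next
        case False
        then show ?thesis using zero(1) u_nonneg[OF l z] by simp
      qed
    qed
  qed
  moreover have "(LINT z|M. wgrad a (u l) z \<bullet> grad \<psi> z + \<psi> z * f l z (u l z)) =
    (LINT z|M. \<psi>1 z * fst (wgrad a (u l) z)) + (LINT z|M. \<psi>2 z * snd (wgrad a (u l) z)) + (LINT z|M. \<psi> z * f l z (u l z))"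
  proof -
    have "(\<lambda>z. wgrad a (u l) z \<bullet> grad \<psi> z + \<psi> z * f l z (u l z)) =
      (\<lambda>z. \<psi>1 z * fst (wgrad a (u l) z) + \<psi>2 z * snd (wgrad a (u l) z) + \<psi> z * f l z (u l z))"
      by (simp add: fun_eq_iff grad_def D inner_prod_def mult.commute)
    moreover have i: "integrable M (\<lambda>z. \<psi>1 z * fst (wgrad a (u l) z))" "integrable M (\<lambda>z. \<psi>2 z * snd (wgrad a (u l) z))"
      "integrable M (\<lambda>z. \<psi> z * f l z (u l z))"
      by (intro L2_mult_integrable test_function_L2 test L2_components gL fL)+
    ultimately show ?thesis by (simp add: Bochner_Integration.integral_add)
  qed
  moreover have "(LINT z|M. u l z * (p2 (fst z) * q (snd z))) = - (LINT z|M. \<psi>1 z * fst (wgrad a (u l) z))"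
    using weak_gradient_components(1)[OF g uL test(2)] by (simp add: D)
  moreover have "(LINT z|M. u l z * (p (fst z) * q2 (snd z))) = - (LINT z|M. \<psi>2 z * snd (wgrad a (u l) z))"
    using weak_gradient_components(2)[OF g uL test(3)] by (simp add: D)
  ultimately have eq: "(LINT z|M. \<psi> z * f l z (u l z)) =
      (LINT z|M. u l z * (p2 (fst z) * q (snd z))) + (LINT z|M. u l z * (p (fst z) * q2 (snd z)))" by simp
  have Ck: "Ck_on 1 UNIV \<psi>" "Ck_on 1 UNIV \<psi>1" "Ck_on 1 UNIV \<psi>2" using test by (auto simp only: test_function_def)
  have "continuous_on UNIV (\<lambda>z. p2 (fst z) * q (snd z))" "continuous_on UNIV (\<lambda>z. p (fst z) * q2 (snd z))" "continuous_on UNIV \<psi>"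
    using Ck_on_1D(2)[OF Ck(2)] Ck_on_1D(3)[OF Ck(3)] Ck_on_1D(4)[OF Ck(1)] unfolding D .
  then have cG: "continuous_on A (\<lambda>z. p2 (fst z) * q (snd z))" "continuous_on A (\<lambda>z. p (fst z) * q2 (snd z))" "continuous_on A \<psi>" for A
    by (auto intro: continuous_on_subset)
  have i2: "integrable M (\<lambda>z. u l z * (p2 (fst z) * q (snd z)))" "integrable M (\<lambda>z. u l z * (p (fst z) * q2 (snd z)))"
    by (intro L2_mult_integrable uL continuous_L2 cG)+
  have "integral ?Q (\<lambda>z. \<psi> z * f l z (u l z)) = (LINT z|M. \<psi> z * f l z (u l z))"
  proof (rule lebesgue_square_localize[symmetric, OF _ sub'])
    show "integrable M (\<lambda>z. \<psi> z * f l z (u l z))" by (rule L2_mult_integrable[OF test_function_L2(1)[OF test(1)] fL])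
    show "\<psi> z * f l z (u l z) = 0" if "z \<in> square a - ?Q" for z using zero(1)[of z] that by simp
  qed
  also have "\<dots> = (LINT z|M. u l z * (p2 (fst z) * q (snd z) + p (fst z) * q2 (snd z)))"
    unfolding eq distrib_left using i2 by (simp add: Bochner_Integration.integral_add)
  also have "\<dots> = integral ?Q (\<lambda>z. u l z * (p2 (fst z) * q (snd z) + p (fst z) * q2 (snd z)))"
  proof (rule lebesgue_square_localize[OF _ sub'])
    show "integrable M (\<lambda>z. u l z * (p2 (fst z) * q (snd z) + p (fst z) * q2 (snd z)))"
      unfolding distrib_left using i2 by (rule Bochner_Integration.integrable_add)
    show "u l z * (p2 (fst z) * q (snd z) + p (fst z) * q2 (snd z)) = 0" if "z \<in> square a - ?Q" for z
    proof -
      have "z \<notin> ?Q" using that by blast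
      from zero(2,3)[OF this] show ?thesis by (simp only: mult_zero_right add_0)
    qed
  qed
  also have "\<dots> = integral ?Q (\<lambda>z. \<psi> z * laplacian (u l) z)"
  proof (rule green_rectangle[where Gx = \<psi>1 and Gy = \<psi>2, OF smooth[OF l] sub'])
    show "((\<lambda>s. \<psi> (s, y)) has_real_derivative \<psi>1 (x, y)) (at x)" for x y
      unfolding defs using DERIV_cmult_right[OF C1_lineD(1)[OF C1(1)]] by simp
    show "((\<lambda>s. \<psi>1 (s, y)) has_real_derivative p2 (fst (x, y)) * q (snd (x, y))) (at x)" for x y
      unfolding defs using DERIV_cmult_right[OF C1_lineD(1)[OF C1(2)]] by simp
    show "((\<lambda>s. \<psi> (x, s)) has_real_derivative \<psi>2 (x, y)) (at y)" for x y
      unfolding defs using DERIV_cmult[OF C1_lineD(1)[OF C1(3)]] by simp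
    show "((\<lambda>s. \<psi>2 (x, s)) has_real_derivative p (fst (x, y)) * q2 (snd (x, y))) (at y)" for x y
      unfolding defs using DERIV_cmult[OF C1_lineD(1)[OF C1(4)]] by simp
    show "\<psi> (x, y) = 0 \<and> \<psi>1 (x, y) = 0" if "x = x0 - r \<or> x = x0 + r" for x y
      using out[of x] r that by (auto simp: defs)
    show "\<psi> (x, y) = 0 \<and> \<psi>2 (x, y) = 0" if "y = y0 - r \<or> y = y0 + r" for x y
      using out'[of y] r that by (auto simp: defs)
  qed (use r cG in auto)
  finally have "integral ?Q (\<lambda>z. \<psi> z * f l z (u l z)) - integral ?Q (\<lambda>z. \<psi> z * laplacian (u l) z) = 0" by simp
  moreover have "continuous_on ?Q (\<lambda>z. f l z (u l z))" "continuous_on ?Q (laplacian (u l))"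
    using continuous_on_subset[OF monotone_reaction_compose_continuous[OF L u_continuous[OF l] u_nonneg[OF l]] sub']
      continuous_on_subset[OF continuous_on_laplacian[OF smooth[OF l]] sub'] by auto
  then have "integral ?Q (\<lambda>z. \<psi> z * f l z (u l z) - \<psi> z * laplacian (u l) z) =
    integral ?Q (\<lambda>z. \<psi> z * f l z (u l z)) - integral ?Q (\<lambda>z. \<psi> z * laplacian (u l) z)"
    by (intro Henstock_Kurzweil_Integration.integral_diff integrable_continuous continuous_on_mult cG)
  ultimately show ?thesis
    unfolding Q by (simp add: \<psi>_def p_def q_def z0 right_diff_distrib)
qed

text \<open>A nonzero value of \<open>f l - laplacian (u l)\<close> keeps its sign on a small square inside \<open>{u l > 0}\<close>, and the
  integral against a bump supported there would not vanish.\<close>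

theorem euler_lagrange:
  assumes l: "l \<in> {1..m}" and z0: "z0 \<in> square a" and pos: "u l z0 > 0"
  shows "laplacian (u l) z0 = f l z0 (u l z0)"
proof (rule ccontr)
  define h where "h z = f l z (u l z) - laplacian (u l) z" for z
  assume "laplacian (u l) z0 \<noteq> f l z0 (u l z0)"
  then have h0: "h z0 \<noteq> 0" by (simp add: h_def)
  obtain L where L: "monotone_reaction a L (f l)" using reaction[OF l] by blast
  have ch: "continuous_on (square a) h"
    unfolding h_def by (intro continuous_on_diff continuous_on_laplacian[OF smooth[OF l]]
        monotone_reaction_compose_continuous[OF L u_continuous[OF l] u_nonneg[OF l]])
  define V where "V = (square a \<inter> u l -` {0<..}) \<inter> (square a \<inter> (\<lambda>z. h z * h z0) -` {0<..})"
  have "open V" unfolding V_def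
    using open_square u_continuous[OF l] ch
    by (intro open_Int continuous_open_preimage continuous_on_mult continuous_on_const) auto
  moreover have hh: "h z0 * h z0 > 0" using h0 not_real_square_gt_zero by blast
  then have "z0 \<in> V" using z0 pos by (simp add: V_def)
  ultimately obtain e where e: "e > 0" "ball z0 e \<subseteq> V" using open_contains_ball by blast
  define r where "r = e / 3"
  have r: "r > 0" using e by (simp add: r_def)
  have sub: "square_around z0 r \<subseteq> V"
  proof
    fix z assume z: "z \<in> square_around z0 r"
    have "dist (fst z) (fst z0) \<le> r" "dist (snd z) (snd z0) \<le> r"
      using z by (cases z, simp add: square_around_iff dist_real_def)+
    then have "dist z z0 < e"
      using r sqrt_sum_squares_le_sum[of "dist (fst z) (fst z0)" "dist (snd z) (snd z0)"]
      by (simp add: dist_prod_def r_def)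
    then show "z \<in> V" using e(2) by (auto simp: dist_commute)
  qed
  define P where "P z = bump r (fst z0) (fst z) * bump r (snd z0) (snd z) * h z * h z0" for z
  have "integral (square_around z0 r) (\<lambda>z. bump r (fst z0) (fst z) * bump r (snd z0) (snd z) * h z) = 0"
    unfolding h_def using sub by (intro tested_euler_lagrange[OF l r]) (auto simp: V_def)
  then have "integral (square_around z0 r) P = 0"
    unfolding P_def by (subst Henstock_Kurzweil_Integration.integral_mult_left) simp
  have cb: "continuous_on A (\<lambda>z. bump r (fst z0) (fst z))" "continuous_on A (\<lambda>z. bump r (snd z0) (snd z))" for A :: "(real \<times> real) set"
    unfolding bump_def by (intro continuous_intros)+
  have cP: "continuous_on (square_around z0 r) P"
    unfolding P_def using sub by (intro continuous_on_mult cb continuous_on_const continuous_on_subset[OF ch]) (auto simp: V_def)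
  then have "P integrable_on (square_around z0 r)" unfolding square_around_def by (rule integrable_continuous)
  with \<open>integral (square_around z0 r) P = 0\<close> have "(P has_integral 0) (square_around z0 r)"
    by (metis integrable_integral)
  moreover have "P z \<ge> 0" if "z \<in> square_around z0 r" for z
  proof -
    have "h z * h z0 > 0" using that sub by (auto simp: V_def)
    then show ?thesis unfolding P_def mult.assoc[of _ "h z"]
      by (intro mult_nonneg_nonneg[OF _ less_imp_le] mult_nonneg_nonneg bump_nonneg)
  qed
  moreover have "z0 \<in> square_around z0 r" using r by (cases z0) (simp add: square_around_iff)
  ultimately have "P z0 = 0"
    using cP r unfolding square_around_def
    by (intro has_integral_0_cbox_imp_0[of "(fst z0 - r, snd z0 - r)" "(fst z0 + r, snd z0 + r)" P])
      (auto simp: box_subset_cbox[THEN subsetD] box_eq_empty Basis_prod_def)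
  moreover have "P z0 > 0" unfolding P_def mult.assoc[of _ "h z0"] using r hh
    by (intro mult_pos_pos[OF _ hh] mult_pos_pos bump_pos) simp_all
  ultimately show False by simp
qed

lemma laplacian_zero_open:
  assumes "open V" "\<And>z. z \<in> V \<Longrightarrow> w z = 0" "z \<in> V"
  shows "laplacian w z = 0"
proof -
  have *: "D1 v z = 0 \<and> D2 v z = 0" if "\<And>z. z \<in> V \<Longrightarrow> v z = 0" "z \<in> V" for v z
  proof -
    have "(v has_derivative (\<lambda>h. 0 * fst h + 0 * snd h)) (at z)"
      by (rule has_derivative_transform_within_open[of "\<lambda>_. 0" _ _ UNIV V]) (use assms(1) that in auto)
    from partial_derivatives_eq(2,3)[OF this] show ?thesis by simp
  qed
  show ?thesis using *[of "D1 w" z] *[of "D2 w" z] *[of w] assms(2,3) by (simp add: laplacian_def)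
qed

text \<open>On the open set where the Laplacian differs from \<open>f l\<close> the Euler-Lagrange equation fails, so \<open>u l\<close>
  vanishes there, and with it its Laplacian.\<close>

theorem laplacian_alternative:
  assumes l: "l \<in> {1..m}" and z: "z \<in> square a"
  shows "laplacian (u l) z = f l z (u l z) \<or> laplacian (u l) z = 0"
proof (rule disjCI)
  assume "laplacian (u l) z \<noteq> 0"
  show "laplacian (u l) z = f l z (u l z)"
  proof (rule ccontr)
    assume ne: "laplacian (u l) z \<noteq> f l z (u l z)"
    obtain L where L: "monotone_reaction a L (f l)" using reaction[OF l] by blast
    define V where "V = square a \<inter> (\<lambda>z. laplacian (u l) z - f l z (u l z)) -` (- {0})"
    have "open V" unfolding V_def
      using open_square by (intro continuous_open_preimage continuous_on_diff continuous_on_laplacian[OF smooth[OF l]]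
        monotone_reaction_compose_continuous[OF L u_continuous[OF l] u_nonneg[OF l]]) auto
    moreover have "u l w = 0" if "w \<in> V" for w
      using euler_lagrange[OF l, of w] u_nonneg[OF l, of w] that by (force simp: V_def)
    moreover have "z \<in> V" using z ne by (simp add: V_def)
    ultimately show False using laplacian_zero_open \<open>laplacian (u l) z \<noteq> 0\<close> by blast
  qed
qed

lemma laplacian_bounds:
  assumes "l \<in> {1..m}" "z \<in> square a"
  shows "0 \<le> laplacian (u l) z" "laplacian (u l) z \<le> f l z (u l z)"
proof -
  obtain L where "monotone_reaction a L (f l)" using reaction[OF assms(1)] by blast
  from monotone_reactionD(2)[OF this assms(2) u_nonneg[OF assms]]
  show "0 \<le> laplacian (u l) z" "laplacian (u l) z \<le> f l z (u l z)"
    using laplacian_alternative[OF assms] by auto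
qed

lemma laplacian_other_zero:
  assumes "l \<in> {1..m}" "p \<in> {1..m} - {l}" "z \<in> square a" "u l z > 0"
  shows "laplacian (u p) z = 0"
proof (rule laplacian_zero_open)
  show "open (square a \<inter> u l -` {0<..})"
    using open_square u_continuous[OF assms(1)] by (intro continuous_open_preimage) auto
  show "u p w = 0" if "w \<in> square a \<inter> u l -` {0<..}" for w
    using that segregated_at_eq_0[OF u_segregated assms(1) _ assms(2)] by simp
  show "z \<in> square a \<inter> u l -` {0<..}" using assms by simp
qed

end

section \<open>Linear combinations of smooth functions\<close>

lemma D_cong_open:
  assumes "open S" "\<And>z. z \<in> S \<Longrightarrow> f z = g z" "z \<in> S" "f differentiable (at z)"
  shows "g differentiable (at z)" "D1 g z = D1 f z" "D2 g z = D2 f z"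
proof -
  have "(f has_derivative frechet_derivative f (at z)) (at z)" using assms(4) by (simp add: frechet_derivative_works)
  then have d: "(g has_derivative frechet_derivative f (at z)) (at z)"
    by (rule has_derivative_transform_within_open[OF _ assms(1,3)]) (use assms(2) in auto)
  then show "g differentiable (at z)" using differentiable_def by blast
  show "D1 g z = D1 f z" "D2 g z = D2 f z" using frechet_derivative_at[OF d] by (simp_all add: D1_def D2_def)
qed

text \<open>The formula for the partial derivatives of a sum holds only on the domain of differentiability, so
  higher derivatives of sums are computed through this congruence.\<close>

lemma Ck_on_cong_open:
  assumes "open S" "\<And>z. z \<in> S \<Longrightarrow> f z = g z" "Ck_on k S f"
  shows "Ck_on k S g"
  using assms(2,3)
proof (induction k arbitrary: f g)
  case 0
  then show ?case using continuous_on_cong[of S S f g] by simp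
next
  case (Suc k)
  have d: "\<And>z. z \<in> S \<Longrightarrow> f differentiable (at z)" "Ck_on k S (D1 f)" "Ck_on k S (D2 f)" using Suc.prems(2) by auto
  note D = D_cong_open[OF assms(1) Suc.prems(1) _ d(1)]
  have "Ck_on k S (D1 g)" by (rule Suc.IH[OF _ d(2)]) (use D(2) in auto)
  moreover have "Ck_on k S (D2 g)" by (rule Suc.IH[OF _ d(3)]) (use D(3) in auto)
  ultimately show ?case using D(1) by auto
qed

lemma D_lincomb:
  assumes "f differentiable (at z)" "g differentiable (at z)"
  shows "(\<lambda>z. \<alpha> * f z + \<beta> * g z) differentiable (at z)"
    "D1 (\<lambda>z. \<alpha> * f z + \<beta> * g z) z = \<alpha> * D1 f z + \<beta> * D1 g z"
    "D2 (\<lambda>z. \<alpha> * f z + \<beta> * g z) z = \<alpha> * D2 f z + \<beta> * D2 g z"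
proof -
  have d: "((\<lambda>z. \<alpha> * f z + \<beta> * g z) has_derivative (\<lambda>h. \<alpha> * frechet_derivative f (at z) h + \<beta> * frechet_derivative g (at z) h)) (at z)"
    using assms by (intro has_derivative_add has_derivative_mult_right) (auto simp: frechet_derivative_works)
  then show "(\<lambda>z. \<alpha> * f z + \<beta> * g z) differentiable (at z)" using differentiable_def by blast
  show "D1 (\<lambda>z. \<alpha> * f z + \<beta> * g z) z = \<alpha> * D1 f z + \<beta> * D1 g z"
    "D2 (\<lambda>z. \<alpha> * f z + \<beta> * g z) z = \<alpha> * D2 f z + \<beta> * D2 g z"
    unfolding D1_def D2_def frechet_derivative_at[OF d, symmetric] by simp_all
qed

lemma Ck_on_lincomb:
  assumes "open S" "Ck_on k S f" "Ck_on k S g"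
  shows "Ck_on k S (\<lambda>z. \<alpha> * f z + \<beta> * g z)"
  using assms(2,3)
proof (induction k arbitrary: f g)
  case 0
  then show ?case by (auto intro!: continuous_intros)
next
  case (Suc k)
  then have d: "\<And>z. z \<in> S \<Longrightarrow> f differentiable (at z)" "\<And>z. z \<in> S \<Longrightarrow> g differentiable (at z)"
    "Ck_on k S (D1 f)" "Ck_on k S (D2 f)" "Ck_on k S (D1 g)" "Ck_on k S (D2 g)" by auto
  note D = D_lincomb[OF d(1) d(2)]
  have "Ck_on k S (D1 (\<lambda>z. \<alpha> * f z + \<beta> * g z))"
    by (rule Ck_on_cong_open[OF assms(1) _ Suc.IH[OF d(3,5)]]) (use D(2) in auto)
  moreover have "Ck_on k S (D2 (\<lambda>z. \<alpha> * f z + \<beta> * g z))"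
    by (rule Ck_on_cong_open[OF assms(1) _ Suc.IH[OF d(4,6)]]) (use D(3) in auto)
  ultimately show ?case using D(1) by auto
qed

lemma laplacian_lincomb:
  assumes "open S" "Ck_on 2 S f" "Ck_on 2 S g" "z \<in> S"
  shows "laplacian (\<lambda>z. \<alpha> * f z + \<beta> * g z) z = \<alpha> * laplacian f z + \<beta> * laplacian g z"
proof -
  note f = Ck_on_1D(1)[OF Ck_on_2D(1)[OF assms(2)]] Ck_on_1D(1)[OF Ck_on_2D(2)[OF assms(2)]] Ck_on_1D(1)[OF Ck_on_2D(3)[OF assms(2)]]
  note g = Ck_on_1D(1)[OF Ck_on_2D(1)[OF assms(3)]] Ck_on_1D(1)[OF Ck_on_2D(2)[OF assms(3)]] Ck_on_1D(1)[OF Ck_on_2D(3)[OF assms(3)]]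
  note D = D_lincomb[OF f(1) g(1)]
  have "D1 (D1 (\<lambda>z. \<alpha> * f z + \<beta> * g z)) z = D1 (\<lambda>z. \<alpha> * D1 f z + \<beta> * D1 g z) z"
    by (rule D_cong_open(2)[OF assms(1) _ assms(4) D_lincomb(1)[OF f(2) g(2)]]) (use D(2) assms(4) in auto)
  moreover have "D2 (D2 (\<lambda>z. \<alpha> * f z + \<beta> * g z)) z = D2 (\<lambda>z. \<alpha> * D2 f z + \<beta> * D2 g z) z"
    by (rule D_cong_open(3)[OF assms(1) _ assms(4) D_lincomb(1)[OF f(3) g(3)]]) (use D(3) assms(4) in auto)
  ultimately show ?thesis
    using D_lincomb(2)[OF f(2) g(2)] D_lincomb(3)[OF f(3) g(3)] assms(4)
    by (simp add: laplacian_def algebra_simps)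
qed

lemma quadratic_C2:
  fixes x0 y0 \<beta> c :: real
  defines "q \<equiv> \<lambda>z. \<beta> * ((fst z - x0)\<^sup>2 + (snd z - y0)\<^sup>2) + c"
  shows "Ck_on 2 S q" "laplacian q z = 4 * \<beta>"
proof -
  have d: "(q has_derivative (\<lambda>v. (2 * \<beta> * (fst z - x0)) * fst v + (2 * \<beta> * (snd z - y0)) * snd v)) (at z)" for z
    unfolding q_def by (auto intro!: derivative_eq_intros simp: algebra_simps)
  note D = partial_derivatives_eq[OF d]
  have D': "D1 q = (\<lambda>z. 2 * \<beta> * (fst z - x0))" "D2 q = (\<lambda>z. 2 * \<beta> * (snd z - y0))" using D by auto
  have d1: "((\<lambda>z. 2 * \<beta> * (fst z - x0)) has_derivative (\<lambda>v. (2 * \<beta>) * fst v + 0 * snd v)) (at z)" for z :: "real \<times> real"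
    by (auto intro!: derivative_eq_intros)
  have d2: "((\<lambda>z. 2 * \<beta> * (snd z - y0)) has_derivative (\<lambda>v. 0 * fst v + (2 * \<beta>) * snd v)) (at z)" for z :: "real \<times> real"
    by (auto intro!: derivative_eq_intros)
  note E1 = partial_derivatives_eq[OF d1]
  note E2 = partial_derivatives_eq[OF d2]
  have E: "D1 (\<lambda>z. 2 * \<beta> * (fst z - x0)) = (\<lambda>_. 2 * \<beta>)" "D2 (\<lambda>z. 2 * \<beta> * (fst z - x0)) = (\<lambda>_. 0)"
    "D1 (\<lambda>z. 2 * \<beta> * (snd z - y0)) = (\<lambda>_. 0)" "D2 (\<lambda>z. 2 * \<beta> * (snd z - y0)) = (\<lambda>_. 2 * \<beta>)"
    using E1(2,3) E2(2,3) by auto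
  show "Ck_on 2 S q"
    unfolding numeral_2_eq_2 Ck_on.simps D'[unfolded numeral_2_eq_2] E[unfolded numeral_2_eq_2]
    using D(1) E1(1)[unfolded numeral_2_eq_2] E2(1)[unfolded numeral_2_eq_2] by auto
  show "laplacian q z = 4 * \<beta>" by (simp add: laplacian_def D' E)
qed

section \<open>Poincare inequality in a boundary strip\<close>

text \<open>The variance of \<open>g\<close> is nonnegative.\<close>

lemma square_integral_le:
  fixes g :: "real \<Rightarrow> real"
  assumes "continuous_on {\<alpha>..\<beta>} g" "\<alpha> \<le> \<beta>"
  shows "(integral {\<alpha>..\<beta>} g)\<^sup>2 \<le> (\<beta> - \<alpha>) * integral {\<alpha>..\<beta>} (\<lambda>t. (g t)\<^sup>2)"
proof (cases "\<alpha> = \<beta>")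
  case False
  then have pos: "\<beta> - \<alpha> > 0" using assms(2) by simp
  define I J \<mu> where "I = integral {\<alpha>..\<beta>} g" and "J = integral {\<alpha>..\<beta>} (\<lambda>t. (g t)\<^sup>2)" and "\<mu> = I / (\<beta> - \<alpha>)"
  have g: "(g has_integral I) {\<alpha>..\<beta>}" "((\<lambda>t. (g t)\<^sup>2) has_integral J) {\<alpha>..\<beta>}"
    unfolding I_def J_def
    by (intro integrable_integral integrable_continuous_interval continuous_intros assms)+
  have c: "((\<lambda>t. \<mu>\<^sup>2) has_integral (\<beta> - \<alpha>) * \<mu>\<^sup>2) {\<alpha>..\<beta>}"
    using has_integral_const_real[of "\<mu>\<^sup>2" \<alpha> \<beta>] assms(2) by simp
  have "((\<lambda>t. (g t)\<^sup>2 - 2 * \<mu> * g t + \<mu>\<^sup>2) has_integral J - 2 * \<mu> * I + (\<beta> - \<alpha>) * \<mu>\<^sup>2) {\<alpha>..\<beta>}"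
    by (intro has_integral_add has_integral_diff has_integral_mult_right g c)
  moreover have "(g t)\<^sup>2 - 2 * \<mu> * g t + \<mu>\<^sup>2 \<ge> 0" for t
    using zero_le_power2[of "g t - \<mu>"] by (simp add: power2_diff algebra_simps)
  ultimately have "0 \<le> J - 2 * \<mu> * I + (\<beta> - \<alpha>) * \<mu>\<^sup>2" by (rule has_integral_nonneg)
  moreover have "(\<beta> - \<alpha>) * \<mu> = I" using pos by (simp add: \<mu>_def)
  then have "(\<beta> - \<alpha>) * \<mu>\<^sup>2 = \<mu> * I" by (simp add: power2_eq_square mult_ac)
  ultimately have "\<mu> * I \<le> J" by (simp add: mult.commute)
  then have "(\<beta> - \<alpha>) * (\<mu> * I) \<le> (\<beta> - \<alpha>) * J" using pos by (intro mult_left_mono) auto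
  then show ?thesis using pos by (simp add: \<mu>_def I_def J_def power2_eq_square)
qed simp

lemma poincare_interval:
  fixes w w' :: "real \<Rightarrow> real"
  assumes w: "\<And>t. (w has_real_derivative w' t) (at t)" and c: "continuous_on {p..q} w'" and pq: "p \<le> q" "e \<in> {p..q}"
  shows "integral {p..q} (\<lambda>t. (w t - w e)\<^sup>2) \<le> (q - p)\<^sup>2 * integral {p..q} (\<lambda>t. (w' t)\<^sup>2)"
proof -
  let ?J = "integral {p..q} (\<lambda>t. (w' t)\<^sup>2)"
  have i: "(\<lambda>t. (w' t)\<^sup>2) integrable_on {\<alpha>..\<beta>}" if "{\<alpha>..\<beta>} \<subseteq> {p..q}" for \<alpha> \<beta>
    using continuous_on_subset[OF c that] by (intro integrable_continuous_interval continuous_intros)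
  have J: "?J \<ge> 0" using i by (intro integral_nonneg) auto
  have step: "(w \<beta> - w \<alpha>)\<^sup>2 \<le> (q - p) * ?J" if ab: "\<alpha> \<le> \<beta>" "{\<alpha>..\<beta>} \<subseteq> {p..q}" for \<alpha> \<beta>
  proof -
    have "(w' has_integral w \<beta> - w \<alpha>) {\<alpha>..\<beta>}"
      using w ab(1)
      by (intro fundamental_theorem_of_calculus) (auto simp: has_real_derivative_iff_has_vector_derivative[symmetric] intro: has_field_derivative_at_within)
    then have "(w \<beta> - w \<alpha>)\<^sup>2 = (integral {\<alpha>..\<beta>} w')\<^sup>2" by (simp add: integral_unique)
    also have "\<dots> \<le> (\<beta> - \<alpha>) * integral {\<alpha>..\<beta>} (\<lambda>t. (w' t)\<^sup>2)"
      by (rule square_integral_le[OF continuous_on_subset[OF c ab(2)] ab(1)])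
    also have "\<dots> \<le> (q - p) * ?J"
      using ab pq i by (intro mult_mono integral_subset_le integral_nonneg) auto
    finally show ?thesis .
  qed
  have "(w t - w e)\<^sup>2 \<le> (q - p) * ?J" if "t \<in> {p..q}" for t
    using step[of e t] step[of t e] that pq(2) by (cases "e \<le> t") (auto simp: power2_commute)
  then have "integral {p..q} (\<lambda>t. (w t - w e)\<^sup>2) \<le> integral {p..q} (\<lambda>_. (q - p) * ?J)"
    using w by (intro integral_le integrable_continuous_interval continuous_intros continuous_at_imp_continuous_on)
      (auto intro: DERIV_isCont)
  also have "\<dots> = (q - p)\<^sup>2 * ?J" using pq(1) by (simp add: power2_eq_square)
  finally show ?thesis .
qed

lemma iterated_integrable:
  fixes F :: "real \<times> real \<Rightarrow> real"
  assumes "continuous_on (cbox (\<alpha>, \<gamma>) (\<beta>, \<delta>)) F"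
  shows "(\<lambda>x. integral {\<gamma>..\<delta>} (\<lambda>y. F (x, y))) integrable_on {\<alpha>..\<beta>}"
    and "(\<lambda>y. integral {\<alpha>..\<beta>} (\<lambda>x. F (x, y))) integrable_on {\<gamma>..\<delta>}"
proof -
  show "(\<lambda>x. integral {\<gamma>..\<delta>} (\<lambda>y. F (x, y))) integrable_on {\<alpha>..\<beta>}"
    using integral_integrable_2dim[OF assms] by simp
  have "continuous_on (cbox (\<gamma>, \<alpha>) (\<delta>, \<beta>)) (\<lambda>z. F (snd z, fst z))"
    by (rule continuous_on_compose2[OF assms]) (auto intro!: continuous_intros simp: mem_cbox_pair simp del: cbox_interval)
  from integral_integrable_2dim[OF this]
  show "(\<lambda>y. integral {\<alpha>..\<beta>} (\<lambda>x. F (x, y))) integrable_on {\<gamma>..\<delta>}" by simp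
qed

text \<open>A strip \<open>S\<close> of width \<open>d\<close> along a side of the square with its projection \<open>\<pi>\<close> onto that side. The last
  two clauses are the Poincare inequality for smooth functions and the control of the values on the side
  by the boundary measure; stating them here allows the four sides to be treated at once.\<close>

definition boundary_strip :: "real \<Rightarrow> real \<Rightarrow> (real \<times> real) set \<Rightarrow> (real \<times> real \<Rightarrow> real \<times> real) \<Rightarrow> bool" where
  "boundary_strip a d S \<pi> \<longleftrightarrow> (\<exists>p q. S = cbox p q) \<and> S \<subseteq> near_boundary a d \<and>
     continuous_on S \<pi> \<and> (\<forall>z\<in>S. \<pi> z \<in> frontier (square a) \<and> dist z (\<pi> z) \<le> d) \<and>
     (\<forall>v. Ck_on 1 UNIV v \<longrightarrow>
        integral S (\<lambda>z. (v z - v (\<pi> z))\<^sup>2) \<le> d\<^sup>2 * integral S (\<lambda>z. (norm (grad v z))\<^sup>2)) \<and>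
     (\<forall>k :: real \<times> real \<Rightarrow> real. continuous_on (frontier (square a)) k \<and> k \<in> borel_measurable borel \<longrightarrow>
        integral S (\<lambda>z. (k (\<pi> z))\<^sup>2) \<le> d * (LINT z|boundary_measure a. (k z)\<^sup>2))"

lemma integral_shift_reflect:
  fixes h :: "real \<Rightarrow> real"
  assumes "continuous_on {0..a} h"
  shows "integral {c..c + a} (\<lambda>t. h (t - c)) = integral {0..a} h"
    "integral {c..c + a} (\<lambda>t. h (c + a - t)) = integral {0..a} h"
proof -
  have h: "(h has_integral integral {0..a} h) (cbox 0 a)"
    using integrable_integral[OF integrable_continuous_interval[OF assms]] by simp
  have "(\<lambda>x. x + c) ` {0..a} = {c..c + a}" by (simp add: add.commute)
  moreover have "(\<lambda>x. c + a - x) ` {0..a} = {c..c + a}" by simp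
  ultimately show "integral {c..c + a} (\<lambda>t. h (t - c)) = integral {0..a} h"
    "integral {c..c + a} (\<lambda>t. h (c + a - t)) = integral {0..a} h"
    using has_integral_affinity[OF h, of 1 "- c"] has_integral_affinity[OF h, of "- 1" "c + a"]
    by (auto simp: integral_unique algebra_simps)
qed

text \<open>On the parameter interval of one side, up to its endpoints, the parametrisation of the boundary is an
  affine map \<open>\<sigma>\<close>; the other sides contribute nonnegatively.\<close>

lemma side_integral_le:
  fixes k :: "real \<times> real \<Rightarrow> real"
  assumes a: "a > 0" and k: "continuous_on (frontier (square a)) k" "k \<in> borel_measurable borel"
    and c: "0 \<le> c" "c + a \<le> 4 * a" and \<sigma>: "continuous_on {c..c + a} \<sigma>" "\<And>t. t \<in> {c<..<c + a} \<Longrightarrow> perimeter a t = \<sigma> t"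
    "\<And>t. t \<in> {c..c + a} \<Longrightarrow> \<sigma> t \<in> frontier (square a)"
  shows "integral {c..c + a} (\<lambda>t. (k (\<sigma> t))\<^sup>2) \<le> (LINT z|boundary_measure a. (k z)\<^sup>2)"
proof -
  let ?g = "\<lambda>t. (k (perimeter a t))\<^sup>2"
  have m: "?g \<in> borel_measurable borel"
    using measurable_compose[OF perimeter_borel[of a] k(2)] by (rule borel_measurable_power)
  have "bounded (k ` frontier (square a))"
    using k(1) compact_frontier_square compact_continuous_image compact_imp_bounded by blast
  then obtain B where B: "\<And>z. z \<in> frontier (square a) \<Longrightarrow> \<bar>k z\<bar> \<le> B"
    unfolding bounded_iff by (metis imageI real_norm_def)
  have gB: "?g t \<le> B\<^sup>2" if "t \<in> {0..<4 * a}" for t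
    using B[OF perimeter_frontier[OF a that]] by (metis abs_le_square_iff abs_ge_zero abs_of_nonneg order_trans power2_abs)
  have gi: "set_integrable lborel {0..<4 * a} ?g"
    unfolding set_integrable_def
  proof (rule integrableI_bounded_set_indicator[where B = "B\<^sup>2"])
    show "AE x in lborel. x \<in> {0..<4 * a} \<longrightarrow> norm ((k (perimeter a x))\<^sup>2) \<le> B\<^sup>2"
      using gB by (intro AE_I2) auto
  qed (use m a in \<open>auto\<close>)
  have sub: "{c<..<c + a} \<subseteq> {0..<4 * a}" using c by auto
  have si: "set_integrable lborel {c<..<c + a} ?g" by (rule set_integrable_subset[OF gi _ sub]) simp
  have "integral {c..c + a} (\<lambda>t. (k (\<sigma> t))\<^sup>2) = integral {c<..<c + a} (\<lambda>t. (k (\<sigma> t))\<^sup>2)"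
    by (rule integral_open_interval_real)
  also have "\<dots> = integral {c<..<c + a} ?g"
    using \<sigma>(2) by (intro Henstock_Kurzweil_Integration.integral_cong) auto
  also have "\<dots> = (LINT t:{c<..<c + a}|lborel. ?g t)"
    by (rule set_borel_integral_eq_integral(2)[OF si, symmetric])
  also have "\<dots> \<le> (LINT t:{0..<4 * a}|lborel. ?g t)"
    unfolding set_lebesgue_integral_def
    using gi si sub by (intro integral_mono) (auto simp: set_integrable_def indicator_def)
  also have "\<dots> = (LINT t|restrict_space lborel {0..<4 * a}. ?g t)"
    by (simp add: integral_restrict_space set_lebesgue_integral_def)
  also have "\<dots> = (LINT z|boundary_measure a. (k z)\<^sup>2)"
    unfolding boundary_measure_def using k(2) by (intro integral_distr[symmetric] perimeter_measurable) measurable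
  finally show ?thesis .
qed

lemma side_integrals_le:
  fixes k :: "real \<times> real \<Rightarrow> real"
  assumes a: "a > 0" and k: "continuous_on (frontier (square a)) k" "k \<in> borel_measurable borel" and e: "e \<in> {0, a}"
  shows "integral {0..a} (\<lambda>x. (k (x, e))\<^sup>2) \<le> (LINT z|boundary_measure a. (k z)\<^sup>2)"
    "integral {0..a} (\<lambda>y. (k (e, y))\<^sup>2) \<le> (LINT z|boundary_measure a. (k z)\<^sup>2)"
proof -
  have fr: "(x, y) \<in> frontier (square a) \<longleftrightarrow> (x, y) \<in> cbox (0,0) (a,a) \<and> (x, y) \<notin> square a" for x y
    using frontier_square[OF a] by blast
  have mem: "(x, e) \<in> frontier (square a)" "(e, x) \<in> frontier (square a)" if "x \<in> {0..a}" for x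
    using that e a by (auto simp: fr mem_cbox_pair square_iff)
  have pair: "continuous_on {0..a} (\<lambda>x. (x, e))" "continuous_on {0..a} (\<lambda>x. (e, x))"
    by (intro continuous_on_Pair continuous_on_id continuous_on_const)+
  have "continuous_on {0..a} (\<lambda>x. k (x, e))" "continuous_on {0..a} (\<lambda>y. k (e, y))"
    by (rule continuous_on_compose2[OF k(1) pair(1)], use mem in blast,
        rule continuous_on_compose2[OF k(1) pair(2)], use mem in blast)
  then have ch: "continuous_on {0..a} (\<lambda>x. (k (x, e))\<^sup>2)" "continuous_on {0..a} (\<lambda>y. (k (e, y))\<^sup>2)"
    by (auto intro: continuous_on_power)
  have e': "0 \<in> {0, a}" "a \<in> {0, a}" by auto
  show "integral {0..a} (\<lambda>x. (k (x, e))\<^sup>2) \<le> (LINT z|boundary_measure a. (k z)\<^sup>2)"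
  proof (cases "e = 0")
    case True
    have "integral {0..0 + a} (\<lambda>t. (k ((\<lambda>t. (t, 0)) t))\<^sup>2) \<le> (LINT z|boundary_measure a. (k z)\<^sup>2)"
      by (rule side_integral_le[OF a k]) (use a mem True in \<open>auto simp: perimeter_def intro!: continuous_intros\<close>)
    then show ?thesis using True by simp
  next
    case False
    then have [simp]: "e = a" using e by simp
    have "integral {2 * a..2 * a + a} (\<lambda>t. (k ((\<lambda>t. (2 * a + a - t, a)) t))\<^sup>2) \<le> (LINT z|boundary_measure a. (k z)\<^sup>2)"
      by (rule side_integral_le[OF a k]) (use a mem in \<open>auto simp: perimeter_def intro!: continuous_intros\<close>)
    then show ?thesis using integral_shift_reflect(2)[OF ch(1), of "2 * a"] by simp
  qed
  show "integral {0..a} (\<lambda>y. (k (e, y))\<^sup>2) \<le> (LINT z|boundary_measure a. (k z)\<^sup>2)"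
  proof (cases "e = 0")
    case True
    have "integral {3 * a..3 * a + a} (\<lambda>t. (k ((\<lambda>t. (0, 3 * a + a - t)) t))\<^sup>2) \<le> (LINT z|boundary_measure a. (k z)\<^sup>2)"
      by (rule side_integral_le[OF a k]) (use a mem True in \<open>auto simp: perimeter_def intro!: continuous_intros\<close>)
    then show ?thesis using integral_shift_reflect(2)[OF ch(2), of "3 * a"] True by simp
  next
    case False
    then have [simp]: "e = a" using e by simp
    have "integral {a..a + a} (\<lambda>t. (k ((\<lambda>t. (a, t - a)) t))\<^sup>2) \<le> (LINT z|boundary_measure a. (k z)\<^sup>2)"
      by (rule side_integral_le[OF a k]) (use a mem in \<open>auto simp: perimeter_def intro!: continuous_intros\<close>)
    then show ?thesis using integral_shift_reflect(1)[OF ch(2), of a] by simp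
  qed
qed

lemma horizontal_strip:
  assumes a: "a > 0" and pq: "0 \<le> p" "p \<le> q" "q \<le> a" and e: "e \<in> {p, q}" "e \<in> {0, a}"
  shows "boundary_strip a (q - p) (cbox (0, p) (a, q)) (\<lambda>z. (fst z, e))"
proof -
  let ?S = "cbox (0, p) (a, q)"
  have e': "e \<in> {p..q}" using e pq by auto
  have fr: "z \<in> frontier (square a) \<longleftrightarrow> z \<in> cbox (0,0) (a,a) \<and> z \<notin> square a" for z
    using frontier_square[OF a] by blast
  have near: "?S \<subseteq> near_boundary a (q - p)"
    using pq e by (auto simp: near_boundary_def mem_cbox_pair simp del: cbox_interval)
  have \<pi>: "(fst z, e) \<in> frontier (square a)" "dist z (fst z, e) \<le> q - p" if "z \<in> ?S" for z
    using that pq e a by (cases z; auto simp: fr mem_cbox_pair square_iff dist_Pair_Pair dist_real_def simp del: cbox_interval)+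
  have 1: "integral ?S (\<lambda>z. (v z - v (fst z, e))\<^sup>2) \<le> (q - p)\<^sup>2 * integral ?S (\<lambda>z. (norm (grad v z))\<^sup>2)"
    if v: "Ck_on 1 UNIV v" for v
  proof -
    note V = Ck_on_1D[OF v]
    have c1: "continuous_on ?S (\<lambda>z. (v z - v (fst z, e))\<^sup>2)"
      by (intro continuous_intros continuous_on_compose2[OF V(4)]) auto
    have c2: "continuous_on ?S (\<lambda>z. (D2 v z)\<^sup>2)"
      by (intro continuous_intros continuous_on_subset[OF V(3)]) auto
    have c3: "continuous_on ?S (\<lambda>z. (norm (grad v z))\<^sup>2)"
      by (intro continuous_intros continuous_grad[OF v])
    have c4: "continuous_on A (\<lambda>y. D2 v (x, y))" for x A
      by (rule continuous_on_compose2[OF V(3)]) (auto intro!: continuous_intros)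
    have "integral ?S (\<lambda>z. (v z - v (fst z, e))\<^sup>2) = integral {0..a} (\<lambda>x. integral {p..q} (\<lambda>y. (v (x, y) - v (x, e))\<^sup>2))"
      using integral_cbox_pair_iterated(1)[OF c1] by simp
    also have "\<dots> \<le> integral {0..a} (\<lambda>x. (q - p)\<^sup>2 * integral {p..q} (\<lambda>y. (D2 v (x, y))\<^sup>2))"
    proof (rule integral_le)
      show "(\<lambda>x. integral {p..q} (\<lambda>y. (v (x, y) - v (x, e))\<^sup>2)) integrable_on {0..a}"
        using iterated_integrable(1)[OF c1] by simp
      show "(\<lambda>x. (q - p)\<^sup>2 * integral {p..q} (\<lambda>y. (D2 v (x, y))\<^sup>2)) integrable_on {0..a}"
        using iterated_integrable(1)[OF c2] by (intro integrable_on_mult_right)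
      fix x
      show "integral {p..q} (\<lambda>y. (v (x, y) - v (x, e))\<^sup>2) \<le> (q - p)\<^sup>2 * integral {p..q} (\<lambda>y. (D2 v (x, y))\<^sup>2)"
        by (rule poincare_interval[OF D2_has_real_derivative[OF V(1)] c4 pq(2) e']) simp
    qed
    also have "\<dots> = (q - p)\<^sup>2 * integral ?S (\<lambda>z. (D2 v z)\<^sup>2)"
      unfolding integral_cbox_pair_iterated(1)[OF c2] by simp
    also have "\<dots> \<le> (q - p)\<^sup>2 * integral ?S (\<lambda>z. (norm (grad v z))\<^sup>2)"
      by (intro mult_left_mono integral_le integrable_continuous c2 c3) (auto simp: grad_def norm_prod_def)
    finally show ?thesis .
  qed
  have 2: "integral ?S (\<lambda>z. (k (fst z, e))\<^sup>2) \<le> (q - p) * (LINT z|boundary_measure a. (k z)\<^sup>2)"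
    if k: "continuous_on (frontier (square a)) k" "k \<in> borel_measurable borel" for k :: "real \<times> real \<Rightarrow> real"
  proof -
    have c: "continuous_on ?S (\<lambda>z. (k (fst z, e))\<^sup>2)"
      by (intro continuous_intros continuous_on_compose2[OF k(1)]) (use \<pi>(1) in auto)
    have "integral ?S (\<lambda>z. (k (fst z, e))\<^sup>2) = integral {0..a} (\<lambda>x. (q - p) * (k (x, e))\<^sup>2)"
      unfolding integral_cbox_pair_iterated(1)[OF c] using pq by simp
    also have "\<dots> = (q - p) * integral {0..a} (\<lambda>x. (k (x, e))\<^sup>2)" by simp
    also have "\<dots> \<le> (q - p) * (LINT z|boundary_measure a. (k z)\<^sup>2)"
      using side_integrals_le(1)[OF a k e(2)] pq by (intro mult_left_mono) auto
    finally show ?thesis .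
  qed
  show ?thesis
    unfolding boundary_strip_def using near \<pi> 1 2 by (intro conjI) (auto intro!: continuous_intros)
qed

lemma vertical_strip:
  assumes a: "a > 0" and pq: "0 \<le> p" "p \<le> q" "q \<le> a" and e: "e \<in> {p, q}" "e \<in> {0, a}"
  shows "boundary_strip a (q - p) (cbox (p, 0) (q, a)) (\<lambda>z. (e, snd z))"
proof -
  let ?S = "cbox (p, 0) (q, a)"
  have e': "e \<in> {p..q}" using e pq by auto
  have fr: "z \<in> frontier (square a) \<longleftrightarrow> z \<in> cbox (0,0) (a,a) \<and> z \<notin> square a" for z
    using frontier_square[OF a] by blast
  have near: "?S \<subseteq> near_boundary a (q - p)"
    using pq e by (auto simp: near_boundary_def mem_cbox_pair simp del: cbox_interval)
  have \<pi>: "(e, snd z) \<in> frontier (square a)" "dist z (e, snd z) \<le> q - p" if "z \<in> ?S" for z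
    using that pq e a by (cases z; auto simp: fr mem_cbox_pair square_iff dist_Pair_Pair dist_real_def simp del: cbox_interval)+
  have 1: "integral ?S (\<lambda>z. (v z - v (e, snd z))\<^sup>2) \<le> (q - p)\<^sup>2 * integral ?S (\<lambda>z. (norm (grad v z))\<^sup>2)"
    if v: "Ck_on 1 UNIV v" for v
  proof -
    note V = Ck_on_1D[OF v]
    have c1: "continuous_on ?S (\<lambda>z. (v z - v (e, snd z))\<^sup>2)"
      by (intro continuous_intros continuous_on_compose2[OF V(4)]) auto
    have c2: "continuous_on ?S (\<lambda>z. (D1 v z)\<^sup>2)"
      by (intro continuous_intros continuous_on_subset[OF V(2)]) auto
    have c3: "continuous_on ?S (\<lambda>z. (norm (grad v z))\<^sup>2)"
      by (intro continuous_intros continuous_grad[OF v])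
    have c4: "continuous_on A (\<lambda>x. D1 v (x, y))" for y A
      by (rule continuous_on_compose2[OF V(2)]) (auto intro!: continuous_intros)
    have "integral ?S (\<lambda>z. (v z - v (e, snd z))\<^sup>2) = integral {0..a} (\<lambda>y. integral {p..q} (\<lambda>x. (v (x, y) - v (e, y))\<^sup>2))"
      using integral_cbox_pair_iterated(2)[OF c1] by simp
    also have "\<dots> \<le> integral {0..a} (\<lambda>y. (q - p)\<^sup>2 * integral {p..q} (\<lambda>x. (D1 v (x, y))\<^sup>2))"
    proof (rule integral_le)
      show "(\<lambda>y. integral {p..q} (\<lambda>x. (v (x, y) - v (e, y))\<^sup>2)) integrable_on {0..a}"
        using iterated_integrable(2)[OF c1] by simp
      show "(\<lambda>y. (q - p)\<^sup>2 * integral {p..q} (\<lambda>x. (D1 v (x, y))\<^sup>2)) integrable_on {0..a}"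
        using iterated_integrable(2)[OF c2] by (intro integrable_on_mult_right)
      fix y
      show "integral {p..q} (\<lambda>x. (v (x, y) - v (e, y))\<^sup>2) \<le> (q - p)\<^sup>2 * integral {p..q} (\<lambda>x. (D1 v (x, y))\<^sup>2)"
        by (rule poincare_interval[OF D1_has_real_derivative[OF V(1)] c4 pq(2) e']) simp
    qed
    also have "\<dots> = (q - p)\<^sup>2 * integral ?S (\<lambda>z. (D1 v z)\<^sup>2)"
      unfolding integral_cbox_pair_iterated(2)[OF c2] by simp
    also have "\<dots> \<le> (q - p)\<^sup>2 * integral ?S (\<lambda>z. (norm (grad v z))\<^sup>2)"
      by (intro mult_left_mono integral_le integrable_continuous c2 c3) (auto simp: grad_def norm_prod_def)
    finally show ?thesis .
  qed
  have 2: "integral ?S (\<lambda>z. (k (e, snd z))\<^sup>2) \<le> (q - p) * (LINT z|boundary_measure a. (k z)\<^sup>2)"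
    if k: "continuous_on (frontier (square a)) k" "k \<in> borel_measurable borel" for k :: "real \<times> real \<Rightarrow> real"
  proof -
    have c: "continuous_on ?S (\<lambda>z. (k (e, snd z))\<^sup>2)"
      by (intro continuous_intros continuous_on_compose2[OF k(1)]) (use \<pi>(1) in auto)
    have "integral ?S (\<lambda>z. (k (e, snd z))\<^sup>2) = integral {0..a} (\<lambda>y. (q - p) * (k (e, y))\<^sup>2)"
      unfolding integral_cbox_pair_iterated(2)[OF c] using pq by simp
    also have "\<dots> = (q - p) * integral {0..a} (\<lambda>y. (k (e, y))\<^sup>2)" by simp
    also have "\<dots> \<le> (q - p) * (LINT z|boundary_measure a. (k z)\<^sup>2)"
      using side_integrals_le(2)[OF a k e(2)] pq by (intro mult_left_mono) auto
    finally show ?thesis .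
  qed
  show ?thesis
    unfolding boundary_strip_def using near \<pi> 1 2 by (intro conjI) (auto intro!: continuous_intros)
qed

lemma strip_around:
  assumes a: "a > 0" and z: "z \<in> square a" and r: "r > 0" "r = Min {fst z, a - fst z, snd z, a - snd z}"
  obtains S \<pi> where "boundary_strip a (2 * r) S \<pi>" "square_around z (r / 2) \<subseteq> S" "z \<in> S"
proof -
  obtain x y where xy: "z = (x, y)" by (cases z)
  have mi: "r \<le> x" "r \<le> a - x" "r \<le> y" "r \<le> a - y" "x = r \<or> a - x = r \<or> y = r \<or> a - y = r"
    unfolding r(2) xy by (auto simp: min_def)
  have ra: "2 * r \<le> a" using mi by linarith
  have sub: "square_around z (r / 2) \<subseteq> cbox (\<alpha>, \<gamma>) (\<beta>, \<delta>) \<and> z \<in> cbox (\<alpha>, \<gamma>) (\<beta>, \<delta>)"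
    if "\<alpha> \<le> x - r / 2" "x + r / 2 \<le> \<beta>" "\<gamma> \<le> y - r / 2" "y + r / 2 \<le> \<delta>" for \<alpha> \<beta> \<gamma> \<delta>
  proof -
    have "(s, t) \<in> cbox (\<alpha>, \<gamma>) (\<beta>, \<delta>)" if "(s, t) \<in> square_around z (r / 2)" for s t
    proof -
      have "s - x \<le> r / 2" "- (s - x) \<le> r / 2" "t - y \<le> r / 2" "- (t - y) \<le> r / 2"
        using that by (simp_all only: square_around_iff xy fst_conv snd_conv abs_le_iff)
      then show ?thesis unfolding mem_cbox_pair
        using \<open>\<alpha> \<le> x - r / 2\<close> \<open>x + r / 2 \<le> \<beta>\<close> \<open>\<gamma> \<le> y - r / 2\<close> \<open>y + r / 2 \<le> \<delta>\<close> by linarith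
    qed
    then have "square_around z (r / 2) \<subseteq> cbox (\<alpha>, \<gamma>) (\<beta>, \<delta>)" by auto
    moreover have "z \<in> square_around z (r / 2)" using r(1) unfolding xy square_around_iff by simp
    ultimately show ?thesis by blast
  qed
  from mi(5) consider "x = r" | "a - x = r" | "y = r" | "a - y = r" by blast
  then show ?thesis
  proof cases
    case 1
    show ?thesis
    proof (rule that)
      show "boundary_strip a (2 * r) (cbox (0, 0) (2 * r, a)) (\<lambda>z. (0, snd z))"
        using vertical_strip[OF a, of 0 "2 * r" 0] ra r(1) by simp
    qed (use sub[of 0 "2 * r" 0 a] 1 mi r(1) in auto)
  next
    case 2
    show ?thesis
    proof (rule that)
      show "boundary_strip a (2 * r) (cbox (a - 2 * r, 0) (a, a)) (\<lambda>z. (a, snd z))"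
        using vertical_strip[OF a, of "a - 2 * r" a a] ra r(1) by simp
    qed (use sub[of "a - 2 * r" a 0 a] 2 mi r(1) in auto)
  next
    case 3
    show ?thesis
    proof (rule that)
      show "boundary_strip a (2 * r) (cbox (0, 0) (a, 2 * r)) (\<lambda>z. (fst z, 0))"
        using horizontal_strip[OF a, of 0 "2 * r" 0] ra r(1) by simp
    qed (use sub[of 0 a 0 "2 * r"] 3 mi r(1) in auto)
  next
    case 4
    show ?thesis
    proof (rule that)
      show "boundary_strip a (2 * r) (cbox (0, a - 2 * r) (a, a)) (\<lambda>z. (fst z, a))"
        using horizontal_strip[OF a, of "a - 2 * r" a a] ra r(1) by simp
    qed (use sub[of 0 a "a - 2 * r" a] 4 mi r(1) in auto)
  qed
qed

section \<open>Boundary values of a minimizer\<close>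

lemma integral_le_lebesgue_square:
  fixes h :: "real \<times> real \<Rightarrow> real"
  assumes "integrable (lebesgue_on (square a)) h" "\<And>z. h z \<ge> 0" "cbox p q \<subseteq> square a" "continuous_on (cbox p q) h"
  shows "integral (cbox p q) h \<le> (LINT z|lebesgue_on (square a). h z)"
  unfolding lebesgue_integral_eq_integral[OF assms(1) square_lebesgue]
  using assms integrable_on_lebesgue_on[OF assms(1) square_lebesgue]
  by (intro integral_subset_le integrable_continuous) auto

lemma indicator_integrable_square:
  fixes h :: "real \<times> real \<Rightarrow> real"
  assumes "integrable (lebesgue_on (square a)) h" "S \<in> sets borel"
  shows "integrable (lebesgue_on (square a)) (\<lambda>z. indicator S z * h z)"
proof (rule Bochner_Integration.integrable_bound[OF assms(1)])
  have "(indicator S :: _ \<Rightarrow> real) \<in> borel_measurable lebesgue"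
    using assms(2) by (intro borel_measurable_indicator) auto
  then have "(indicator S :: _ \<Rightarrow> real) \<in> borel_measurable (lebesgue_on (square a))" by (rule measurable_restrict_space1)
  then show "(\<lambda>z. indicator S z * h z) \<in> borel_measurable (lebesgue_on (square a))"
    using borel_measurable_integrable[OF assms(1)] by (rule borel_measurable_times)
qed (auto intro!: AE_I2 simp: indicator_def)

lemma integral_strip_eq:
  fixes h :: "real \<times> real \<Rightarrow> real"
  assumes "continuous_on (cbox (0, 0) (a, a)) h" "cbox p q \<subseteq> cbox (0, 0) (a, a)"
  shows "integral (cbox p q) h = (LINT z|lebesgue_on (square a). indicator (cbox p q) z * h z)"
proof -
  have "integral (cbox p q) h = integral (cbox (0, 0) (a, a)) (\<lambda>z. if z \<in> cbox p q then h z else 0)"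
    unfolding integral_restrict_Int using assms(2) by (simp add: Int_absorb2)
  also have "\<dots> = integral (cbox (0, 0) (a, a)) (\<lambda>z. indicator (cbox p q) z * h z)"
    by (intro Henstock_Kurzweil_Integration.integral_cong) (simp add: indicator_def)
  also have "\<dots> = (LINT z|lebesgue_on (square a). indicator (cbox p q) z * h z)"
    by (rule lebesgue_square_eq_integral[symmetric], rule indicator_integrable_square[OF continuous_integrable_square[OF assms(1)]]) simp
  finally show ?thesis .
qed

text \<open>With approximating functions \<open>v\<close> from the definition of the trace, \<open>u - \<phi> \<circ> \<pi>\<close> is the sum of \<open>u - v\<close>, of
  \<open>v - v \<circ> \<pi>\<close> and of \<open>v \<circ> \<pi> - \<phi> \<circ> \<pi>\<close>. The outer two tend to zero in mean square, and the Poincare inequality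
  bounds the middle one by the energy of \<open>v\<close>, which converges to that of \<open>u\<close>.\<close>

theorem trace_strip:
  assumes u: "has_trace a u \<phi>" "continuous_on (square a) u" and \<phi>: "continuous_on (frontier (square a)) \<phi>"
    and S: "boundary_strip a d S \<pi>" and d: "d > 0" and B: "cbox p q \<subseteq> S" "cbox p q \<subseteq> square a"
  shows "integral (cbox p q) (\<lambda>z. (u z - \<phi> (\<pi> z))\<^sup>2) \<le>
    6 * d\<^sup>2 * (LINT z|lebesgue_on (square a). indicator S z * (norm (wgrad a u z))\<^sup>2)"
proof -
  let ?M = "lebesgue_on (square a)" and ?\<beta> = "boundary_measure a"
  have uW: "u \<in> W12 a" and \<phi>L: "\<phi> \<in> L2 ?\<beta>" using u(1) by (auto simp: has_trace_def)
  obtain v where v: "\<And>k. Ck_on 1 UNIV (v k)"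
    "(\<lambda>k. LINT z|?M. (v k z - u z)\<^sup>2) \<longlonglongrightarrow> 0"
    "(\<lambda>k. LINT z|?M. (norm (grad (v k) z - wgrad a u z))\<^sup>2) \<longlonglongrightarrow> 0"
    "(\<lambda>k. LINT z|?\<beta>. (v k z - \<phi> z)\<^sup>2) \<longlonglongrightarrow> 0"
    using u(1) by (auto simp: has_trace_def)
  define G where "G = (LINT z|?M. indicator S z * (norm (wgrad a u z))\<^sup>2)"
  define \<alpha> \<gamma> \<beta> where "\<alpha> k = (LINT z|?M. (v k z - u z)\<^sup>2)"
    and "\<gamma> k = (LINT z|?M. (norm (grad (v k) z - wgrad a u z))\<^sup>2)" and "\<beta> k = (LINT z|?\<beta>. (v k z - \<phi> z)\<^sup>2)" for k
  obtain p' q' where S': "S = cbox p' q'" using S by (auto simp: boundary_strip_def)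
  have Ssub: "S \<subseteq> cbox (0, 0) (a, a)" using S by (auto simp: boundary_strip_def near_boundary_def)
  have c\<pi>: "continuous_on S \<pi>" and \<pi>: "\<And>z. z \<in> S \<Longrightarrow> \<pi> z \<in> frontier (square a)" using S by (auto simp: boundary_strip_def)
  note S1 = S[unfolded boundary_strip_def, THEN conjunct2, THEN conjunct2, THEN conjunct2, THEN conjunct2]
  have gL: "wgrad a u \<in> L2 ?M" using W12D(2)[OF uW] by (simp add: weak_gradient_def)
  have main: "integral (cbox p q) (\<lambda>z. (u z - \<phi> (\<pi> z))\<^sup>2) \<le> 3 * \<alpha> k + 3 * (d\<^sup>2 * (2 * G + 2 * \<gamma> k)) + 3 * (d * \<beta> k)" for k
  proof -
    note V = Ck_on_1D[OF v(1)[of k]]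
    have cv: "continuous_on A (v k)" for A using continuous_on_subset[OF V(4)] by auto
    have c\<phi>: "continuous_on S (\<lambda>z. \<phi> (\<pi> z))" "continuous_on S (\<lambda>z. v k (\<pi> z))"
      using \<pi> by (auto intro!: continuous_on_compose2[OF \<phi> c\<pi>] continuous_on_compose2[OF cv c\<pi>, of UNIV])
    define P1 P2 P3 where "P1 z = (v k z - u z)\<^sup>2" and "P2 z = (v k z - v k (\<pi> z))\<^sup>2" and "P3 z = (v k (\<pi> z) - \<phi> (\<pi> z))\<^sup>2" for z
    have c1: "continuous_on (cbox p q) P1"
      unfolding P1_def using continuous_on_subset[OF u(2) B(2)] cv by (intro continuous_intros)
    have c2: "continuous_on S P2" "continuous_on S P3"
      unfolding P2_def P3_def using c\<phi> cv by (auto intro!: continuous_intros)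
    note c2' = continuous_on_subset[OF c2(1) B(1)] continuous_on_subset[OF c2(2) B(1)]
    have int: "P1 integrable_on cbox p q" "P2 integrable_on cbox p q" "P3 integrable_on cbox p q" "P2 integrable_on S" "P3 integrable_on S"
      using c1 c2 c2' unfolding S' by (auto intro: integrable_continuous)
    have "integral (cbox p q) (\<lambda>z. (u z - \<phi> (\<pi> z))\<^sup>2) \<le> integral (cbox p q) (\<lambda>z. 3 * P1 z + 3 * P2 z + 3 * P3 z)"
    proof (rule integral_le)
      show "(\<lambda>z. (u z - \<phi> (\<pi> z))\<^sup>2) integrable_on cbox p q"
        using continuous_on_subset[OF u(2) B(2)] continuous_on_subset[OF c\<phi>(1) B(1)]
        by (intro integrable_continuous continuous_intros)
      show "(\<lambda>z. 3 * P1 z + 3 * P2 z + 3 * P3 z) integrable_on cbox p q"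
        using int by (intro integrable_add integrable_on_mult_right) auto
      have "(A + B + C)\<^sup>2 \<le> 3 * A\<^sup>2 + 3 * B\<^sup>2 + 3 * C\<^sup>2" for A B C :: real
        using zero_le_power2[of "A - B"] zero_le_power2[of "A - C"] zero_le_power2[of "B - C"]
        by (simp add: power2_eq_square algebra_simps)
      note * = this[of "u z - v k z" "v k z - v k (\<pi> z)" "v k (\<pi> z) - \<phi> (\<pi> z)" for z]
      show "(u z - \<phi> (\<pi> z))\<^sup>2 \<le> 3 * P1 z + 3 * P2 z + 3 * P3 z" for z
        using *[of z] power2_commute[of "u z" "v k z"] by (simp add: P1_def P2_def P3_def)
    qed
    also have "\<dots> = 3 * integral (cbox p q) P1 + 3 * integral (cbox p q) P2 + 3 * integral (cbox p q) P3"
      using int by (simp add: Henstock_Kurzweil_Integration.integral_add integrable_add)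
    also have "\<dots> \<le> 3 * \<alpha> k + 3 * (d\<^sup>2 * (2 * G + 2 * \<gamma> k)) + 3 * (d * \<beta> k)"
    proof -
      have "integral (cbox p q) P1 \<le> \<alpha> k"
      proof -
        have "(\<lambda>z. v k z + (-1) *\<^sub>R u z) \<in> L2 ?M"
          by (rule L2_add_scaleR[OF continuous_L2[OF cv] W12D(1)[OF uW]])
        from L2D(2)[OF this] have "integrable ?M P1" by (simp add: P1_def[abs_def])
        then show ?thesis
          using integral_le_lebesgue_square[of a P1, OF _ _ B(2) c1] by (simp add: \<alpha>_def P1_def)
      qed
      moreover have "integral (cbox p q) P2 \<le> d\<^sup>2 * (2 * G + 2 * \<gamma> k)"
      proof -
        have gv: "grad (v k) \<in> L2 ?M" by (intro continuous_L2 continuous_grad v(1))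
        have "(\<lambda>z. grad (v k) z + (-1) *\<^sub>R wgrad a u z) \<in> L2 ?M" by (intro L2_add_scaleR gv gL)
        from L2D(2)[OF this] have gi: "integrable ?M (\<lambda>z. (norm (grad (v k) z - wgrad a u z))\<^sup>2)" by simp
        have "integral (cbox p q) P2 \<le> integral S P2"
          using int B(1) by (intro integral_subset_le) (auto simp: P2_def)
        also have "\<dots> \<le> d\<^sup>2 * integral S (\<lambda>z. (norm (grad (v k) z))\<^sup>2)"
          unfolding P2_def using S1 v(1)[of k] by blast
        also have "integral S (\<lambda>z. (norm (grad (v k) z))\<^sup>2) = (LINT z|?M. indicator S z * (norm (grad (v k) z))\<^sup>2)"
          unfolding S' using Ssub S' by (intro integral_strip_eq continuous_intros continuous_grad[OF v(1)]) auto
        also have "\<dots> \<le> (LINT z|?M. 2 * (indicator S z * (norm (wgrad a u z))\<^sup>2) + 2 * (norm (grad (v k) z - wgrad a u z))\<^sup>2)"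
        proof (rule integral_mono)
          show "integrable ?M (\<lambda>z. 2 * (indicator S z * (norm (wgrad a u z))\<^sup>2) + 2 * (norm (grad (v k) z - wgrad a u z))\<^sup>2)"
            using gi indicator_integrable_square[OF L2D(2)[OF gL], of S] by (simp add: S')
          show "integrable ?M (\<lambda>z. indicator S z * (norm (grad (v k) z))\<^sup>2)"
            using indicator_integrable_square[OF L2D(2)[OF gv], of S] by (simp add: S')
          fix z
          have "(norm (x + y))\<^sup>2 \<le> 2 * (norm x)\<^sup>2 + 2 * (norm y)\<^sup>2" for x y :: "real \<times> real"
          proof -
            have "(norm (x + y))\<^sup>2 \<le> (norm x + norm y)\<^sup>2" by (intro power_mono norm_triangle_ineq) auto
            also have "\<dots> \<le> 2 * (norm x)\<^sup>2 + 2 * (norm y)\<^sup>2"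
              using sum_squares_bound[of "norm x" "norm y"] by (simp add: power2_sum)
            finally show ?thesis .
          qed
          from this[of "wgrad a u z" "grad (v k) z - wgrad a u z"]
          show "indicator S z * (norm (grad (v k) z))\<^sup>2 \<le> 2 * (indicator S z * (norm (wgrad a u z))\<^sup>2) + 2 * (norm (grad (v k) z - wgrad a u z))\<^sup>2"
            by (auto simp: indicator_def)
        qed
        also have "\<dots> = 2 * G + 2 * \<gamma> k"
          using gi indicator_integrable_square[OF L2D(2)[OF gL], of S] by (simp add: S' G_def \<gamma>_def)
        finally show ?thesis by (simp add: mult_left_mono)
      qed
      moreover have "integral (cbox p q) P3 \<le> d * \<beta> k"
      proof -
        have "integral (cbox p q) P3 \<le> integral S P3"
          using int B(1) by (intro integral_subset_le) (auto simp: P3_def)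
        also have "\<dots> \<le> d * (LINT z|?\<beta>. ((\<lambda>z. v k z - \<phi> z) z)\<^sup>2)"
        proof -
          have "continuous_on (frontier (square a)) (\<lambda>z. v k z - \<phi> z)" using cv \<phi> by (intro continuous_on_diff)
          moreover have "\<phi> \<in> borel_measurable borel" using L2D(1)[OF \<phi>L] by (simp add: boundary_measure_def)
          then have "(\<lambda>z. v k z - \<phi> z) \<in> borel_measurable borel"
            using borel_measurable_continuous_onI[OF V(4)] by (intro borel_measurable_diff)
          ultimately show ?thesis unfolding P3_def using S1 by blast
        qed
        finally show ?thesis by (simp add: \<beta>_def)
      qed
      ultimately show ?thesis by simp
    qed
    finally show ?thesis .
  qed
  have "(\<lambda>k. 3 * \<alpha> k + 3 * (d\<^sup>2 * (2 * G + 2 * \<gamma> k)) + 3 * (d * \<beta> k)) \<longlonglongrightarrow> 3 * 0 + 3 * (d\<^sup>2 * (2 * G + 2 * 0)) + 3 * (d * 0)"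
    unfolding \<alpha>_def \<beta>_def \<gamma>_def by (intro tendsto_intros v(2-4))
  then have "(\<lambda>k. 3 * \<alpha> k + 3 * (d\<^sup>2 * (2 * G + 2 * \<gamma> k)) + 3 * (d * \<beta> k)) \<longlonglongrightarrow> 6 * d\<^sup>2 * G"
    by (simp add: mult.assoc)
  from LIMSEQ_le_const[OF this] main show ?thesis unfolding G_def by blast
qed

lemma near_boundary_borel: "near_boundary a d \<in> sets borel"
proof -
  have "near_boundary a d = cbox (0, 0) (a, a) - box (d, d) (a - d, a - d)"
    by (auto simp: near_boundary_def box_def Basis_prod_def)
  then show ?thesis by auto
qed

lemma strip_energy_small:
  fixes g :: "real \<times> real \<Rightarrow> real"
  assumes g: "integrable (lebesgue_on (square a)) g" "\<And>z. g z \<ge> 0" and "\<epsilon> > 0"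
  obtains \<delta> where "\<delta> > 0"
    "\<And>S. S \<in> sets borel \<Longrightarrow> S \<subseteq> near_boundary a \<delta> \<Longrightarrow> (LINT z|lebesgue_on (square a). indicator S z * g z) \<le> \<epsilon>"
proof -
  let ?M = "lebesgue_on (square a)"
  define N where "N n = near_boundary a (1 / real (Suc n))" for n
  have iN: "integrable ?M (\<lambda>z. indicator (N n) z * g z)" for n
    unfolding N_def by (rule indicator_integrable_square[OF g(1) near_boundary_borel])
  have "(\<lambda>n. LINT z|?M. indicator (N n) z * g z) \<longlonglongrightarrow> (LINT z|?M. 0)"
  proof (rule integral_dominated_convergence[where w = g])
    show "AE z in ?M. (\<lambda>n. indicator (N n) z * g z) \<longlonglongrightarrow> 0"
    proof (rule AE_I2)
      fix z assume "z \<in> space ?M"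
      then obtain x y where xy: "z = (x, y)" "0 < x" "x < a" "0 < y" "y < a" by (cases z) (auto simp: square_iff)
      define r where "r = min (min x (a - x)) (min y (a - y))"
      have "r > 0" using xy by (simp add: r_def)
      have "(\<lambda>n. 1 / real (Suc n)) \<longlonglongrightarrow> 0" using LIMSEQ_inverse_real_of_nat by (simp add: inverse_eq_divide)
      then have "\<forall>\<^sub>F n in sequentially. 1 / real (Suc n) < r" using \<open>r > 0\<close> by (rule order_tendstoD(2))
      then have "\<forall>\<^sub>F n in sequentially. indicator (N n) z * g z = 0"
      proof eventually_elim
        case (elim n)
        then have "1 / real (Suc n) < x" "x < a - 1 / real (Suc n)" "1 / real (Suc n) < y" "y < a - 1 / real (Suc n)"
          unfolding r_def by linarith+
        then have "z \<notin> N n" unfolding N_def near_boundary_def xy by simp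
        then show ?case by simp
      qed
      then show "(\<lambda>n. indicator (N n) z * g z) \<longlonglongrightarrow> 0" by (rule tendsto_eventually)
    qed
    show "AE z in ?M. norm (indicator (N n) z * g z) \<le> g z" for n
      using g(2) by (auto intro!: AE_I2 simp: indicator_def)
  qed (use g(1) iN in auto)
  then have "\<forall>\<^sub>F n in sequentially. (LINT z|?M. indicator (N n) z * g z) < \<epsilon>"
    using \<open>\<epsilon> > 0\<close> by (intro order_tendstoD(2)) auto
  then obtain n where n: "(LINT z|?M. indicator (N n) z * g z) < \<epsilon>" by (auto simp: eventually_sequentially)
  show ?thesis
  proof (rule that[of "1 / real (Suc n)"])
    fix S assume S: "S \<in> sets borel" "S \<subseteq> near_boundary a (1 / real (Suc n))"
    have "(LINT z|?M. indicator S z * g z) \<le> (LINT z|?M. indicator (N n) z * g z)"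
      using S(2) g(2) by (intro integral_mono iN indicator_integrable_square[OF g(1) S(1)])
        (auto simp: N_def indicator_def)
    then show "(LINT z|?M. indicator S z * g z) \<le> \<epsilon>" using n by simp
  qed simp
qed

lemma near_boundary_mono: "d \<le> d' \<Longrightarrow> near_boundary a d \<subseteq> near_boundary a d'"
  by (auto simp: near_boundary_def)

context smooth_minimizer
begin

lemma \<phi>_continuous: "l \<in> {1..m} \<Longrightarrow> continuous_on (frontier (square a)) (\<phi> l)"
  using data by (simp add: admissible_boundary_data_def)

text \<open>With \<open>r\<close> the distance of \<open>z\<close> from the boundary, \<open>trace_strip\<close> bounds the integral of \<open>(u l - \<phi> l \<circ> \<pi>)\<^sup>2\<close> over a
  square of size \<open>r\<close> by a multiple of \<open>r\<^sup>2\<close> times the energy in a strip of width \<open>2 r\<close>. The factor \<open>r\<^sup>2\<close> is the area of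
  the square, so that the mean is controlled by an energy that tends to zero with \<open>r\<close>.\<close>

lemma mean_oscillation_near_boundary:
  assumes l: "l \<in> {1..m}" and "\<epsilon> > 0"
  obtains \<delta> where "\<delta> > 0"
    "\<And>d z. d \<le> \<delta> \<Longrightarrow> z \<in> square a \<Longrightarrow> z \<in> near_boundary a d \<Longrightarrow> \<exists>\<xi> R. \<xi> \<in> frontier (square a) \<and> 0 < R \<and> R \<le> d \<and> dist z \<xi> \<le> 4 * R \<and>
      square_around z R \<subseteq> square a \<and> integral (square_around z R) (\<lambda>w. \<bar>u l w - \<phi> l \<xi>\<bar>) \<le> 54 * \<epsilon> * R\<^sup>2"
proof -
  note tr = u_trace[OF l]
  have gL: "wgrad a (u l) \<in> L2 M" using W12D(2)[OF u_W12[OF l]] by (simp add: weak_gradient_def)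
  obtain \<delta>1 where \<delta>1: "\<delta>1 > 0" "\<And>S. S \<in> sets borel \<Longrightarrow> S \<subseteq> near_boundary a \<delta>1 \<Longrightarrow>
      (LINT z|M. indicator S z * (norm (wgrad a (u l) z))\<^sup>2) \<le> \<epsilon>\<^sup>2"
    using strip_energy_small[OF L2D(2)[OF gL], of "\<epsilon>\<^sup>2"] \<open>\<epsilon> > 0\<close> by auto
  have "uniformly_continuous_on (frontier (square a)) (\<phi> l)"
    using compact_uniformly_continuous[OF \<phi>_continuous[OF l] compact_frontier_square] .
  then obtain \<delta>2 where \<delta>2: "\<delta>2 > 0" "\<And>x y. x \<in> frontier (square a) \<Longrightarrow> y \<in> frontier (square a) \<Longrightarrow> dist y x < \<delta>2 \<Longrightarrow> dist (\<phi> l y) (\<phi> l x) < \<epsilon>"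
    using \<open>\<epsilon> > 0\<close> unfolding uniformly_continuous_on_def by metis
  \<comment> \<open>the strip has width \<open>2 r\<close>, and projections of points of the square are at most \<open>5 r\<close> apart\<close>
  define \<delta> where "\<delta> = min (\<delta>1 / 2) (\<delta>2 / 10)"
  have \<delta>: "\<delta> > 0" "2 * \<delta> \<le> \<delta>1" "10 * \<delta> \<le> \<delta>2" using \<delta>1(1) \<delta>2(1) by (auto simp: \<delta>_def)
  show ?thesis
  proof (rule that[OF \<delta>(1)])
    fix d z assume d: "d \<le> \<delta>" and z: "z \<in> square a" "z \<in> near_boundary a d"
    obtain x y where xy: "z = (x, y)" by (cases z)
    define r where "r = Min {fst z, a - fst z, snd z, a - snd z}"
    have r: "r > 0" using z(1) by (simp add: r_def xy square_iff)
    have rd: "r \<le> d" using z(2) by (auto simp: r_def xy near_boundary_def min_def)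
    then have r\<delta>: "r \<le> \<delta>" using d by simp
    have rb: "r \<le> x" "r \<le> a - x" "r \<le> y" "r \<le> a - y" by (auto simp: r_def xy min_def)
    obtain S \<pi> where S: "boundary_strip a (2 * r) S \<pi>" "square_around z (r / 2) \<subseteq> S" "z \<in> S"
      using strip_around[OF a z(1) r r_def] by blast
    define R where "R = r / 2"
    have R: "R > 0" using r by (simp add: R_def)
    let ?B = "square_around z R"
    have BS: "?B \<subseteq> S" using S(2) by (simp add: R_def)
    have Bsq: "?B \<subseteq> square a"
    proof
      fix w assume w: "w \<in> ?B"
      obtain s t where st: "w = (s, t)" by (cases w)
      have "\<bar>s - x\<bar> \<le> r / 2" "\<bar>t - y\<bar> \<le> r / 2" using w unfolding st xy R_def by (simp_all add: square_around_iff)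
      then show "w \<in> square a" unfolding st square_iff using rb r by linarith
    qed
    have \<pi>: "\<pi> w \<in> frontier (square a)" "dist w (\<pi> w) \<le> 2 * r" if "w \<in> S" for w
      using S(1) that by (auto simp: boundary_strip_def)
    have c\<pi>: "continuous_on S \<pi>" using S(1) by (simp add: boundary_strip_def)
    obtain p' q' where S': "S = cbox p' q'" using S(1) by (auto simp: boundary_strip_def)
    define c where "c = \<phi> l (\<pi> z)"
    have osc: "\<bar>\<phi> l (\<pi> w) - c\<bar> \<le> \<epsilon>" if w: "w \<in> ?B" for w
    proof -
      have wS: "w \<in> S" using w BS by blast
      have "dist (fst w) (fst z) \<le> r / 2" "dist (snd w) (snd z) \<le> r / 2"
        using w by (cases w, simp add: square_around_iff dist_real_def R_def)+
      then have "dist w z \<le> r"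
        using sqrt_sum_squares_le_sum[of "dist (fst w) (fst z)" "dist (snd w) (snd z)"] by (simp add: dist_prod_def)
      then have "dist (\<pi> w) (\<pi> z) \<le> 5 * r"
        using \<pi>(2)[OF wS] \<pi>(2)[OF S(3)] dist_triangle[of "\<pi> w" "\<pi> z" w] dist_triangle[of w "\<pi> z" z]
        by (simp add: dist_commute)
      then have "dist (\<pi> w) (\<pi> z) < \<delta>2" using r\<delta> \<delta> r by linarith
      then have "dist (\<phi> l (\<pi> w)) (\<phi> l (\<pi> z)) < \<epsilon>" using \<delta>2(2) \<pi>(1)[OF wS] \<pi>(1)[OF S(3)] by blast
      then show ?thesis by (simp add: dist_real_def c_def)
    qed
    define D where "D w = u l w - \<phi> l (\<pi> w)" for w
    have cD: "continuous_on ?B D"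
      unfolding D_def using continuous_on_subset[OF u_continuous[OF l] Bsq]
        continuous_on_subset[OF continuous_on_compose2[OF \<phi>_continuous[OF l] c\<pi> image_subsetI[OF \<pi>(1)]] BS]
      by (rule continuous_on_diff)
    have int: "h integrable_on ?B" if "continuous_on ?B h" for h :: "real \<times> real \<Rightarrow> real"
      using that unfolding square_around_def by (rule integrable_continuous)
    have "S \<subseteq> near_boundary a \<delta>1"
      using S(1) near_boundary_mono[of "2 * r" \<delta>1 a] r\<delta> \<delta> by (auto simp: boundary_strip_def)
    then have G: "(LINT z|M. indicator S z * (norm (wgrad a (u l) z))\<^sup>2) \<le> \<epsilon>\<^sup>2" using \<delta>1(2)[of S] by (simp add: S')
    have "integral ?B (\<lambda>w. (D w)\<^sup>2) \<le> 6 * (2 * r)\<^sup>2 * (LINT z|M. indicator S z * (norm (wgrad a (u l) z))\<^sup>2)"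
      unfolding D_def square_around_def using BS Bsq r
      by (intro trace_strip[OF tr u_continuous[OF l] \<phi>_continuous[OF l] S(1)]) (auto simp: square_around_def)
    also have "\<dots> \<le> 6 * (2 * r)\<^sup>2 * \<epsilon>\<^sup>2" using G by (intro mult_left_mono) auto
    finally have D2: "integral ?B (\<lambda>w. (D w)\<^sup>2) \<le> 96 * R\<^sup>2 * \<epsilon>\<^sup>2" by (simp add: R_def power2_eq_square)
    have "integral ?B (\<lambda>w. \<bar>u l w - c\<bar>) \<le> integral ?B (\<lambda>w. 3 / 2 * \<epsilon> + 1 / (2 * \<epsilon>) * (D w)\<^sup>2)"
    proof (rule integral_le)
      show "(\<lambda>w. \<bar>u l w - c\<bar>) integrable_on ?B"
        using continuous_on_subset[OF u_continuous[OF l] Bsq] by (intro int continuous_intros)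
      show "(\<lambda>w. 3 / 2 * \<epsilon> + 1 / (2 * \<epsilon>) * (D w)\<^sup>2) integrable_on ?B"
        using cD by (intro int continuous_intros)
      fix w assume w: "w \<in> ?B"
      have "2 * \<bar>D w\<bar> * \<epsilon> \<le> (D w)\<^sup>2 + \<epsilon>\<^sup>2" using sum_squares_bound[of "\<bar>D w\<bar>" \<epsilon>] by simp
      then have "\<bar>D w\<bar> \<le> \<epsilon> / 2 + 1 / (2 * \<epsilon>) * (D w)\<^sup>2"
        using \<open>\<epsilon> > 0\<close> by (simp add: field_simps power2_eq_square)
      moreover have "\<bar>u l w - c\<bar> \<le> \<bar>D w\<bar> + \<epsilon>" using osc[OF w] unfolding D_def by linarith
      ultimately show "\<bar>u l w - c\<bar> \<le> 3 / 2 * \<epsilon> + 1 / (2 * \<epsilon>) * (D w)\<^sup>2" by linarith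
    qed
    also have "\<dots> = integral ?B (\<lambda>w. 3 / 2 * \<epsilon>) + integral ?B (\<lambda>w. 1 / (2 * \<epsilon>) * (D w)\<^sup>2)"
      using cD by (intro Henstock_Kurzweil_Integration.integral_add int continuous_intros)
    also have "integral ?B (\<lambda>w. 3 / 2 * \<epsilon>) = 4 * R\<^sup>2 * (3 / 2 * \<epsilon>)"
      using content_square_around[of R z] R by (simp add: square_around_def)
    also have "integral ?B (\<lambda>w. 1 / (2 * \<epsilon>) * (D w)\<^sup>2) = 1 / (2 * \<epsilon>) * integral ?B (\<lambda>w. (D w)\<^sup>2)"
      by (rule Henstock_Kurzweil_Integration.integral_mult_right)
    also have "\<dots> \<le> 1 / (2 * \<epsilon>) * (96 * R\<^sup>2 * \<epsilon>\<^sup>2)" using D2 \<open>\<epsilon> > 0\<close> by (intro mult_left_mono) auto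
    also have "\<dots> = 48 * R\<^sup>2 * \<epsilon>" using \<open>\<epsilon> > 0\<close> by (simp add: power2_eq_square)
    finally have "integral ?B (\<lambda>w. \<bar>u l w - c\<bar>) \<le> 54 * \<epsilon> * R\<^sup>2" by (simp add: algebra_simps)
    then show "\<exists>\<xi> R. \<xi> \<in> frontier (square a) \<and> 0 < R \<and> R \<le> d \<and> dist z \<xi> \<le> 4 * R \<and>
      square_around z R \<subseteq> square a \<and> integral (square_around z R) (\<lambda>w. \<bar>u l w - \<phi> l \<xi>\<bar>) \<le> 54 * \<epsilon> * R\<^sup>2"
      using \<pi>[OF S(3)] R Bsq rd r by (intro exI[of _ "\<pi> z"] exI[of _ R]) (auto simp: c_def R_def)
  qed
qed

text \<open>Subharmonicity of \<open>s (u l - c) + \<beta> \<bar>v - z\<bar>\<^sup>2\<close>. With \<open>s = 1\<close> and \<open>\<beta> = 0\<close> this bounds \<open>u l\<close> from above; with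
  \<open>s = -1\<close> and \<open>4 \<beta>\<close> an upper bound of the Laplacian it bounds \<open>u l\<close> from below.\<close>

lemma mean_value_estimate:
  assumes l: "l \<in> {1..m}" and sub: "square_around z R \<subseteq> square a" and R: "R > 0" and "\<beta> \<ge> 0" and s: "\<bar>s\<bar> = 1"
    and lap: "\<And>v. v \<in> square a \<Longrightarrow> s * laplacian (u l) v + 4 * \<beta> \<ge> 0"
    and I: "integral (square_around z R) (\<lambda>w. \<bar>u l w - c\<bar>) \<le> 54 * \<epsilon> * R\<^sup>2"
  shows "s * (u l z - c) \<le> 2916 * \<epsilon> + 432 * \<beta> * R\<^sup>2"
proof -
  define \<rho> where "\<rho> v = (fst v - fst z)\<^sup>2 + (snd v - snd z)\<^sup>2" for v :: "real \<times> real"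
  define q where "q v = \<beta> * \<rho> v + - s * c" for v
  have q: "Ck_on 2 (square a) q" "laplacian q v = 4 * \<beta>" for v unfolding q_def \<rho>_def by (rule quadratic_C2)+
  define w where "w v = s * u l v + 1 * q v" for v
  have weq: "w v = s * (u l v - c) + \<beta> * \<rho> v" for v by (simp add: w_def q_def algebra_simps)
  have \<rho>le: "0 \<le> \<rho> v \<and> \<rho> v \<le> 2 * R\<^sup>2" if "v \<in> square_around z R" for v
  proof -
    have "(fst v - fst z)\<^sup>2 \<le> R\<^sup>2" "(snd v - snd z)\<^sup>2 \<le> R\<^sup>2"
      using that R by (cases v, auto simp: square_around_iff intro!: power2_le_iff_abs_le[THEN iffD2])+
    then show ?thesis by (simp add: \<rho>_def)
  qed
  let ?B = "square_around z R"
  have int: "h integrable_on ?B" if "continuous_on ?B h" for h :: "real \<times> real \<Rightarrow> real"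
    using that unfolding square_around_def by (rule integrable_continuous)
  have cu: "continuous_on ?B (u l)" using continuous_on_subset[OF u_continuous[OF l] sub] .
  have cw: "continuous_on ?B w" unfolding weq[abs_def] \<rho>_def using cu by (intro continuous_intros)
  have "w z \<le> 54 / R\<^sup>2 * integral ?B (\<lambda>v. \<bar>w v\<bar>)"
  proof (rule subharmonic_le_mean[OF _ sub R])
    show "Ck_on 2 (square a) w" unfolding w_def by (rule Ck_on_lincomb[OF open_square smooth[OF l] q(1)])
    fix v assume "v \<in> ?B"
    then have v: "v \<in> square a" using sub by blast
    show "laplacian w v \<ge> 0"
      unfolding w_def laplacian_lincomb[OF open_square smooth[OF l] q(1) v] q(2) using lap[OF v] by simp
  qed
  also have "\<dots> \<le> 54 / R\<^sup>2 * (54 * \<epsilon> * R\<^sup>2 + 8 * \<beta> * R\<^sup>2 * R\<^sup>2)"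
  proof (rule mult_left_mono)
    have "integral ?B (\<lambda>v. \<bar>w v\<bar>) \<le> integral ?B (\<lambda>v. \<bar>u l v - c\<bar> + \<beta> * (2 * R\<^sup>2))"
    proof (rule integral_le)
      fix v assume v: "v \<in> ?B"
      have "\<beta> * \<rho> v \<le> \<beta> * (2 * R\<^sup>2)" "\<beta> * \<rho> v \<ge> 0" using \<rho>le[OF v] \<open>\<beta> \<ge> 0\<close> by (auto intro!: mult_left_mono)
      moreover have "\<bar>s * (u l v - c)\<bar> = \<bar>u l v - c\<bar>" using s by (simp add: abs_mult)
      ultimately show "\<bar>w v\<bar> \<le> \<bar>u l v - c\<bar> + \<beta> * (2 * R\<^sup>2)" unfolding weq by linarith
    qed (use cw cu in \<open>auto intro!: int continuous_intros\<close>)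
    also have "\<dots> = integral ?B (\<lambda>v. \<bar>u l v - c\<bar>) + integral ?B (\<lambda>v. \<beta> * (2 * R\<^sup>2))"
      using cu by (intro Henstock_Kurzweil_Integration.integral_add int continuous_intros)
    also have "integral ?B (\<lambda>v. \<beta> * (2 * R\<^sup>2)) = 4 * R\<^sup>2 * (\<beta> * (2 * R\<^sup>2))"
      using content_square_around[of R z] R by (simp add: square_around_def)
    finally show "integral ?B (\<lambda>v. \<bar>w v\<bar>) \<le> 54 * \<epsilon> * R\<^sup>2 + 8 * \<beta> * R\<^sup>2 * R\<^sup>2" using I by (simp add: algebra_simps)
  qed simp
  also have "\<dots> = 2916 * \<epsilon> + 432 * \<beta> * R\<^sup>2" using R by (simp add: field_simps)
  finally show ?thesis by (simp add: weq \<rho>_def)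
qed

text \<open>Near the boundary the bound follows from subharmonicity, in the interior from compactness. It bounds
  the reaction term, and with it the Laplacian, from above, as the lower estimate in \<open>boundary_values\<close>
  requires.\<close>

lemma u_bounded:
  assumes l: "l \<in> {1..m}"
  obtains K where "K \<ge> 0" "\<And>z. z \<in> square a \<Longrightarrow> u l z \<le> K"
proof -
  obtain \<delta> where \<delta>: "\<delta> > 0"
    "\<And>d z. d \<le> \<delta> \<Longrightarrow> z \<in> square a \<Longrightarrow> z \<in> near_boundary a d \<Longrightarrow> \<exists>\<xi> R. \<xi> \<in> frontier (square a) \<and> 0 < R \<and> R \<le> d \<and> dist z \<xi> \<le> 4 * R \<and>
      square_around z R \<subseteq> square a \<and> integral (square_around z R) (\<lambda>w. \<bar>u l w - \<phi> l \<xi>\<bar>) \<le> 54 * 1 * R\<^sup>2"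
    using mean_oscillation_near_boundary[OF l zero_less_one] by blast
  have "bounded (\<phi> l ` frontier (square a))"
    using \<phi>_continuous[OF l] compact_frontier_square compact_continuous_image compact_imp_bounded by blast
  then obtain K1 where K1: "\<And>z. z \<in> frontier (square a) \<Longrightarrow> \<phi> l z \<le> K1"
    unfolding bounded_iff by (metis abs_le_D1 imageI real_norm_def)
  have sub: "cbox (\<delta>, \<delta>) (a - \<delta>, a - \<delta>) \<subseteq> square a"
    using \<delta>(1) by (auto simp: mem_cbox_pair square_iff simp del: cbox_interval)
  have "bounded (u l ` cbox (\<delta>, \<delta>) (a - \<delta>, a - \<delta>))"
    by (intro compact_imp_bounded compact_continuous_image continuous_on_subset[OF u_continuous[OF l] sub] compact_cbox)
  then obtain K2 where K2: "\<And>z. z \<in> cbox (\<delta>, \<delta>) (a - \<delta>, a - \<delta>) \<Longrightarrow> u l z \<le> K2"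
    unfolding bounded_iff by (metis abs_le_D1 imageI real_norm_def)
  have "u l z \<le> \<bar>K1\<bar> + 2916 + \<bar>K2\<bar>" if z: "z \<in> square a" for z
  proof (cases "z \<in> near_boundary a \<delta>")
    case True
    then obtain \<xi> R where "\<xi> \<in> frontier (square a)" "0 < R" "square_around z R \<subseteq> square a"
      "integral (square_around z R) (\<lambda>w. \<bar>u l w - \<phi> l \<xi>\<bar>) \<le> 54 * 1 * R\<^sup>2"
      using \<delta>(2)[OF order_refl z] by blast
    then show ?thesis
      using mean_value_estimate[OF l, of z R 0 1 "\<phi> l \<xi>" 1] K1[of \<xi>] laplacian_bounds(1)[OF l] by simp
  next
    case False
    then have "z \<in> cbox (\<delta>, \<delta>) (a - \<delta>, a - \<delta>)"
      using z square_subset_closed[of a] by (cases z) (auto simp: near_boundary_def mem_cbox_pair subset_eq simp del: cbox_interval)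
    from K2[OF this] show ?thesis by simp
  qed
  then show ?thesis using that[of "\<bar>K1\<bar> + 2916 + \<bar>K2\<bar>"] by simp
qed

theorem boundary_values:
  assumes l: "l \<in> {1..m}" and "\<epsilon> > 0"
  shows "\<forall>\<^sub>F d in at_right 0. \<forall>z\<in>near_boundary a d. \<forall>\<xi>\<in>frontier (square a). dist z \<xi> \<le> d \<longrightarrow> \<bar>u l z - \<phi> l \<xi>\<bar> \<le> \<epsilon>"
proof -
  obtain K where K: "K \<ge> 0" "\<And>z. z \<in> square a \<Longrightarrow> u l z \<le> K" using u_bounded[OF l] by blast
  obtain L where L: "monotone_reaction a L (f l)" using reaction[OF l] by blast
  obtain F where F: "F \<ge> 0" "\<And>x s. x \<in> square a \<Longrightarrow> 0 \<le> s \<Longrightarrow> s \<le> K \<Longrightarrow> f l x s \<le> F"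
    using monotone_reaction_bounded[OF L K(1)] by blast
  have lapF: "laplacian (u l) v \<le> F" if "v \<in> square a" for v
    using laplacian_bounds(2)[OF l that] F(2)[OF that u_nonneg[OF l that] K(2)[OF that]] by simp
  \<comment> \<open>\<open>2916\<close> is the constant of \<open>mean_value_estimate\<close>; each of its two uses may contribute \<open>\<epsilon> / 4\<close>\<close>
  define \<epsilon>' where "\<epsilon>' = \<epsilon> / 2 / (2916 * 2)"
  have \<epsilon>': "\<epsilon>' > 0" "2916 * \<epsilon>' = \<epsilon> / 4" using \<open>\<epsilon> > 0\<close> by (simp_all add: \<epsilon>'_def)
  obtain \<delta> where \<delta>: "\<delta> > 0"
    "\<And>d z. d \<le> \<delta> \<Longrightarrow> z \<in> square a \<Longrightarrow> z \<in> near_boundary a d \<Longrightarrow> \<exists>\<xi> R. \<xi> \<in> frontier (square a) \<and> 0 < R \<and> R \<le> d \<and> dist z \<xi> \<le> 4 * R \<and>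
      square_around z R \<subseteq> square a \<and> integral (square_around z R) (\<lambda>w. \<bar>u l w - \<phi> l \<xi>\<bar>) \<le> 54 * \<epsilon>' * R\<^sup>2"
    using mean_oscillation_near_boundary[OF l \<epsilon>'(1)] by blast
  have "uniformly_continuous_on (frontier (square a)) (\<phi> l)"
    using compact_uniformly_continuous[OF \<phi>_continuous[OF l] compact_frontier_square] .
  then obtain \<eta> where \<eta>: "\<eta> > 0" "\<And>x y. x \<in> frontier (square a) \<Longrightarrow> y \<in> frontier (square a) \<Longrightarrow> dist y x < \<eta> \<Longrightarrow> dist (\<phi> l y) (\<phi> l x) < \<epsilon> / 2"
    using \<open>\<epsilon> > 0\<close> unfolding uniformly_continuous_on_def by (metis half_gt_zero)
  \<comment> \<open>the last two bounds make the term \<open>108 F R\<^sup>2\<close> at most \<open>\<epsilon> / 4\<close> for \<open>R \<le> d0\<close>\<close>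
  define d0 where "d0 = min (min \<delta> (\<eta> / 10)) (min 1 (\<epsilon> / (4 * (108 * F + 1))))"
  have d0: "d0 > 0" using \<delta>(1) \<eta>(1) F(1) \<open>\<epsilon> > 0\<close> by (simp add: d0_def)
  have main: "\<bar>u l z - \<phi> l \<xi>\<bar> \<le> \<epsilon>"
    if d: "d < d0" and z: "z \<in> near_boundary a d" and \<xi>: "\<xi> \<in> frontier (square a)" "dist z \<xi> \<le> d" for d z \<xi>
  proof -
    have d': "d < \<delta>" "d < \<eta> / 10" "d < 1" "d < \<epsilon> / (4 * (108 * F + 1))" using d by (simp_all add: d0_def)
    have dn: "d \<ge> 0" using \<xi>(2) zero_le_dist order_trans by blast
    have zc: "z \<in> cbox (0, 0) (a, a)" using z by (simp add: near_boundary_def)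
    from a zc show ?thesis
    proof (cases rule: closed_square_cases)
      case 1
      obtain \<xi>0 R where R: "\<xi>0 \<in> frontier (square a)" "0 < R" "R \<le> d" "dist z \<xi>0 \<le> 4 * R" "square_around z R \<subseteq> square a"
        "integral (square_around z R) (\<lambda>w. \<bar>u l w - \<phi> l \<xi>0\<bar>) \<le> 54 * \<epsilon>' * R\<^sup>2"
        using \<delta>(2)[OF less_imp_le[OF d'(1)] 1 z] by blast
      have "u l z - \<phi> l \<xi>0 \<le> \<epsilon> / 4"
        using mean_value_estimate[OF l R(5,2), of 0 1 "\<phi> l \<xi>0" \<epsilon>'] R(6) laplacian_bounds(1)[OF l] \<epsilon>'(2) by simp
      moreover have "\<phi> l \<xi>0 - u l z \<le> \<epsilon> / 4 + 108 * F * R\<^sup>2"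
        using mean_value_estimate[OF l R(5,2), of "F / 4" "-1" "\<phi> l \<xi>0" \<epsilon>'] R(6) lapF F(1) \<epsilon>'(2) by simp
      moreover have "108 * F * R\<^sup>2 \<le> \<epsilon> / 4"
      proof -
        have "R\<^sup>2 \<le> R * 1" unfolding power2_eq_square using R(2,3) d'(3) by (intro mult_left_mono) auto
        then have "108 * F * R\<^sup>2 \<le> (108 * F + 1) * d" using R(2,3) F(1) by (intro mult_mono) auto
        also have "\<dots> \<le> (108 * F + 1) * (\<epsilon> / (4 * (108 * F + 1)))" using d'(4) F(1) by (intro mult_left_mono) auto
        also have "\<dots> = \<epsilon> / 4"
        proof -
          have "108 * F + 1 \<noteq> 0" using F(1) by linarith
          then show ?thesis by (simp add: field_simps)
        qed
        finally show ?thesis .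
      qed
      moreover have "dist (\<phi> l \<xi>) (\<phi> l \<xi>0) < \<epsilon> / 2"
      proof (rule \<eta>(2)[OF R(1) \<xi>(1)])
        have "dist \<xi> \<xi>0 \<le> d + 4 * R" using dist_triangle[of \<xi> \<xi>0 z] \<xi>(2) R(4) by (simp add: dist_commute)
        then show "dist \<xi> \<xi>0 < \<eta>" using R(3) d'(2) \<eta>(1) by linarith
      qed
      ultimately show ?thesis unfolding dist_real_def by linarith
    next
      case 2
      have "dist z \<xi> < \<eta>" using \<xi>(2) d'(2) \<eta>(1) by linarith
      then have "dist (\<phi> l z) (\<phi> l \<xi>) < \<epsilon> / 2" by (rule \<eta>(2)[OF \<xi>(1) 2])
      then show ?thesis using u_boundary[OF l 2] \<open>\<epsilon> > 0\<close> by (simp add: dist_real_def)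
    qed
  qed
  have "\<forall>\<^sub>F d in at_right 0. d < d0" using eventually_at_right_real[OF d0] by (rule eventually_mono) simp
  then show ?thesis by eventually_elim (use main in blast)
qed

end

section \<open>Convergence of the scheme\<close>

lemma discrete_laplacian_excess:
  "discrete_laplacian h (excess m w l) z = discrete_laplacian h (w l) z - (\<Sum>p\<in>{1..m} - {l}. discrete_laplacian h (w p) z)"
proof -
  have "excess m w l = (\<lambda>z. w l z - (\<Sum>p\<in>{1..m} - {l}. w p z))" by (simp add: excess_def fun_eq_iff)
  then show ?thesis
    by (simp only: discrete_laplacian_def neighbour_average_diff neighbour_average_sum sum_distrib_left right_diff_distrib
        sum_subtractf)
qed

lemma frontier_subset_near_boundary:
  assumes "a > 0" "d \<ge> 0"
  shows "frontier (square a) \<subseteq> near_boundary a d"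
  using assms by (auto simp: frontier_square near_boundary_def square_iff)

context smooth_minimizer
begin

lemma segregated_closed:
  assumes "z \<in> cbox (0, 0) (a, a)"
  shows "segregated_at m u z"
  using a assms
proof (cases rule: closed_square_cases)
  case 1
  then show ?thesis by (rule u_segregated)
next
  case 2
  then show ?thesis
    using data u_boundary[OF _ 2] unfolding segregated_at_def admissible_boundary_data_def by auto
qed

lemma laplacian_excess:
  assumes l: "l \<in> {1..m}" and z: "z \<in> square a"
  shows "laplacian (u l) z - (\<Sum>p\<in>{1..m} - {l}. laplacian (u p) z) \<le> f l z (u l z)"
    and "u l z > 0 \<Longrightarrow> laplacian (u l) z - (\<Sum>p\<in>{1..m} - {l}. laplacian (u p) z) = f l z (u l z)"
proof -
  have "(\<Sum>p\<in>{1..m} - {l}. laplacian (u p) z) \<ge> 0"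
    using laplacian_bounds(1) z by (intro sum_nonneg) auto
  then show "laplacian (u l) z - (\<Sum>p\<in>{1..m} - {l}. laplacian (u p) z) \<le> f l z (u l z)"
    using laplacian_bounds(2)[OF l z] by linarith
  assume pos: "u l z > 0"
  have "(\<Sum>p\<in>{1..m} - {l}. laplacian (u p) z) = 0"
    using laplacian_other_zero[OF l _ z pos] by (intro sum.neutral) blast
  then show "laplacian (u l) z - (\<Sum>p\<in>{1..m} - {l}. laplacian (u p) z) = f l z (u l z)"
    using euler_lagrange[OF l z pos] by simp
qed

text \<open>The width \<open>d\<close> of the boundary layer is fixed first, so that both families are close to the boundary
  data in the layer for every mesh; only then is the mesh refined to make the consistency error small
  outside the layer.\<close>

theorem uniform_convergence:
  assumes m: "m \<ge> 1" and uh: "\<And>N. N \<ge> 1 \<Longrightarrow> discrete_solution a m f \<phi> N (uh N)" and "\<epsilon> > 0"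
  shows "\<forall>\<^sub>F N in sequentially. \<forall>z\<in>mesh a N. deviation m (uh N) u z \<le> \<epsilon>"
proof -
  define \<epsilon>1 where "\<epsilon>1 = \<epsilon> / (4 * real m)"
  have \<epsilon>1: "\<epsilon>1 > 0" "real m * (2 * \<epsilon>1) = \<epsilon> / 2" using m \<open>\<epsilon> > 0\<close> by (simp_all add: \<epsilon>1_def)
  define \<kappa> where "\<kappa> = \<epsilon> / (4 * a\<^sup>2)"
  have \<kappa>: "\<kappa> > 0" "2 * \<kappa> * a\<^sup>2 = \<epsilon> / 2" using a \<open>\<epsilon> > 0\<close> by (simp_all add: \<kappa>_def)
  have "\<forall>\<^sub>F d in at_right 0. 0 < d \<and>
    (\<forall>l\<in>{1..m}. \<forall>N\<ge>1. \<forall>U. discrete_solution a m f \<phi> N U \<longrightarrow>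
      (\<forall>z\<in>mesh a N \<inter> near_boundary a d. \<exists>\<xi>\<in>frontier (square a). dist z \<xi> \<le> d \<and> \<bar>U l z - \<phi> l \<xi>\<bar> \<le> \<epsilon>1)) \<and>
    (\<forall>l\<in>{1..m}. \<forall>z\<in>near_boundary a d. \<forall>\<xi>\<in>frontier (square a). dist z \<xi> \<le> d \<longrightarrow> \<bar>u l z - \<phi> l \<xi>\<bar> \<le> \<epsilon>1)"
    using scheme_boundary_values[OF a reaction data _ \<epsilon>1(1)] boundary_values[OF _ \<epsilon>1(1)]
    by (intro eventually_conj eventually_at_right_less eventually_ball_finite) auto
  from eventually_happens'[OF trivial_limit_at_right_real this] obtain d where d: "d > 0"
    and dU: "\<And>l N U z. l \<in> {1..m} \<Longrightarrow> N \<ge> 1 \<Longrightarrow> discrete_solution a m f \<phi> N U \<Longrightarrow> z \<in> mesh a N \<Longrightarrow> z \<in> near_boundary a d \<Longrightarrow>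
        \<exists>\<xi>\<in>frontier (square a). dist z \<xi> \<le> d \<and> \<bar>U l z - \<phi> l \<xi>\<bar> \<le> \<epsilon>1"
    and du: "\<And>l z \<xi>. l \<in> {1..m} \<Longrightarrow> z \<in> near_boundary a d \<Longrightarrow> \<xi> \<in> frontier (square a) \<Longrightarrow> dist z \<xi> \<le> d \<Longrightarrow> \<bar>u l z - \<phi> l \<xi>\<bar> \<le> \<epsilon>1"
    by blast
  have "\<kappa> / real m > 0" using \<kappa>(1) m by simp
  then have "\<forall>\<^sub>F h in at_right 0. \<forall>l\<in>{1..m}. \<forall>z\<in>cbox (d, d) (a - d, a - d). \<bar>discrete_laplacian h (u l) z - laplacian (u l) z\<bar> \<le> \<kappa> / real m"
    using discrete_laplacian_consistent[OF smooth d] by (intro eventually_ball_finite) auto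
  moreover have "filterlim (\<lambda>N. a / real N) (at_right 0) sequentially"
  proof (rule filterlim_at_withinI)
    show "(\<lambda>N. a / real N) \<longlonglongrightarrow> 0" by (rule lim_const_over_n)
    show "\<forall>\<^sub>F N in sequentially. a / real N \<in> {0<..} - {0}"
      using eventually_gt_at_top[of 0] by eventually_elim (use a in simp)
  qed
  ultimately have "\<forall>\<^sub>F N in sequentially. \<forall>l\<in>{1..m}. \<forall>z\<in>cbox (d, d) (a - d, a - d).
      \<bar>discrete_laplacian (a / real N) (u l) z - laplacian (u l) z\<bar> \<le> \<kappa> / real m"
    by (rule eventually_compose_filterlim)
  then show ?thesis
    using eventually_ge_at_top[of 1]
  proof eventually_elim
    case (elim N)
    interpret scheme a m f \<phi> N "uh N"
      using a elim(2) reaction data uh[OF elim(2)] by unfold_locales auto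
    define G where "G = - near_boundary a d"
    have G: "z \<in> square a" "z \<in> cbox (d, d) (a - d, a - d)" if "z \<in> mesh_interior a N \<inter> G" for z
    proof -
      show z: "z \<in> square a" using that mesh_interior_subset_square[OF a, of N] by blast
      then have "z \<in> cbox (0, 0) (a, a)" using square_subset_closed by blast
      then show "z \<in> cbox (d, d) (a - d, a - d)"
        using that by (cases z) (simp add: G_def near_boundary_def mem_cbox_pair del: cbox_interval)
    qed
    have consistent: "\<bar>discrete_laplacian h (excess m u l) z - (laplacian (u l) z - (\<Sum>p\<in>{1..m} - {l}. laplacian (u p) z))\<bar> \<le> \<kappa>"
      if l: "l \<in> {1..m}" and z: "z \<in> mesh_interior a N \<inter> G" for l z
    proof -
      define e where "e p = discrete_laplacian h (u p) z - laplacian (u p) z" for p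
      have e: "\<bar>e p\<bar> \<le> \<kappa> / real m" if "p \<in> {1..m}" for p using elim(1) that G(2)[OF z] by (simp add: e_def)
      have "discrete_laplacian h (excess m u l) z - (laplacian (u l) z - (\<Sum>p\<in>{1..m} - {l}. laplacian (u p) z))
        = e l - (\<Sum>p\<in>{1..m} - {l}. e p)"
        by (simp add: discrete_laplacian_excess e_def sum_subtractf)
      also have "\<bar>\<dots>\<bar> \<le> \<bar>e l\<bar> + (\<Sum>p\<in>{1..m} - {l}. \<bar>e p\<bar>)"
        using sum_abs[of e "{1..m} - {l}"] by linarith
      also have "\<dots> = (\<Sum>p\<in>{1..m}. \<bar>e p\<bar>)" using sum.remove[OF finite_atLeastAtMost l, of "\<lambda>p. \<bar>e p\<bar>"] by simp
      also have "\<dots> \<le> (\<Sum>p\<in>{1..m}. \<kappa> / real m)" by (intro sum_mono e)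
      also have "\<dots> = \<kappa>" using m by simp
      finally show ?thesis .
    qed
    have near: "deviation m (uh N) u z \<le> \<epsilon> / 2" if z: "z \<in> mesh a N - (mesh_interior a N \<inter> G)" for z
    proof -
      have zn: "z \<in> near_boundary a d"
        using z mesh_boundary_subset_frontier[OF a N] frontier_subset_near_boundary[OF a, of d] d
        by (auto simp: G_def mesh_boundary_def)
      have "deviation m (uh N) u z \<le> (\<Sum>l\<in>{1..m}. 2 * \<epsilon>1)"
        unfolding deviation_def
      proof (rule sum_mono)
        fix l assume l: "l \<in> {1..m}"
        obtain \<xi> where "\<xi> \<in> frontier (square a)" "dist z \<xi> \<le> d" "\<bar>uh N l z - \<phi> l \<xi>\<bar> \<le> \<epsilon>1"
          using dU[OF l N uh[OF N] _ zn] z by blast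
        then show "\<bar>uh N l z - u l z\<bar> \<le> 2 * \<epsilon>1" using du[OF l zn] by fastforce
      qed
      then show ?thesis using \<epsilon>1(2) by simp
    qed
    show ?case
    proof
      fix z assume z: "z \<in> mesh a N"
      have "deviation m (uh N) u z \<le> \<epsilon> / 2 + 2 * \<kappa> * a\<^sup>2"
      proof (rule discrete_comparison[where F = f and \<tau> = \<kappa> and G = G, OF a N segregated _ _ _ _ _ _ near _ _ _ z])
        show "segregated_at m u w" if "w \<in> mesh a N" for w
          using that mesh_subset_closed_square[OF a] segregated_closed by blast
        show "mono_on {0..} (f l w)" if "l \<in> {1..m}" "w \<in> square a" for l w
        proof -
          obtain L where L: "monotone_reaction a L (f l)" using reaction[OF \<open>l \<in> {1..m}\<close>] by blast
          show ?thesis by (rule mono_onI) (use monotone_reactionD(3)[OF L that(2)] in auto)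
        qed
        fix l w assume l: "l \<in> {1..m}" and w: "w \<in> mesh_interior a N \<inter> G"
        show "discrete_laplacian h (excess m (uh N) l) w \<le> f l w (uh N l w)"
          using discrete_laplacian_excess_le[OF l] w by blast
        show "discrete_laplacian h (excess m (uh N) l) w \<ge> f l w (uh N l w)" if "uh N l w > 0"
          using discrete_laplacian_excess_eq[OF l _ that] w by simp
        show "discrete_laplacian h (excess m u l) w \<le> f l w (u l w) + \<kappa>"
          using consistent[OF l w] laplacian_excess(1)[OF l G(1)[OF w]] by linarith
        show "discrete_laplacian h (excess m u l) w \<ge> f l w (u l w) - \<kappa>" if "u l w > 0"
          using consistent[OF l w] laplacian_excess(2)[OF l G(1)[OF w] that] by linarith
      qed (use \<kappa> \<open>\<epsilon> > 0\<close> in auto)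
      then show "deviation m (uh N) u z \<le> \<epsilon>" using \<kappa>(2) by simp
    qed
  qed
qed

end

theorem corollary1:
  fixes a :: real and m :: nat
    and f :: "nat \<Rightarrow> real \<times> real \<Rightarrow> real \<Rightarrow> real"
    and \<phi> u :: "nat \<Rightarrow> real \<times> real \<Rightarrow> real"
    and uh :: "nat \<Rightarrow> nat \<Rightarrow> real \<times> real \<Rightarrow> real"
  assumes "a > 0" and "m \<ge> 2"
    and "admissible_dynamics a m f"
    and "admissible_boundary_data a m \<phi>"
    and "\<forall>l\<in>{1..m}. \<forall>x\<in>square a. mono_on {0..} (f l x)"
    and "minimizer a m f \<phi> u"
    and "\<forall>l\<in>{1..m}. Ck_on 2 (square a) (u l)"
    and "\<forall>N\<ge>1. discrete_solution a m f \<phi> N (uh N)"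
  shows "\<forall>l\<in>{1..m}.
    (\<lambda>N. Max ((\<lambda>z. \<bar>u l z - uh N l z\<bar>) ` mesh a N)) \<longlonglongrightarrow> 0"
proof
  fix l assume l: "l \<in> {1..m}"
  interpret smooth_minimizer a m f \<phi> u
  proof
    show "\<exists>L. monotone_reaction a L (f l)" if "l \<in> {1..m}" for l
      using admissible_monotone_reaction[OF assms(3,5) that] by blast
    show "Ck_on 2 (square a) (u l)" if "l \<in> {1..m}" for l using assms(7) that by blast
  qed (rule assms)+
  define E where "E N = Max ((\<lambda>z. \<bar>u l z - uh N l z\<bar>) ` mesh a N)" for N
  have fin: "finite ((\<lambda>z. \<bar>u l z - uh N l z\<bar>) ` mesh a N)" "(\<lambda>z. \<bar>u l z - uh N l z\<bar>) ` mesh a N \<noteq> {}" for N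
    using finite_mesh mesh_nonempty by auto
  have "E \<longlonglongrightarrow> 0"
  proof (rule tendstoI)
    fix \<epsilon> :: real assume "\<epsilon> > 0"
    then have "\<forall>\<^sub>F N in sequentially. \<forall>z\<in>mesh a N. deviation m (uh N) u z \<le> \<epsilon> / 2"
      using assms(2,8) by (intro uniform_convergence) auto
    then show "\<forall>\<^sub>F N in sequentially. dist (E N) 0 < \<epsilon>"
    proof eventually_elim
      case (elim N)
      have "\<bar>u l z - uh N l z\<bar> \<le> \<epsilon> / 2" if "z \<in> mesh a N" for z
      proof -
        have "\<bar>uh N l z - u l z\<bar> \<le> deviation m (uh N) u z"
          unfolding deviation_def using l by (intro member_le_sum) auto
        then show ?thesis using elim that by (force simp: abs_minus_commute)
      qed
      then have "E N \<le> \<epsilon> / 2" unfolding E_def using fin by (subst Max_le_iff) auto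
      moreover have "E N \<ge> 0"
      proof -
        have "E N \<in> (\<lambda>z. \<bar>u l z - uh N l z\<bar>) ` mesh a N" unfolding E_def by (rule Max_in[OF fin])
        then show ?thesis by auto
      qed
      ultimately show ?case using \<open>\<epsilon> > 0\<close> by simp
    qed
  qed
  then show "(\<lambda>N. Max ((\<lambda>z. \<bar>u l z - uh N l z\<bar>) ` mesh a N)) \<longlonglongrightarrow> 0" unfolding E_def .
qed

end
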